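(* Let $K$ be a Barański carpet such that for both $j=1,2$ the projection $\eta_j(K)$ satisfies the strong separation condition and $\Omega_j\neq\varnothing$. Suppose that for one of $j=1,2$, with $j'$ denoting the other index, $d_j<d_{j'}$ and $\dim_{\mathrm B}\eta_j(K)+t_j>\dim_{\mathrm B}\eta_{j'}(K)+t_{j'}$. Then $$\dim_{\mathrm H}\{x\in K:\dim_{\mathrm A}(K,x)=\dim_{\mathrm A} K\}<\dim_{\mathrm H} K.$$
   Context: **Barański carpets.** Let $\mathcal{I}$ be a finite index set with $\#\mathcal{I}\geq 2$. For $i\in\mathcal{I}$, $j\in\{1,2\}$ let $\beta_{i,j}\in(0,1)$, $d_{i,j}\in\mathbb{R}$, put $S_{i,j}(t)=\beta_{i,j}t+d_{i,j}$ and $T_i(x_1,x_2)=(S_{i,1}(x_1),S_{i,2}(x_2))$. The attractor $K$ is the unique non-empty compact set with $K=\bigcup_{i\in\mathcal{I}}T_i(K)$; it is assumed throughout that $K\subset[0,1]^2$. $K$ is a Barański carpet if: (1) $T_i((0,1)^2)\cap T_j((0,1)^2)=\varnothing$ for all $i\neq j$; (2) for all $i,j\in\mathcal{I}$ and $\ell\in\{1,2\}$ either $S_{i,\ell}((0,1))=S_{j,\ell}((0,1))$ or $S_{i,\ell}((0,1))\cap S_{j,\ell}((0,1))=\varnothing$. **Projections.** $\eta_j\colon\mathbb{R}^2\to\mathbb{R}$ is the projection onto the $j$-th coordinate. On $\mathcal{I}$ write $i\sim_j i'$ if $S_{i,j}=S_{i',j}$, and let $\eta_j\colon\mathcal{I}\to\mathcal{I}/{\sim_j}=:\eta_j(\mathcal{I})$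 be the quotient map. $\eta_j(K)$ is the attractor of the IFS of the distinct maps $S_{\underline{\ell},j}$, $\underline{\ell}\in\eta_j(\mathcal{I})$; it "satisfies the strong separation condition" if $S_{\underline{\ell},j}(\eta_j(K))\cap S_{\underline{\ell}',j}(\eta_j(K))=\varnothing$ for all $\underline{\ell}\neq\underline{\ell}'$. For $j\in\{1,2\}$, $j'$ denotes the other element of $\{1,2\}$. **Entropy notation.** $\mathcal{P}$ is the set of probability vectors on $\mathcal{I}$. For $\bm{w}\in\mathcal{P}$, $\eta_j(\bm{w})$ is the probability vector on $\eta_j(\mathcal{I})$ with entries $\eta_j(\bm{w})_{\underline{\ell}}=\sum_{i\in\eta_j^{-1}(\underline{\ell})}w_i$; $H$ is Shannon entropy, $H(\bm{p})=-\sum p_i\log p_i$; $\chi_j(\bm{w})=-\sum_{i\in\mathcal{I}}w_i\log\beta_{i,j}$. Let $\mathcal{P}_j=\{\bm{w}\in\mathcal{P}:\chi_j(\bm{w})\leq\chi_{j'}(\bm{w})\}$ and $$d_j=\max_{\bm{w}\in\mathcal{P}_j}\left(\frac{H(\eta_j(\bm{w}))}{\chi_j(\bm{w})}+\frac{H(\bm{w})-H(\eta_j(\bm{w}))}{\chi_{j'}(\bm{w})}\right).$$ **Column dimensions.** $t_j=\max_{\underline{\ell}\in\eta_j(\mathcal{I})}t_j(\underline{\ell})$, where $t_j(\underline{\ell})$ is the unique solution of $\sum_{i\in\eta_j^{-1}(\underline{\ell})}\beta_{i,j'}^{t_j(\underline{\ell})}=1$. **The sets $\Omega_j$.** $\Omega=\mathcal{I}^{\mathbb{N}}$.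 For $\gamma\in\Omega$, $k\in\mathbb{N}$, let $\bm{\xi}_k(\gamma)\in\mathcal{P}$ have entries $\bm{\xi}_k(\gamma)_i=\#\{1\leq \ell\leq k:\gamma_\ell=i\}/k$ and $\Gamma_k(\gamma)=\chi_1(\bm{\xi}_k(\gamma))/\chi_2(\bm{\xi}_k(\gamma))$. Then $\Omega_1=\{\gamma:\limsup_{k\to\infty}\Gamma_k(\gamma)<1\}$ and $\Omega_2=\{\gamma:\liminf_{k\to\infty}\Gamma_k(\gamma)>1\}$. **Dimensions.** $\dim_{\mathrm H},\dim_{\mathrm B}$ are Hausdorff and box dimension. $N_r(F)$ is the smallest number of closed balls of radius $r$ needed to cover $F$. For compact $K$, $\dim_{\mathrm A} K=\inf\{s:\exists C>0\ \forall 0<r\leq R<1\ \forall x\in K,\ N_r(B(x,R)\cap K)\leq C(R/r)^s\}$, and for $x\in K$, $\dim_{\mathrm A}(K,x)=\inf\{s:\exists C>0\ \exists\rho>0\ \forall 0<r\leq R<\rho,\ N_r(B(x,R)\cap K)\leq C(R/r)^s\}$. *)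

theory Defs
  imports "HOL-Analysis.Analysis"
begin

section \<open>Dimensions\<close>

text \<open>
  All dimensions take values in \<^typ>\<open>ereal\<close>, so that infima of empty sets carry no junk value.
\<close>

text \<open>
  The summand \<open>|U|\<^sup>s\<close> of the Hausdorff measure, with the convention \<open>|{}|\<^sup>s = 0\<close>, also for
  \<open>s = 0\<close>, and \<open>0\<^sup>0 = 1\<close> for nonempty \<open>U\<close> (the library has \<open>0 powr 0 = 0\<close>).
\<close>
definition diameter_power :: "real \<Rightarrow> 'a::metric_space set \<Rightarrow> real" where
  "diameter_power s U =
     (if U = {} then 0 else if s = 0 then 1 else diameter U powr s)"

text \<open>Boundedness is required since \<^const>\<open>diameter\<close> is meaningful only for bounded sets.\<close>
definition hausdorff_premeasure :: "real \<Rightarrow> real \<Rightarrow> 'a::metric_space set \<Rightarrow> ennreal" where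
  "hausdorff_premeasure s \<delta> F =
     (INF U \<in> {U :: nat \<Rightarrow> 'a set.
                 (\<forall>n. bounded (U n) \<and> diameter (U n) \<le> \<delta>) \<and> F \<subseteq> (\<Union>n. U n)}.
        \<Sum>n. ennreal (diameter_power s (U n)))"

definition hausdorff_measure :: "real \<Rightarrow> 'a::metric_space set \<Rightarrow> ennreal" where
  "hausdorff_measure s F = (SUP \<delta> \<in> {0<..}. hausdorff_premeasure s \<delta> F)"

definition hausdorff_dim :: "'a::metric_space set \<Rightarrow> ereal" where
  "hausdorff_dim F = (INF s \<in> {s. 0 \<le> s \<and> hausdorff_measure s F = 0}. ereal s)"

text \<open>
  \<open>N\<^sub>r(F)\<close>, with arbitrary centres in the ambient space.  For bounded \<open>F\<close> and \<open>r > 0\<close>, the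
  only case used below, the set of admissible numbers is nonempty.
\<close>
definition covering_number :: "real \<Rightarrow> 'a::euclidean_space set \<Rightarrow> nat" where
  "covering_number r F =
     (LEAST n. \<exists>C. finite C \<and> card C = n \<and> F \<subseteq> (\<Union>c\<in>C. cball c r))"

text \<open>A genuine limit rather than an upper or lower limit; it is unspecified if the limit does
  not exist.\<close>
definition box_dim :: "'a::euclidean_space set \<Rightarrow> ereal" where
  "box_dim F = Lim (at_right 0) (\<lambda>r. ereal (ln (real (covering_number r F)) / - ln r))"

definition assouad_dim :: "'a::euclidean_space set \<Rightarrow> ereal" where
  "assouad_dim K =
     (INF s \<in> {s :: real. \<exists>C>0. \<forall>r R. 0 < r \<and> r \<le> R \<and> R < 1 \<longrightarrow>
                (\<forall>x\<in>K. real (covering_number r (cball x R \<inter> K)) \<le> C * (R / r) powr s)}.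
        ereal s)"

definition pointwise_assouad_dim :: "'a::euclidean_space set \<Rightarrow> 'a \<Rightarrow> ereal" where
  "pointwise_assouad_dim K x =
     (INF s \<in> {s :: real. \<exists>C>0. \<exists>\<rho>>0. \<forall>r R. 0 < r \<and> r \<le> R \<and> R < \<rho> \<longrightarrow>
                real (covering_number r (cball x R \<inter> K)) \<le> C * (R / r) powr s}.
        ereal s)"


section \<open>Baranski carpets\<close>

text \<open>
  Coordinates are indexed by the two-element type \<^typ>\<open>2\<close>, whose elements are \<open>1\<close> and \<open>2\<close>.
  A system is given by an index set \<open>I\<close>, contraction ratios \<open>\<beta> i j\<close> and translations \<open>d i j\<close>.
\<close>

definition other :: "2 \<Rightarrow> 2" where
  "other j = (if j = 1 then 2 else 1)"

definition coord_map :: "('i \<Rightarrow> 2 \<Rightarrow> real) \<Rightarrow> ('i \<Rightarrow> 2 \<Rightarrow> real) \<Rightarrow> 'i \<Rightarrow> 2 \<Rightarrow> real \<Rightarrow> real" where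
  "coord_map \<beta> d i j t = \<beta> i j * t + d i j"

definition carpet_map :: "('i \<Rightarrow> 2 \<Rightarrow> real) \<Rightarrow> ('i \<Rightarrow> 2 \<Rightarrow> real) \<Rightarrow> 'i \<Rightarrow> real^2 \<Rightarrow> real^2" where
  "carpet_map \<beta> d i x = (\<chi> j. coord_map \<beta> d i j (x $ j))"

definition is_attractor :: "'i set \<Rightarrow> ('i \<Rightarrow> 'a \<Rightarrow> 'a) \<Rightarrow> 'a::topological_space set \<Rightarrow> bool" where
  "is_attractor I f K \<longleftrightarrow> K \<noteq> {} \<and> compact K \<and> K = (\<Union>i\<in>I. f i ` K)"

definition baranski_carpet ::
  "'i set \<Rightarrow> ('i \<Rightarrow> 2 \<Rightarrow> real) \<Rightarrow> ('i \<Rightarrow> 2 \<Rightarrow> real) \<Rightarrow> (real^2) set \<Rightarrow> bool" where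
  "baranski_carpet I \<beta> d K \<longleftrightarrow>
     finite I \<and> 2 \<le> card I \<and>
     (\<forall>i\<in>I. \<forall>j. 0 < \<beta> i j \<and> \<beta> i j < 1) \<and>
     is_attractor I (carpet_map \<beta> d) K \<and>
     K \<subseteq> cbox 0 1 \<and>
     (\<forall>i\<in>I. \<forall>i'\<in>I. i \<noteq> i' \<longrightarrow> carpet_map \<beta> d i ` box 0 1 \<inter> carpet_map \<beta> d i' ` box 0 1 = {}) \<and>
     (\<forall>i\<in>I. \<forall>i'\<in>I. \<forall>j.
        coord_map \<beta> d i j ` {0<..<1} = coord_map \<beta> d i' j ` {0<..<1} \<or>
        coord_map \<beta> d i j ` {0<..<1} \<inter> coord_map \<beta> d i' j ` {0<..<1} = {})"

text \<open>
  The quotient \<open>\<eta>\<^sub>j(I)\<close>.  Its elements are equivalence classes, so an element \<open>\<ell>\<close> is itself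
  the fibre of the quotient map over \<open>\<ell>\<close>.
\<close>
definition eta_index ::
  "'i set \<Rightarrow> ('i \<Rightarrow> 2 \<Rightarrow> real) \<Rightarrow> ('i \<Rightarrow> 2 \<Rightarrow> real) \<Rightarrow> 2 \<Rightarrow> 'i set set" where
  "eta_index I \<beta> d j = I // {(i, i'). i \<in> I \<and> i' \<in> I \<and> coord_map \<beta> d i j = coord_map \<beta> d i' j}"

definition eta :: "2 \<Rightarrow> (real^2) set \<Rightarrow> real set" where
  "eta j K = (\<lambda>x. x $ j) ` K"

text \<open>The map attached to a class is \<open>coord_map \<beta> d i j\<close> for any of its members \<open>i\<close>.\<close>
definition strong_separation ::
  "'i set \<Rightarrow> ('i \<Rightarrow> 2 \<Rightarrow> real) \<Rightarrow> ('i \<Rightarrow> 2 \<Rightarrow> real) \<Rightarrow> (real^2) set \<Rightarrow> 2 \<Rightarrow> bool" where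
  "strong_separation I \<beta> d K j \<longleftrightarrow>
     (\<forall>l \<in> eta_index I \<beta> d j. \<forall>l' \<in> eta_index I \<beta> d j. l \<noteq> l' \<longrightarrow>
        (\<forall>i\<in>l. \<forall>i'\<in>l'. coord_map \<beta> d i j ` eta j K \<inter> coord_map \<beta> d i' j ` eta j K = {}))"


section \<open>Entropy and Lyapunov exponents\<close>

text \<open>Only the values on \<open>I\<close> matter; nothing is required of \<open>w\<close> off \<open>I\<close>.\<close>
definition prob_vectors :: "'i set \<Rightarrow> ('i \<Rightarrow> real) set" where
  "prob_vectors I = {w. (\<forall>i\<in>I. 0 \<le> w i) \<and> (\<Sum>i\<in>I. w i) = 1}"

definition shannon_entropy :: "'b set \<Rightarrow> ('b \<Rightarrow> real) \<Rightarrow> real" where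
  "shannon_entropy A p = - (\<Sum>a\<in>A. p a * ln (p a))"

definition eta_vector :: "('i \<Rightarrow> real) \<Rightarrow> 'i set \<Rightarrow> real" where
  "eta_vector w l = (\<Sum>i\<in>l. w i)"

definition chi :: "'i set \<Rightarrow> ('i \<Rightarrow> 2 \<Rightarrow> real) \<Rightarrow> 2 \<Rightarrow> ('i \<Rightarrow> real) \<Rightarrow> real" where
  "chi I \<beta> j w = - (\<Sum>i\<in>I. w i * ln (\<beta> i j))"

definition prob_vectors_dir :: "'i set \<Rightarrow> ('i \<Rightarrow> 2 \<Rightarrow> real) \<Rightarrow> 2 \<Rightarrow> ('i \<Rightarrow> real) set" where
  "prob_vectors_dir I \<beta> j = {w \<in> prob_vectors I. chi I \<beta> j w \<le> chi I \<beta> (other j) w}"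

text \<open>
  The number \<open>d\<^sub>j\<close>.  The maximum is written as a supremum; by compactness it is attained
  whenever \<^term>\<open>prob_vectors_dir I \<beta> j\<close> is nonempty, in particular if \<open>\<Omega>\<^sub>j\<close> is nonempty.
\<close>
definition d_dir :: "'i set \<Rightarrow> ('i \<Rightarrow> 2 \<Rightarrow> real) \<Rightarrow> ('i \<Rightarrow> 2 \<Rightarrow> real) \<Rightarrow> 2 \<Rightarrow> real" where
  "d_dir I \<beta> d j =
     (SUP w \<in> prob_vectors_dir I \<beta> j.
        shannon_entropy (eta_index I \<beta> d j) (eta_vector w) / chi I \<beta> j w +
        (shannon_entropy I w - shannon_entropy (eta_index I \<beta> d j) (eta_vector w))
          / chi I \<beta> (other j) w)"

definition column_dim :: "('i \<Rightarrow> 2 \<Rightarrow> real) \<Rightarrow> 2 \<Rightarrow> 'i set \<Rightarrow> real" where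
  "column_dim \<beta> j l = (THE t. (\<Sum>i\<in>l. \<beta> i (other j) powr t) = 1)"

definition max_column_dim ::
  "'i set \<Rightarrow> ('i \<Rightarrow> 2 \<Rightarrow> real) \<Rightarrow> ('i \<Rightarrow> 2 \<Rightarrow> real) \<Rightarrow> 2 \<Rightarrow> real" where
  "max_column_dim I \<beta> d j = Max (column_dim \<beta> j ` eta_index I \<beta> d j)"

text \<open>
  Symbolic sequences are indexed from \<open>0\<close>: the letter \<open>\<gamma>\<^sub>n\<close> of the usual \<open>1\<close>-based notation is
  \<open>\<gamma> (n - 1)\<close>, so the first \<open>k\<close> letters are those at positions below \<open>k\<close>.
\<close>
definition letter_freq :: "(nat \<Rightarrow> 'i) \<Rightarrow> nat \<Rightarrow> 'i \<Rightarrow> real" where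
  "letter_freq \<gamma> k i = real (card {n. n < k \<and> \<gamma> n = i}) / real k"

definition exponent_ratio :: "'i set \<Rightarrow> ('i \<Rightarrow> 2 \<Rightarrow> real) \<Rightarrow> (nat \<Rightarrow> 'i) \<Rightarrow> nat \<Rightarrow> real" where
  "exponent_ratio I \<beta> \<gamma> k = chi I \<beta> 1 (letter_freq \<gamma> k) / chi I \<beta> 2 (letter_freq \<gamma> k)"

definition Omega_dir :: "'i set \<Rightarrow> ('i \<Rightarrow> 2 \<Rightarrow> real) \<Rightarrow> 2 \<Rightarrow> (nat \<Rightarrow> 'i) set" where
  "Omega_dir I \<beta> j =
     (if j = 1
      then {\<gamma>. range \<gamma> \<subseteq> I \<and> limsup (\<lambda>k. ereal (exponent_ratio I \<beta> \<gamma> k)) < 1}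
      else {\<gamma>. range \<gamma> \<subseteq> I \<and> liminf (\<lambda>k. ereal (exponent_ratio I \<beta> \<gamma> k)) > 1})"

end

theory Submission
  imports Defs "HOL-Probability.Infinite_Product_Measure" "HOL-Combinatorics.Multiset_Permutations"
    "HOL-Real_Asymp.Real_Asymp"
begin

text \<open>
  Write \<open>a\<close> for \<open>j\<close>, \<open>b\<close> for the other direction, \<open>p\<^sub>l\<close> for the box dimension of \<open>\<eta>\<^sub>l(K)\<close> and
  \<open>s\<^sub>l = p\<^sub>l + t\<^sub>l\<close>; so \<open>s\<^sub>b < s\<^sub>a\<close> and \<open>d\<^sub>a < d\<^sub>b\<close>.  Along a coding of \<open>x \<in> K\<close> let \<open>B\<^sub>l(k)\<close> be the
  product of the first \<open>k\<close> contraction ratios in direction \<open>l\<close>.  The level-\<open>k\<close> cylinder around \<open>x\<close>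
  is an affine copy of \<open>K\<close> with side lengths \<open>B\<^sub>a(k)\<close> and \<open>B\<^sub>b(k)\<close>.  The points of maximal pointwise
  Assouad dimension have cylinders that are infinitely often at least as long in direction \<open>a\<close> as in
  direction \<open>b\<close>, and such points form a set of dimension at most \<open>d\<^sub>a\<close>, while \<open>dim\<^sub>H K > d\<^sub>a\<close>.

  \<^bold>\<open>Large pointwise dimension forces a return.\<close>  Suppose \<open>B\<^sub>a(k) < B\<^sub>b(k)\<close> for all large \<open>k\<close>.  By strong
  separation a small ball around \<open>x\<close> only meets an approximate square: the first letters are those of
  \<open>x\<close>, the next ones are prescribed up to their class in direction \<open>b\<close>, the rest is free.  Subdividing
  such a set until the pieces are thin gives \<open>dim\<^sub>A(K,x) \<le> max {s\<^sub>b, p\<^sub>a + t'}\<close> for every \<open>t' \<ge> 0\<close> with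
  \<open>\<Sum>\<^sub>i \<beta>\<^sub>i\<^sub>a\<^bsup>p\<^sub>a\<^esup> \<beta>\<^sub>i\<^sub>b\<^bsup>t'\<^esup> \<le> 1\<close> (\<open>pointwise_assouad_le\<close>); the second term reflects that the
  pointwise dimension is never below the box dimension of \<open>K\<close>.  Some \<open>t' < t\<^sub>a\<close> is admissible
  because the sum is strictly below \<open>1\<close> at \<open>t\<^sub>a\<close>: otherwise its summands form a probability vector
  at which the formula for \<open>d\<^sub>a\<close> takes its largest conceivable value \<open>s\<^sub>a\<close>, which is incompatible
  with \<open>d\<^sub>a < d\<^sub>b\<close> and \<open>s\<^sub>b < s\<^sub>a\<close> (\<open>nonuniform_columns\<close>).  On the other hand \<open>dim\<^sub>A K \<ge> s\<^sub>a\<close>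
  (\<open>assouad_dim_ge\<close>): very flat cylinders, obtained by repeating a letter with \<open>\<beta>\<^sub>i\<^sub>a > \<beta>\<^sub>i\<^sub>b\<close>,
  contain at the scale of their height a near product of \<open>\<eta>\<^sub>a(K)\<close> with the fattest column.  Hence \<open>dim\<^sub>A(K,x) < dim\<^sub>A K\<close>.

  \<^bold>\<open>Points that return have dimension at most \<open>d\<^sub>a\<close>.\<close>  Cover by approximate squares and count them by
  the empirical entropy of the words that describe them.  At a scale \<open>k\<close> with \<open>B\<^sub>b(k) \<le> B\<^sub>a(k)\<close> the square
  is described by the first \<open>k\<close> letters and by a window of classes in direction \<open>a\<close>.  The count is
  bounded by \<open>B\<^sub>b(k)\<^bsup>-(d\<^sub>a + \<epsilon>)\<^esup>\<close> unless the window has larger entropy, relative to the change of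
  \<open>- ln B\<^sub>a\<close>, than the class prefix.  If that happened at all large scales with \<open>B\<^sub>b(k) \<le> B\<^sub>a(k)\<close>, then this
  inequality would hold from some scale on, and the entropy of the class prefix relative to \<open>- ln B\<^sub>a\<close>
  would increase by a fixed amount from each scale to the end of its window, although it is bounded
  (\<open>good_scale\<close>, \<open>hausdorff_measure_zero_region\<close>).

  \<^bold>\<open>The whole carpet is larger.\<close>  Some \<open>w\<close> with \<open>\<chi>\<^sub>b(w) \<le> \<chi>\<^sub>a(w)\<close> has formula value above \<open>d\<^sub>a\<close>.  The
  inequality of exponents is strict, for with equality both formulas agree and \<open>w\<close> competes for
  \<open>d\<^sub>a\<close>.  The words with prescribed letter counts, in proportions close to \<open>w\<close>, all have the same two side
  lengths, so concatenating them freely gives a homogeneous subset of \<open>K\<close>.  A lower bound for its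
  dimension follows from the mass distribution principle for the uniform product measure (\<open>hausdorff_dim_ge_dim_formula\<close>).
\<close>

section \<open>Moran's equation and Gibbs' inequality\<close>

lemma moran_sum_strict_antimono:
  fixes p :: "'b \<Rightarrow> real"
  assumes "finite A" "A \<noteq> {}" "\<And>a. a \<in> A \<Longrightarrow> 0 < p a \<and> p a < 1" "s < t"
  shows "(\<Sum>a\<in>A. p a powr t) < (\<Sum>a\<in>A. p a powr s)"
  using assms by (intro sum_strict_mono) (auto intro!: powr_less_mono')

lemma moran_root_ex1:
  fixes p :: "'b \<Rightarrow> real"
  assumes fin: "finite A" and ne: "A \<noteq> {}" and p: "\<And>a. a \<in> A \<Longrightarrow> 0 < p a \<and> p a < 1"
  shows "\<exists>!t. (\<Sum>a\<in>A. p a powr t) = 1"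
proof -
  let ?f = "\<lambda>t. \<Sum>a\<in>A. p a powr t"
  have lim: "(?f \<longlongrightarrow> (\<Sum>a\<in>A. 0)) at_top"
  proof (intro tendsto_sum)
    fix a assume "a \<in> A"
    then have "0 < p a" "p a < 1" using p by auto
    then show "((\<lambda>t. p a powr t) \<longlongrightarrow> 0) at_top"
      by real_asymp
  qed
  then have "\<forall>\<^sub>F t in at_top. ?f t < 1"
    by (intro order_tendstoD(2)[where y = 0]) auto
  then have "\<forall>\<^sub>F t in at_top. ?f t < 1 \<and> t \<ge> 0"
    using eventually_ge_at_top[of 0] by eventually_elim auto
  then obtain T where T: "?f T < 1" "T \<ge> 0"
    unfolding eventually_at_top_linorder by (meson order_refl)
  have "?f 0 = (\<Sum>a\<in>A. 1)"
    by (rule sum.cong) (use p in force)+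
  then have f0: "?f 0 \<ge> 1"
    using fin ne by (simp add: Suc_leI card_gt_0_iff)
  have "continuous_on {0..T} ?f"
    using p by (intro continuous_intros) force+
  then have "\<exists>t. 0 \<le> t \<and> t \<le> T \<and> ?f t = 1"
    using T f0 by (intro IVT2') auto
  then obtain t where t: "?f t = 1" by blast
  show ?thesis
  proof (rule ex1I[of _ t])
    fix u assume "?f u = 1"
    then show "u = t"
      using t moran_sum_strict_antimono[where p = p and s = u and t = t, OF fin ne p] moran_sum_strict_antimono[where p = p and s = t and t = u, OF fin ne p]
      by (cases u t rule: linorder_cases) auto
  qed (rule t)
qed

text \<open>
  The root of Moran's equation: the similarity dimension of ratios \<open>p\<close>.  It appears as the dimension
  of the projections and as the column dimensions.
\<close>

definition moran_dim :: "'b set \<Rightarrow> ('b \<Rightarrow> real) \<Rightarrow> real" where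
  "moran_dim A p = (THE t. (\<Sum>a\<in>A. p a powr t) = 1)"

context
  fixes A :: "'b set" and p :: "'b \<Rightarrow> real"
  assumes fin: "finite A" and ne: "A \<noteq> {}" and p: "\<And>a. a \<in> A \<Longrightarrow> 0 < p a \<and> p a < 1"
begin

lemma moran_dim_sum: "(\<Sum>a\<in>A. p a powr moran_dim A p) = 1"
  unfolding moran_dim_def by (rule theI'[OF moran_root_ex1]) (use fin ne p in auto)

lemma le_moran_dim_iff: "t \<le> moran_dim A p \<longleftrightarrow> 1 \<le> (\<Sum>a\<in>A. p a powr t)"
  using moran_dim_sum moran_sum_strict_antimono[where p = p and s = t and t = "moran_dim A p", OF fin ne p]
    moran_sum_strict_antimono[where p = p and s = "moran_dim A p" and t = t, OF fin ne p]
  by (cases t "moran_dim A p" rule: linorder_cases) auto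

lemma moran_dim_le_iff: "moran_dim A p \<le> t \<longleftrightarrow> (\<Sum>a\<in>A. p a powr t) \<le> 1"
  using moran_dim_sum moran_sum_strict_antimono[where p = p and s = t and t = "moran_dim A p", OF fin ne p]
    moran_sum_strict_antimono[where p = p and s = "moran_dim A p" and t = t, OF fin ne p]
  by (cases t "moran_dim A p" rule: linorder_cases) auto

lemma moran_dim_nonneg: "0 \<le> moran_dim A p"
proof -
  have "(\<Sum>a\<in>A. p a powr 0) = (\<Sum>a\<in>A. 1)"
    by (rule sum.cong) (use p in force)+
  then show ?thesis
    using fin ne by (simp add: le_moran_dim_iff Suc_leI card_gt_0_iff)
qed

end

text \<open>
  Every entropy estimate below is an instance: an upper bound for an entropy comes from a suitable
  subprobability vector \<open>q\<close>.  The reason is \<open>ln x \<le> x - 1\<close> at \<open>x = q / p\<close>, summed against \<open>p\<close>.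
\<close>

lemma gibbs_inequality:
  fixes p q :: "'b \<Rightarrow> real"
  assumes fin: "finite A"
    and nn: "\<And>a. a \<in> A \<Longrightarrow> 0 \<le> p a" "\<And>a. a \<in> A \<Longrightarrow> 0 \<le> q a"
    and ac: "\<And>a. a \<in> A \<Longrightarrow> q a = 0 \<Longrightarrow> p a = 0"
    and le: "(\<Sum>a\<in>A. q a) \<le> (\<Sum>a\<in>A. p a)"
  shows "(\<Sum>a\<in>A. p a * ln (q a)) \<le> (\<Sum>a\<in>A. p a * ln (p a))"
proof -
  have "p a * ln (q a) - p a * ln (p a) \<le> q a - p a" if "a \<in> A" for a
  proof (cases "p a = 0")
    case True
    then show ?thesis using nn(2)[OF that] by simp
  next
    case False
    then have pos: "0 < p a" "0 < q a" using nn ac that by force+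
    then have "p a * ln (q a / p a) \<le> p a * (q a / p a - 1)"
      by (intro mult_left_mono ln_le_minus_one) auto
    then show ?thesis
      using pos by (simp add: ln_div algebra_simps)
  qed
  then have "(\<Sum>a\<in>A. p a * ln (q a) - p a * ln (p a)) \<le> (\<Sum>a\<in>A. q a - p a)"
    by (rule sum_mono)
  then show ?thesis
    using le by (simp add: sum_subtractf)
qed

section \<open>Coverings and packings\<close>

text \<open>
  The bound on the number of balls is a real number, so that bounds of the form \<open>C * s powr t\<close>
  can be added over pieces without rounding.
\<close>

definition coverable :: "real \<Rightarrow> real \<Rightarrow> 'a::metric_space set \<Rightarrow> bool" where
  "coverable r N F \<longleftrightarrow> (\<exists>C. finite C \<and> real (card C) \<le> N \<and> F \<subseteq> (\<Union>c\<in>C. cball c r))"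

lemma coverable_mono:
  "coverable r N F \<Longrightarrow> N \<le> N' \<Longrightarrow> F' \<subseteq> F \<Longrightarrow> coverable r N' F'"
  unfolding coverable_def by (meson order_trans)

lemma coverable_UN:
  assumes "finite A" "\<And>i. i \<in> A \<Longrightarrow> coverable r (f i) (F i)"
  shows "coverable r (\<Sum>i\<in>A. f i) (\<Union>i\<in>A. F i)"
proof -
  obtain C where C: "\<And>i. i \<in> A \<Longrightarrow> finite (C i) \<and> real (card (C i)) \<le> f i \<and> F i \<subseteq> (\<Union>c\<in>C i. cball c r)"
    using assms(2) unfolding coverable_def by metis
  have "real (card (\<Union>i\<in>A. C i)) \<le> (\<Sum>i\<in>A. real (card (C i)))"
    using card_UN_le[OF assms(1), of C] by (simp flip: of_nat_sum)
  also have "\<dots> \<le> (\<Sum>i\<in>A. f i)"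
    using C by (intro sum_mono) auto
  finally show ?thesis
    unfolding coverable_def using C assms(1) by (intro exI[of _ "\<Union>i\<in>A. C i"]) fastforce
qed

lemma coverable_single: "F \<subseteq> cball c r \<Longrightarrow> 1 \<le> N \<Longrightarrow> coverable r N F"
  unfolding coverable_def by (intro exI[of _ "{c}"]) auto

lemma coverable_image:
  assumes "coverable r N F" "\<And>x y. dist (f x) (f y) \<le> L * dist x y" "0 \<le> L"
  shows "coverable (L * r) N (f ` F)"
proof -
  obtain C where C: "finite C" "real (card C) \<le> N" "F \<subseteq> (\<Union>c\<in>C. cball c r)"
    using assms unfolding coverable_def by auto
  have "f ` F \<subseteq> (\<Union>c\<in>f ` C. cball c (L * r))"
  proof clarsimp
    fix x assume "x \<in> F"
    then obtain c where c: "c \<in> C" "dist c x \<le> r" using C by auto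
    have "dist (f c) (f x) \<le> L * r"
      using assms(2)[of c x] mult_left_mono[OF c(2) assms(3)] by linarith
    then show "\<exists>c\<in>C. dist (f c) (f x) \<le> L * r" using c by auto
  qed
  moreover have "real (card (f ` C)) \<le> N"
    using card_image_le[OF C(1), of f] C(2) by linarith
  ultimately show ?thesis
    unfolding coverable_def using C(1) by blast
qed

lemma covering_number_le:
  assumes "coverable r N F"
  shows "real (covering_number r F) \<le> N"
proof -
  obtain C where "finite C" "real (card C) \<le> N" "F \<subseteq> (\<Union>c\<in>C. cball c r)"
    using assms unfolding coverable_def by auto
  then have "covering_number r F \<le> card C"
    unfolding covering_number_def by (intro Least_le) auto
  with \<open>real (card C) \<le> N\<close> show ?thesis by linarith
qed

lemma covering_number_witness:
  fixes F :: "'a::euclidean_space set"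
  assumes "bounded F" "0 < r"
  obtains C where "finite C" "card C = covering_number r F" "F \<subseteq> (\<Union>c\<in>C. cball c r)"
proof -
  have "compact (closure F)" using assms by simp
  then have "complete (closure F) \<and> (\<forall>e>0. \<exists>k. finite k \<and> closure F \<subseteq> (\<Union>x\<in>k. ball x e))"
    by (rule compact_eq_totally_bounded[THEN iffD1])
  then obtain C where C: "finite C" "closure F \<subseteq> (\<Union>x\<in>C. ball x r)"
    using \<open>0 < r\<close> by meson
  then have "F \<subseteq> (\<Union>c\<in>C. cball c r)"
    using closure_subset[of F] by (force simp: subset_iff)
  then have "\<exists>n C. finite C \<and> card C = n \<and> F \<subseteq> (\<Union>c\<in>C. cball c r)"
    using C by blast
  then have "\<exists>C. finite C \<and> card C = covering_number r F \<and> F \<subseteq> (\<Union>c\<in>C. cball c r)"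
    unfolding covering_number_def by (rule LeastI_ex)
  then show ?thesis using that by blast
qed

definition separated_set :: "real \<Rightarrow> 'a::metric_space set \<Rightarrow> bool" where
  "separated_set r S \<longleftrightarrow> (\<forall>x\<in>S. \<forall>y\<in>S. x \<noteq> y \<longrightarrow> r \<le> dist x y)"

text \<open>
  Packings give lower bounds for covering numbers, and they are additive over pieces that are far
  apart; this is what strong separation is used for in lower bounds.
\<close>

definition packable :: "real \<Rightarrow> real \<Rightarrow> 'a::metric_space set \<Rightarrow> bool" where
  "packable r N F \<longleftrightarrow> (\<exists>S. finite S \<and> S \<subseteq> F \<and> N \<le> real (card S) \<and> separated_set r S)"

lemma packable_mono:
  "packable r N F \<Longrightarrow> N' \<le> N \<Longrightarrow> F \<subseteq> F' \<Longrightarrow> packable r N' F'"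
  unfolding packable_def by (meson order_trans)

lemma packable_single: "F \<noteq> {} \<Longrightarrow> N \<le> 1 \<Longrightarrow> packable r N F"
proof -
  assume "F \<noteq> {}" "N \<le> 1"
  then obtain x where "x \<in> F" by blast
  then show ?thesis
    using \<open>N \<le> 1\<close> unfolding packable_def separated_set_def by (intro exI[of _ "{x}"]) auto
qed

lemma packable_UN:
  assumes "finite A" "\<And>i. i \<in> A \<Longrightarrow> packable r (f i) (F i)" "0 < r"
    and sep: "\<And>i i' x y. \<lbrakk>i \<in> A; i' \<in> A; i \<noteq> i'; x \<in> F i; y \<in> F i'\<rbrakk> \<Longrightarrow> r \<le> dist x y"
  shows "packable r (\<Sum>i\<in>A. f i) (\<Union>i\<in>A. F i)"
proof -
  obtain S where S: "\<And>i. i \<in> A \<Longrightarrow> finite (S i) \<and> S i \<subseteq> F i \<and> f i \<le> real (card (S i)) \<and> separated_set r (S i)"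
    using assms(2) unfolding packable_def by metis
  have "card (\<Union>i\<in>A. S i) = (\<Sum>i\<in>A. card (S i))"
  proof (rule card_UN_disjoint)
    show "\<forall>i\<in>A. \<forall>j\<in>A. i \<noteq> j \<longrightarrow> S i \<inter> S j = {}"
    proof (intro ballI impI)
      fix i j assume "i \<in> A" "j \<in> A" "i \<noteq> j"
      then have "\<And>x. x \<in> S i \<Longrightarrow> x \<in> S j \<Longrightarrow> r \<le> dist x x" using sep S by blast
      then show "S i \<inter> S j = {}" using \<open>0 < r\<close> by fastforce
    qed
  qed (use assms S in auto)
  then have "(\<Sum>i\<in>A. f i) \<le> real (card (\<Union>i\<in>A. S i))"
    using S by (simp add: sum_mono)
  moreover have "separated_set r (\<Union>i\<in>A. S i)"
    unfolding separated_set_def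
  proof clarify
    fix x i y j assume *: "i \<in> A" "x \<in> S i" "j \<in> A" "y \<in> S j" "x \<noteq> y"
    show "r \<le> dist x y"
    proof (cases "i = j")
      case True
      then show ?thesis using * S unfolding separated_set_def by blast
    next
      case False
      then show ?thesis using * S sep by blast
    qed
  qed
  ultimately show ?thesis
    unfolding packable_def using S assms(1) by (intro exI[of _ "\<Union>i\<in>A. S i"]) blast
qed

lemma packable_image:
  assumes "packable r N F" "\<And>x y. L * dist x y \<le> dist (f x) (f y)" "0 < L" "0 < r"
  shows "packable (L * r) N (f ` F)"
proof -
  obtain S where S: "finite S" "S \<subseteq> F" "N \<le> real (card S)" "separated_set r S"
    using assms unfolding packable_def by auto
  have inj: "inj_on f S"
  proof (rule inj_onI)
    fix x y assume "x \<in> S" "y \<in> S" "f x = f y"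
    then have "L * dist x y \<le> 0" using assms(2)[of x y] by simp
    then show "x = y" using \<open>0 < L\<close> by (simp add: mult_le_0_iff)
  qed
  have "separated_set (L * r) (f ` S)"
    unfolding separated_set_def
  proof clarsimp
    fix x y assume "x \<in> S" "y \<in> S" "f x \<noteq> f y"
    then have "r \<le> dist x y" using S(4) unfolding separated_set_def by metis
    then have "L * r \<le> L * dist x y" using \<open>0 < L\<close> by simp
    then show "L * r \<le> dist (f x) (f y)" using assms(2)[of x y] by linarith
  qed
  then show ?thesis
    unfolding packable_def using S inj by (intro exI[of _ "f ` S"]) (auto simp: card_image)
qed

text \<open>
  A ball of radius \<open>r\<close> contains at most one point of a set that is separated by more than \<open>2 * r\<close>.
\<close>

lemma covering_number_ge:
  fixes F :: "'a::euclidean_space set"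
  assumes "packable r' N F" "bounded F" "0 < r" "2 * r < r'"
  shows "N \<le> real (covering_number r F)"
proof -
  obtain S where S: "finite S" "S \<subseteq> F" "N \<le> real (card S)" "separated_set r' S"
    using assms unfolding packable_def by auto
  obtain C where C: "finite C" "card C = covering_number r F" "F \<subseteq> (\<Union>c\<in>C. cball c r)"
    using covering_number_witness assms by blast
  have "\<forall>x\<in>S. \<exists>c\<in>C. dist c x \<le> r" using C(3) S(2) by (auto simp: subset_iff)
  then obtain g where g: "\<And>x. x \<in> S \<Longrightarrow> g x \<in> C \<and> dist (g x) x \<le> r" by metis
  have "inj_on g S"
  proof (rule inj_onI, rule ccontr)
    fix x y assume *: "x \<in> S" "y \<in> S" "g x = g y" "x \<noteq> y"
    then have "r' \<le> dist x y" using S(4) unfolding separated_set_def by blast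
    also have "dist x y \<le> dist (g x) x + dist (g y) y"
      using * by (metis dist_triangle3)
    also have "\<dots> \<le> 2 * r" using g[of x] g[of y] * by linarith
    finally show False using assms by linarith
  qed
  then have "card S \<le> card C"
    using g C by (intro card_inj_on_le) auto
  then show ?thesis using S C by simp
qed

section \<open>Hausdorff measure\<close>

lemma diameter_power_nonneg: "0 \<le> diameter_power s U"
  by (simp add: diameter_power_def)

text \<open>
  A Borel-Cantelli argument: if every point of \<open>A\<close> lies in members of infinitely many of the
  families \<open>U k\<close>, whose sums of diameter powers are summable in \<open>k\<close>, then the tails of the double
  family are covers of \<open>A\<close> of arbitrarily small cost.
\<close>

lemma hausdorff_measure_zeroI:
  fixes A :: "'a::metric_space set" and U :: "nat \<Rightarrow> 'j \<Rightarrow> 'a set"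
  assumes fin: "\<And>k. finite (J k)"
    and bdd: "\<And>k j. j \<in> J k \<Longrightarrow> bounded (U k j) \<and> diameter (U k j) \<le> r k"
    and r: "r \<longlonglongrightarrow> 0"
    and e: "\<And>k. (\<Sum>j\<in>J k. diameter_power s (U k j)) \<le> e k" "summable e"
    and cov: "\<And>x N. x \<in> A \<Longrightarrow> \<exists>k\<ge>N. \<exists>j\<in>J k. x \<in> U k j"
  shows "hausdorff_measure s A = 0"
proof -
  have "hausdorff_premeasure s \<delta> A \<le> ennreal \<eta>" if \<delta>: "0 < \<delta>" and \<eta>: "0 < \<eta>" for \<delta> \<eta>
  proof -
    have "\<forall>\<^sub>F k in sequentially. r k < \<delta>" by (rule order_tendstoD(2)[OF r \<delta>])
    then obtain N1 where N1: "\<And>k. N1 \<le> k \<Longrightarrow> r k < \<delta>" unfolding eventually_sequentially by blast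
    obtain N2 where N2: "\<And>k. N2 \<le> k \<Longrightarrow> norm (\<Sum>i. e (i + k)) < \<eta>"
      using suminf_exist_split[OF \<eta> e(2)] by blast
    define N where "N = max N1 N2"
    have e0: "0 \<le> e k" for k
      using e(1)[of k] sum_nonneg[of "J k" "\<lambda>j. diameter_power s (U k j)"] diameter_power_nonneg by (meson order_trans)
    obtain h where h: "\<And>k. bij_betw (h k) {0..<card (J k)} (J k)"
      using ex_bij_betw_nat_finite[OF fin] by metis
    \<comment> \<open>the double family enumerated by pairs, padded with empty sets, which cost nothing\<close>
    define W where "W = (\<lambda>(k, i). if i < card (J (k + N)) then U (k + N) (h (k + N) i) else {})"
    have hin: "h k i \<in> J k" if "i < card (J k)" for k i
      using bij_betwE[OF h[of k]] that by simp
    have W_ok: "bounded (W p) \<and> diameter (W p) \<le> \<delta>" for p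
    proof (cases p)
      case (Pair k i)
      have "r (k + N) < \<delta>" by (rule N1) (simp add: N_def)
      then show ?thesis
        using bdd[OF hin[of i "k + N"]] \<delta> by (auto simp: W_def Pair)
    qed
    have cover: "A \<subseteq> (\<Union>n. W (prod_decode n))"
    proof
      fix x assume "x \<in> A"
      then obtain k j where kj: "N \<le> k" "j \<in> J k" "x \<in> U k j" using cov by blast
      obtain i where i: "i < card (J k)" "h k i = j"
        using bij_betw_imp_surj_on[OF h[of k]] kj(2) by force
      have "x \<in> W (k - N, i)" using kj i by (simp add: W_def)
      then have "x \<in> W (prod_decode (prod_encode (k - N, i)))" by simp
      then show "x \<in> (\<Union>n. W (prod_decode n))" by blast
    qed
    have "hausdorff_premeasure s \<delta> A \<le> (\<Sum>n. ennreal (diameter_power s (W (prod_decode n))))"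
      unfolding hausdorff_premeasure_def
      by (rule INF_lower2[of "\<lambda>n. W (prod_decode n)"]) (use W_ok cover in auto)
    also have "\<dots> = (\<Sum>k. \<Sum>i. ennreal (diameter_power s (W (k, i))))"
      by (rule suminf_ennreal_2dimen[where f = "\<lambda>p. ennreal (diameter_power s (W p))"]) simp
    also have "\<dots> \<le> (\<Sum>k. ennreal (e (k + N)))"
    proof (intro suminf_le allI)
      fix k
      have "(\<Sum>i. ennreal (diameter_power s (W (k, i)))) = (\<Sum>i<card (J (k + N)). ennreal (diameter_power s (W (k, i))))"
        by (rule suminf_finite) (auto simp: W_def diameter_power_def)
      also have "\<dots> = ennreal (\<Sum>i<card (J (k + N)). diameter_power s (W (k, i)))"
        by (rule sum_ennreal) (rule diameter_power_nonneg)
      also have "(\<Sum>i<card (J (k + N)). diameter_power s (W (k, i)))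
          = (\<Sum>i\<in>{0..<card (J (k + N))}. diameter_power s (U (k + N) (h (k + N) i)))"
        by (rule sum.cong) (auto simp: W_def)
      also have "\<dots> = (\<Sum>j\<in>J (k + N). diameter_power s (U (k + N) j))"
        by (rule sum.reindex_bij_betw[OF h])
      finally show "(\<Sum>i. ennreal (diameter_power s (W (k, i)))) \<le> ennreal (e (k + N))"
        using e(1) by (simp add: ennreal_leI)
    qed auto
    also have "\<dots> = ennreal (\<Sum>k. e (k + N))"
      using e0 e(2) by (intro suminf_ennreal2) (auto simp: summable_iff_shift)
    also have "\<dots> \<le> ennreal \<eta>"
      using N2[of N] by (intro ennreal_leI) (auto simp: N_def)
    finally show ?thesis .
  qed
  then have "hausdorff_premeasure s \<delta> A = 0" if "0 < \<delta>" for \<delta>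
    using ennreal_le_epsilon[of 0 "hausdorff_premeasure s \<delta> A"] that by (auto simp flip: le_zero_eq)
  then show ?thesis unfolding hausdorff_measure_def by simp
qed

lemma hausdorff_dim_le: "0 \<le> s \<Longrightarrow> hausdorff_measure s A = 0 \<Longrightarrow> hausdorff_dim A \<le> ereal s"
  unfolding hausdorff_dim_def by (intro INF_lower) auto

text \<open>
  The measure lives on a coding space, and the preimage under \<open>P\<close> of a set of diameter below \<open>r\<close> is only
  enclosed in a measurable set of mass at most \<open>C * r powr \<sigma>\<close>.  This suffices because the proof is
  countable subadditivity: a cover of \<open>K\<close> gives a cover of the coding space, so its masses have sum
  at least \<open>1\<close>.  A set of diameter \<open>0\<close> is enclosed in a set of mass \<open>2 powr - (n + 2)\<close>, where \<open>n\<close> is its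
  place in the cover.
\<close>

lemma mass_distribution_principle:
  fixes P :: "'m \<Rightarrow> 'a::metric_space"
  assumes M: "prob_space M" and P: "\<And>\<omega>. \<omega> \<in> space M \<Longrightarrow> P \<omega> \<in> K"
    and const: "0 < C" "0 < g" "0 < \<sigma>"
    and mass: "\<And>U r. 0 < r \<Longrightarrow> r < g \<Longrightarrow> (\<And>x y. x \<in> U \<Longrightarrow> y \<in> U \<Longrightarrow> dist x y < r) \<Longrightarrow>
      \<exists>Q\<in>sets M. {\<omega> \<in> space M. P \<omega> \<in> U} \<subseteq> Q \<and> emeasure M Q \<le> ennreal (C * r powr \<sigma>)"
  shows "ereal \<sigma> \<le> hausdorff_dim K"
  unfolding hausdorff_dim_def
proof (rule INF_greatest, rule ccontr)
  fix s assume s: "s \<in> {s. 0 \<le> s \<and> hausdorff_measure s K = 0}" and "\<not> ereal \<sigma> \<le> ereal s"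
  then have s\<sigma>: "0 \<le> s" "s < \<sigma>" "hausdorff_measure s K = 0" by auto
  define \<delta> where "\<delta> = min g 1 / 4"
  have \<delta>: "0 < \<delta>" "2 * \<delta> < g" "\<delta> < 1" using const by (auto simp: \<delta>_def)
  \<comment> \<open>chosen so that a cover of cost \<open>\<eta>\<close> carries mass at most \<open>1 / 4\<close>\<close>
  define \<eta> where "\<eta> = 1 / (4 * (C * 2 powr \<sigma>))"
  have \<eta>: "0 < \<eta>" using const by (simp add: \<eta>_def)
  have "hausdorff_premeasure s \<delta> K \<le> hausdorff_measure s K"
    unfolding hausdorff_measure_def using \<delta> by (intro SUP_upper) auto
  then have "hausdorff_premeasure s \<delta> K < ennreal \<eta>" using s\<sigma> \<eta> by simp
  then obtain U where "U \<in> {U. (\<forall>n. bounded (U n) \<and> diameter (U n) \<le> \<delta>) \<and> K \<subseteq> (\<Union>n. U n)}"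
    and sumU: "(\<Sum>n. ennreal (diameter_power s (U n))) < ennreal \<eta>"
    unfolding hausdorff_premeasure_def INF_less_iff by blast
  then have U: "\<And>n. bounded (U n)" "\<And>n. diameter (U n) \<le> \<delta>" "K \<subseteq> (\<Union>n. U n)" by auto
  have ex: "\<exists>Q\<in>sets M. {\<omega> \<in> space M. P \<omega> \<in> U n} \<subseteq> Q \<and>
      emeasure M Q \<le> ennreal (C * 2 powr \<sigma> * diameter_power s (U n)) + ennreal ((1 / 2) ^ Suc (Suc n))" for n
  proof (cases "0 < diameter (U n)")
    case True
    let ?d = "diameter (U n)"
    have ne: "U n \<noteq> {}" using True by auto
    have "dist x y < 2 * ?d" if "x \<in> U n" "y \<in> U n" for x y
      using diameter_bounded_bound[OF U(1) that] True by simp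
    moreover have "2 * ?d < g" using U(2)[of n] \<delta> by linarith
    ultimately obtain Q where Q: "Q \<in> sets M" "{\<omega> \<in> space M. P \<omega> \<in> U n} \<subseteq> Q" "emeasure M Q \<le> ennreal (C * (2 * ?d) powr \<sigma>)"
      using mass[of "2 * ?d" "U n"] True by auto
    have "?d powr \<sigma> \<le> diameter_power s (U n)"
    proof -
      have "?d powr \<sigma> \<le> ?d powr s" using True U(2)[of n] \<delta> s\<sigma> by (intro powr_mono') auto
      also have "\<dots> = diameter_power s (U n)" using ne True by (simp add: diameter_power_def)
      finally show ?thesis .
    qed
    then have "C * (2 * ?d) powr \<sigma> \<le> C * 2 powr \<sigma> * diameter_power s (U n)"
      using const True by (simp add: powr_mult mult.assoc)
    then have "emeasure M Q \<le> ennreal (C * 2 powr \<sigma> * diameter_power s (U n))"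
      using Q(3) by (meson ennreal_leI order_trans)
    then show ?thesis using Q(1,2) by (meson add_increasing2 zero_le)
  next
    case False
    have "((\<lambda>r. C * r powr \<sigma>) \<longlongrightarrow> C * 0 powr \<sigma>) (at_right 0)"
      using const by (intro tendsto_intros) (auto simp: eventually_at_right_less eventually_at_filter)
    then have "\<forall>\<^sub>F r in at_right 0. C * r powr \<sigma> < (1 / 2) ^ Suc (Suc n)"
      by (rule order_tendstoD(2)) simp
    moreover have "\<forall>\<^sub>F r in at_right (0::real). 0 < r \<and> r < g"
      unfolding eventually_at_right_field using const by (intro exI[of _ g]) auto
    ultimately have "\<forall>\<^sub>F r in at_right 0. C * r powr \<sigma> < (1 / 2) ^ Suc (Suc n) \<and> 0 < r \<and> r < g"
      by eventually_elim auto
    then obtain r where r: "C * r powr \<sigma> < (1 / 2) ^ Suc (Suc n)" "0 < r" "r < g"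
      using eventually_happens[of _ "at_right (0::real)"] by force
    have "dist x y < r" if "x \<in> U n" "y \<in> U n" for x y
      using diameter_bounded_bound[OF U(1) that] False r(2) by linarith
    then obtain Q where Q: "Q \<in> sets M" "{\<omega> \<in> space M. P \<omega> \<in> U n} \<subseteq> Q" "emeasure M Q \<le> ennreal (C * r powr \<sigma>)"
      using mass[OF r(2,3), of "U n"] by auto
    have "emeasure M Q \<le> ennreal ((1 / 2) ^ Suc (Suc n))"
      using Q(3) r(1) by (meson ennreal_leI less_imp_le order_trans)
    then show ?thesis using Q(1,2) by (meson add_increasing zero_le)
  qed
  define R where "R n Q \<longleftrightarrow> Q \<in> sets M \<and> {\<omega> \<in> space M. P \<omega> \<in> U n} \<subseteq> Q \<and>
      emeasure M Q \<le> ennreal (C * 2 powr \<sigma> * diameter_power s (U n)) + ennreal ((1 / 2) ^ Suc (Suc n))" for n Q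
  have "\<exists>Q. R n Q" for n
    using ex[of n] unfolding R_def Bex_def .
  then obtain Q where "\<And>n. R n (Q n)" by metis
  then have Q: "\<And>n. Q n \<in> sets M" "\<And>n. {\<omega> \<in> space M. P \<omega> \<in> U n} \<subseteq> Q n"
    "\<And>n. emeasure M (Q n) \<le> ennreal (C * 2 powr \<sigma> * diameter_power s (U n)) + ennreal ((1 / 2) ^ Suc (Suc n))"
    by (simp_all only: R_def)
  have "space M \<subseteq> (\<Union>n. Q n)" using P U(3) Q(2) by blast
  then have "emeasure M (space M) \<le> emeasure M (\<Union>n. Q n)"
    by (rule emeasure_mono) (use Q(1) in auto)
  then have "1 \<le> emeasure M (\<Union>n. Q n)"
    by (simp only: prob_space.emeasure_space_1[OF M])
  also have "\<dots> \<le> (\<Sum>n. emeasure M (Q n))"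
    using Q(1) by (intro emeasure_subadditive_countably) auto
  also have "\<dots> \<le> (\<Sum>n. ennreal (C * 2 powr \<sigma> * diameter_power s (U n)) + ennreal ((1 / 2) ^ Suc (Suc n)))"
    by (intro suminf_le Q(3)) auto
  also have "\<dots> = (\<Sum>n. ennreal (C * 2 powr \<sigma> * diameter_power s (U n))) + (\<Sum>n. ennreal ((1 / 2) ^ Suc (Suc n)))"
    by (rule suminf_add[symmetric]) auto
  also have "(\<Sum>n. ennreal ((1 / 2) ^ Suc (Suc n))) = ennreal (1 / 2)"
  proof (rule suminf_ennreal_eq)
    have "(\<lambda>n. (1 / 4) * (1 / 2) ^ n) sums ((1 / 4) * (1 / (1 - 1 / 2 :: real)))"
      by (intro sums_mult geometric_sums) simp
    then show "(\<lambda>n. (1 / 2 :: real) ^ Suc (Suc n)) sums (1 / 2)" by simp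
  qed simp
  also have "(\<Sum>n. ennreal (C * 2 powr \<sigma> * diameter_power s (U n))) = ennreal (C * 2 powr \<sigma>) * (\<Sum>n. ennreal (diameter_power s (U n)))"
    using const by (simp add: ennreal_mult diameter_power_nonneg ennreal_suminf_cmult)
  also have "\<dots> \<le> ennreal (C * 2 powr \<sigma>) * ennreal \<eta>"
    using sumU by (intro mult_left_mono) auto
  also have "\<dots> = ennreal (1 / 4)"
    using const by (simp add: \<eta>_def flip: ennreal_mult)
  finally have "1 \<le> ennreal (1 / 4) + ennreal (1 / 2)" by (simp add: add_right_mono)
  also have "\<dots> = ennreal (1 / 4 + 1 / 2)" by (rule ennreal_plus[symmetric]) auto
  finally show False by (simp only: ennreal_ge_1)
qed

section \<open>Empirical entropy and counting of words\<close>

text \<open>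
  The length of the word times the Shannon entropy of its empirical distribution.
\<close>

definition word_ent :: "'b list \<Rightarrow> real" where
  "word_ent xs = (\<Sum>x\<leftarrow>xs. - ln (real (count_list xs x) / real (length xs)))"

lemma sum_list_eq_sum_count:
  fixes f :: "'b \<Rightarrow> real"
  assumes "finite A" "set xs \<subseteq> A"
  shows "(\<Sum>x\<leftarrow>xs. f x) = (\<Sum>x\<in>A. real (count_list xs x) * f x)"
  using assms(2)
proof (induction xs)
  case (Cons y xs)
  have "(\<Sum>x\<in>A. real (count_list (y # xs) x) * f x) = (\<Sum>x\<in>A. real (count_list xs x) * f x + (if x = y then f x else 0))"
    by (intro sum.cong) (auto simp: algebra_simps)
  also have "\<dots> = (\<Sum>x\<in>A. real (count_list xs x) * f x) + f y"
    using Cons.prems assms(1) by (simp add: sum.distrib sum.delta)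
  finally show ?case using Cons by simp
qed simp

lemma sum_count_list: "finite A \<Longrightarrow> set xs \<subseteq> A \<Longrightarrow> (\<Sum>x\<in>A. real (count_list xs x)) = real (length xs)"
  using sum_list_eq_sum_count[of A xs "\<lambda>_. 1"] by (simp add: sum_list_triv)

text \<open>
  Among all product measures, the empirical one makes a word most likely.
\<close>

lemma word_ent_le:
  fixes p :: "'b \<Rightarrow> real"
  assumes A: "finite A" "set xs \<subseteq> A" and p: "\<And>x. x \<in> A \<Longrightarrow> 0 \<le> p x" "\<And>x. x \<in> set xs \<Longrightarrow> 0 < p x"
    and sum: "(\<Sum>x\<in>A. p x) \<le> 1"
  shows "word_ent xs \<le> (\<Sum>x\<leftarrow>xs. - ln (p x))"
proof (cases "xs = []")
  case False
  let ?n = "real (length xs)"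
  let ?f = "\<lambda>x. real (count_list xs x) / ?n"
  have n: "0 < ?n" using False by simp
  have "(\<Sum>x\<in>A. ?f x * ln (p x)) \<le> (\<Sum>x\<in>A. ?f x * ln (?f x))"
  proof (rule gibbs_inequality[OF A(1)])
    show "(\<Sum>a\<in>A. p a) \<le> (\<Sum>a\<in>A. ?f a)"
      using sum sum_count_list[OF A] n by (simp flip: sum_divide_distrib)
    show "p x = 0 \<Longrightarrow> ?f x = 0" if "x \<in> A" for x
      using p(2)[of x] count_notin[of x xs] by fastforce
  qed (use p in auto)
  then have "?n * (\<Sum>x\<in>A. ?f x * ln (p x)) \<le> ?n * (\<Sum>x\<in>A. ?f x * ln (?f x))"
    using n by (intro mult_left_mono) auto
  moreover have "?n * (\<Sum>x\<in>A. ?f x * g x) = (\<Sum>x\<in>A. real (count_list xs x) * g x)" for g :: "'b \<Rightarrow> real"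
    unfolding sum_distrib_left by (intro sum.cong refl) (use n in simp)
  ultimately have "(\<Sum>x\<in>A. real (count_list xs x) * ln (p x)) \<le> (\<Sum>x\<in>A. real (count_list xs x) * ln (?f x))"
    by simp
  then show ?thesis
    unfolding word_ent_def sum_list_eq_sum_count[OF A] by (simp add: sum_negf)
qed (simp add: word_ent_def)

lemma count_list_pos: "x \<in> set xs \<Longrightarrow> 0 < count_list xs x"
  by (metis count_list_0_iff gr0I)

lemma word_ent_nonneg: "0 \<le> word_ent xs"
  unfolding word_ent_def
proof (rule sum_list_nonneg, clarsimp)
  fix x assume "x \<in> set xs"
  then have "0 < count_list xs x" "count_list xs x \<le> length xs" by (auto simp: count_list_pos count_le_length)
  then show "ln (real (count_list xs x) / real (length xs)) \<le> 0"
    by (intro ln_le_zero_iff[THEN iffD2]) (auto simp: divide_simps)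
qed

text \<open>
  Concavity of entropy: the empirical distribution of the concatenation is a competitor for each part.
\<close>

lemma word_ent_append: "word_ent xs + word_ent ys \<le> word_ent (xs @ ys)"
proof (cases "xs @ ys = []")
  case False
  let ?p = "\<lambda>x. real (count_list (xs @ ys) x) / real (length (xs @ ys))"
  let ?A = "set (xs @ ys)"
  have sum: "(\<Sum>x\<in>?A. ?p x) \<le> 1"
    using sum_count_list[of ?A "xs @ ys"] False by (simp only: sum_divide_distrib[symmetric]) simp
  have pos: "0 < ?p x" if "x \<in> ?A" for x
  proof (rule divide_pos_pos)
    show "0 < real (count_list (xs @ ys) x)" using count_list_pos[OF that] by (simp only: of_nat_0_less_iff)
    show "0 < real (length (xs @ ys))" using False by (simp only: of_nat_0_less_iff length_greater_0_conv not_False_eq_True)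
  qed
  have "word_ent xs \<le> (\<Sum>x\<leftarrow>xs. - ln (?p x))"
    by (rule word_ent_le[where A = ?A]) (use sum pos in \<open>auto simp del: count_list_append\<close>)
  moreover have "word_ent ys \<le> (\<Sum>x\<leftarrow>ys. - ln (?p x))"
    by (rule word_ent_le[where A = ?A]) (use sum pos in \<open>auto simp del: count_list_append\<close>)
  ultimately show ?thesis
    unfolding word_ent_def[of "xs @ ys"] by (simp del: count_list_append)
qed (simp add: word_ent_def)

lemma word_ent_le_log_card:
  assumes "finite A" "set xs \<subseteq> A"
  shows "word_ent xs \<le> real (length xs) * ln (real (card A))"
proof (cases "A = {}")
  case False
  then have c: "0 < card A" using assms by (simp add: card_gt_0_iff)
  have "word_ent xs \<le> (\<Sum>x\<leftarrow>xs. - ln (1 / real (card A)))"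
    by (rule word_ent_le[OF assms]) (use c in auto)
  then show ?thesis using c by (simp add: ln_div sum_list_triv)
qed (use assms in \<open>simp add: word_ent_def\<close>)

text \<open>
  The \<open>n\<close>-fold product measure of \<open>p\<close>, summed over all words.
\<close>

lemma sum_lists_prod:
  fixes p :: "'b \<Rightarrow> real"
  assumes "finite A"
  shows "(\<Sum>xs\<in>{xs. set xs \<subseteq> A \<and> length xs = n}. prod_list (map p xs)) = (\<Sum>x\<in>A. p x) ^ n"
proof (induction n)
  case (Suc n)
  let ?S = "{xs. set xs \<subseteq> A \<and> length xs = n}"
  have inj: "inj_on (\<lambda>(xs, x). x # xs) (?S \<times> A)" by (auto intro: inj_onI)
  have "(\<Sum>xs\<in>{xs. set xs \<subseteq> A \<and> length xs = Suc n}. prod_list (map p xs))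
      = (\<Sum>(xs, x)\<in>?S \<times> A. p x * prod_list (map p xs))"
    unfolding lists_length_Suc_eq by (subst sum.reindex[OF inj]) (simp add: case_prod_unfold)
  also have "\<dots> = (\<Sum>xs\<in>?S. \<Sum>x\<in>A. p x * prod_list (map p xs))"
    by (simp add: sum.cartesian_product)
  also have "\<dots> = (\<Sum>x\<in>A. p x) * (\<Sum>xs\<in>?S. prod_list (map p xs))"
    by (simp add: sum_product sum.swap[of _ A])
  finally show ?case using Suc by simp
qed (simp cong: conj_cong)

lemma exp_word_ent: "exp (- word_ent xs) = prod_list (map (\<lambda>x. real (count_list xs x) / real (length xs)) xs)"
proof -
  have "exp (- (\<Sum>y\<leftarrow>ys. - ln (f y))) = prod_list (map f ys)" if "\<And>y. y \<in> set ys \<Longrightarrow> 0 < f y" for ys and f :: "'a \<Rightarrow> real"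
    using that by (induction ys) (auto simp: exp_diff exp_add exp_minus field_simps)
  moreover have "0 < real (count_list xs x) / real (length xs)" if "x \<in> set xs" for x
    using that count_list_pos[OF that] by (intro divide_pos_pos) (auto dest: length_pos_if_in_set)
  ultimately show ?thesis unfolding word_ent_def by (simp only:)
qed

text \<open>
  Up to a polynomial factor there are at most \<open>exp h\<close> words of empirical entropy \<open>h\<close>: the summand is the probability of the
  word under its own empirical distribution, each product measure has total mass \<open>1\<close>, and there are
  at most \<open>(n + 1) ^ card A\<close> empirical distributions of words of length \<open>n\<close>.
\<close>

lemma sum_exp_word_ent:
  assumes A: "finite A"
  shows "(\<Sum>xs\<in>{xs. set xs \<subseteq> A \<and> length xs = n}. exp (- word_ent xs)) \<le> real (n + 1) ^ card A"
proof -
  let ?S = "{xs. set xs \<subseteq> A \<and> length xs = n}"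
  let ?T = "{c \<in> A \<rightarrow>\<^sub>E {0..n}. (\<Sum>x\<in>A. c x) = n}"
  let ?g = "\<lambda>c xs. prod_list (map (\<lambda>x. real (c x) / real n) xs)"
  have finT: "finite ?T" using A by (simp add: finite_PiE)
  have finS: "finite ?S" using A by (rule finite_lists_length_eq)
  have nn: "0 \<le> ?g c xs" for c xs by (rule prod_list_nonneg) auto
  have "exp (- word_ent xs) \<le> (\<Sum>c\<in>?T. ?g c xs)" if xs: "xs \<in> ?S" for xs
  proof -
    let ?c = "restrict (count_list xs) A"
    have le: "count_list xs x \<le> n" for x using xs count_le_length[of xs x] by simp
    have "(\<Sum>x\<in>A. real (count_list xs x)) = real n" using xs A sum_count_list[of A xs] by simp
    then have "(\<Sum>x\<in>A. count_list xs x) = n" by (simp flip: of_nat_sum)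
    moreover have "?c \<in> A \<rightarrow>\<^sub>E {0..n}" using le by simp
    ultimately have c: "?c \<in> ?T" by simp
    have "exp (- word_ent xs) = ?g ?c xs"
      unfolding exp_word_ent using xs by (intro arg_cong[of _ _ prod_list] map_cong) auto
    also have "\<dots> \<le> (\<Sum>c\<in>?T. ?g c xs)"
      by (rule member_le_sum[OF c nn finT])
    finally show ?thesis .
  qed
  then have "(\<Sum>xs\<in>?S. exp (- word_ent xs)) \<le> (\<Sum>xs\<in>?S. \<Sum>c\<in>?T. ?g c xs)" by (rule sum_mono)
  also have "\<dots> = (\<Sum>c\<in>?T. \<Sum>xs\<in>?S. ?g c xs)" by (rule sum.swap)
  also have "\<dots> = (\<Sum>c\<in>?T. (\<Sum>x\<in>A. real (c x) / real n) ^ n)"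
    by (simp add: sum_lists_prod[OF A])
  also have "\<dots> \<le> (\<Sum>c\<in>?T. 1)"
  proof (rule sum_mono)
    fix c assume c: "c \<in> ?T"
    then have "(\<Sum>x\<in>A. real (c x) / real n) = real n / real n"
      by (simp flip: sum_divide_distrib of_nat_sum)
    then show "(\<Sum>x\<in>A. real (c x) / real n) ^ n \<le> 1" by (cases "n = 0") auto
  qed
  also have "\<dots> = real (card ?T)" by simp
  also have "\<dots> \<le> real (card (A \<rightarrow>\<^sub>E {0..n}))"
    using A by (intro of_nat_mono card_mono finite_PiE) auto
  also have "\<dots> = real (n + 1) ^ card A" by (simp add: card_funcsetE[OF A])
  finally show ?thesis .
qed

lemma sum_exp_word_ent_le:
  assumes "finite A"
  shows "(\<Sum>zs\<in>{zs. set zs \<subseteq> A \<and> length zs \<le> M}. exp (- word_ent zs)) \<le> real (M + 1) ^ (card A + 1)"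
proof -
  have "{zs. set zs \<subseteq> A \<and> length zs \<le> M} = (\<Union>n\<in>{..M}. {zs. set zs \<subseteq> A \<and> length zs = n})" by auto
  then have "(\<Sum>zs\<in>{zs. set zs \<subseteq> A \<and> length zs \<le> M}. exp (- word_ent zs))
      = (\<Sum>n\<le>M. \<Sum>zs\<in>{zs. set zs \<subseteq> A \<and> length zs = n}. exp (- word_ent zs))"
    by (simp only:) (intro sum.UNION_disjoint, use assms finite_lists_length_eq in auto)
  also have "\<dots> \<le> (\<Sum>n\<le>M. real (M + 1) ^ card A)"
    by (intro sum_mono order_trans[OF sum_exp_word_ent[OF assms]] power_mono) auto
  also have "\<dots> = real (M + 1) ^ (card A + 1)" by simp
  finally show ?thesis .
qed

text \<open>
  Words over a fixed word of classes are chosen letter by letter, each in its own class.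
\<close>

lemma sum_fibre_prod:
  fixes q :: "'b \<Rightarrow> real"
  assumes "finite A"
  shows "(\<Sum>ys\<in>{ys. set ys \<subseteq> A \<and> map f ys = zs}. prod_list (map q ys)) = prod_list (map (\<lambda>z. \<Sum>y\<in>{y\<in>A. f y = z}. q y) zs)"
proof (induction zs)
  case Nil
  have "{ys. set ys \<subseteq> A \<and> map f ys = []} = {[]}" by auto
  then show ?case by simp
next
  case (Cons z zs)
  let ?S = "{ys. set ys \<subseteq> A \<and> map f ys = zs}" and ?Y = "{y\<in>A. f y = z}"
  have eq: "{ys. set ys \<subseteq> A \<and> map f ys = z # zs} = (\<lambda>(y, ys). y # ys) ` (?Y \<times> ?S)"
    by (auto simp: image_iff map_eq_Cons_conv)
  have inj: "inj_on (\<lambda>(y, ys). y # ys) (?Y \<times> ?S)" by (auto intro: inj_onI)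
  have "(\<Sum>ys\<in>{ys. set ys \<subseteq> A \<and> map f ys = z # zs}. prod_list (map q ys)) = (\<Sum>(y, ys)\<in>?Y \<times> ?S. q y * prod_list (map q ys))"
    unfolding eq by (subst sum.reindex[OF inj]) (simp add: case_prod_unfold)
  also have "\<dots> = (\<Sum>y\<in>?Y. q y) * (\<Sum>ys\<in>?S. prod_list (map q ys))"
    by (simp add: sum_product sum.cartesian_product)
  finally show ?case using Cons by simp
qed

text \<open>
  A weak form of Stirling's formula; a logarithmic error is negligible against the length of a word.
\<close>

lemma ln_fact_bounds:
  "real n * ln (real n) - real n \<le> ln (fact n)"
  "ln (fact n) \<le> real n * ln (real n) - real n + ln (real (n + 1)) + 1"
proof -
  have *: "real n * ln (real n) - real n \<le> ln (fact n) \<and> ln (fact n) \<le> real n * ln (real n) - real n + ln (real n) + 1"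
    if "1 \<le> n"
    using that
  proof (induction n rule: nat_induct_at_least)
    case (Suc n)
    then have n: "0 < real n" by simp
    define u where "u = ln (real n + 1) - ln (real n)"
    have "ln (1 + 1 / real n) \<le> 1 / real n" using n by (intro ln_add_one_self_le_self) auto
    moreover have "1 + 1 / real n = (real n + 1) / real n" using n by (simp add: field_simps)
    moreover have "ln ((real n + 1) / real n) = u" unfolding u_def using n by (simp add: ln_div)
    ultimately have b: "real n * u \<le> 1" using n by (simp add: field_simps)
    have "ln (real n / (real n + 1)) \<le> real n / (real n + 1) - 1"
      using n by (intro ln_le_minus_one) auto
    moreover have "ln (real n / (real n + 1)) = - u" unfolding u_def using n by (simp add: ln_div)
    moreover have "real n / (real n + 1) - 1 = - (1 / (real n + 1))" using n by (simp add: field_simps)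
    ultimately have c: "1 \<le> (real n + 1) * u" using n by (simp add: field_simps)
    have f: "ln (fact (Suc n)) = ln (real n + 1) + ln (fact n :: real)"
      using ln_mult_pos[of "real n + 1" "fact n"] n by (simp add: add.commute)
    have "ln (real n + 1) = ln (real n) + u" by (simp add: u_def)
    then show ?case
      using Suc.IH b c unfolding f by (simp add: add.commute algebra_simps)
  qed simp
  show "real n * ln (real n) - real n \<le> ln (fact n)"
    using * by (cases "n = 0") auto
  show "ln (fact n) \<le> real n * ln (real n) - real n + ln (real (n + 1)) + 1"
  proof (cases "n = 0")
    case False
    then have "ln (real n) \<le> ln (real (n + 1))" by simp
    moreover have "1 \<le> n" using False by simp
    ultimately show ?thesis using * by linarith
  qed simp
qed

text \<open>
  The number of words with letter counts \<open>c\<close> is a multinomial coefficient, which is the exponential of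
  the entropy up to a polynomial factor.
\<close>

lemma ln_card_permutations_ge:
  fixes c :: "'b \<Rightarrow> nat"
  assumes A: "finite A" and M: "\<And>x. count M x = (if x \<in> A then c x else 0)" and n: "n = (\<Sum>x\<in>A. c x)"
  shows "real n * ln (real n) - (\<Sum>x\<in>A. real (c x) * ln (real (c x))) - real (card A) * (ln (real (n + 1)) + 1)
    \<le> ln (real (card (permutations_of_multiset M)))"
proof -
  have set: "set_mset M \<subseteq> A" using M by (auto simp: count_greater_zero_iff[symmetric] simp del: count_greater_zero_iff split: if_splits)
  have size: "size M = n"
    unfolding size_multiset_overloaded_eq n using set A M
    by (intro sum.mono_neutral_cong_left) (auto simp: not_in_iff)
  have "(\<Prod>x\<in>set_mset M. fact (count M x)) = (\<Prod>x\<in>A. fact (c x) :: nat)"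
    using set A M by (intro prod.mono_neutral_cong_left) (auto simp: not_in_iff)
  then have "card (permutations_of_multiset M) * (\<Prod>x\<in>A. fact (c x)) = (fact n :: nat)"
    using card_permutations_of_multiset_aux[of M] size by simp
  then have "real (card (permutations_of_multiset M) * (\<Prod>x\<in>A. fact (c x))) = real (fact n)"
    by (simp only:)
  then have "real (card (permutations_of_multiset M)) * (\<Prod>x\<in>A. fact (c x)) = fact n"
    by simp
  moreover have "(\<Prod>x\<in>A. fact (c x) :: real) \<noteq> 0" using A by simp
  ultimately have "real (card (permutations_of_multiset M)) = fact n / (\<Prod>x\<in>A. fact (c x))"
    by (simp add: eq_divide_eq)
  then have "ln (real (card (permutations_of_multiset M))) = ln (fact n) - (\<Sum>x\<in>A. ln (fact (c x)))"
    using A by (simp add: ln_div ln_prod prod_pos)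
  moreover have "(\<Sum>x\<in>A. ln (fact (c x))) \<le> (\<Sum>x\<in>A. real (c x) * ln (real (c x)) - real (c x) + (ln (real (n + 1)) + 1))"
  proof (rule sum_mono)
    fix x assume "x \<in> A"
    then have "c x \<le> n" unfolding n using A by (intro member_le_sum) auto
    then have "ln (real (c x + 1)) \<le> ln (real (n + 1))" by simp
    then show "ln (fact (c x)) \<le> real (c x) * ln (real (c x)) - real (c x) + (ln (real (n + 1)) + 1)"
      using ln_fact_bounds(2)[of "c x"] by linarith
  qed
  moreover have "\<dots> = (\<Sum>x\<in>A. real (c x) * ln (real (c x))) - real n + real (card A) * (ln (real (n + 1)) + 1)"
    by (simp add: sum.distrib sum_subtractf n)
  ultimately show ?thesis using ln_fact_bounds(1)[of n] by linarith
qed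

section \<open>Limits and growth\<close>

lemma summable_poly_exp:
  assumes "0 < \<kappa>"
  shows "summable (\<lambda>k. real (k + 1) ^ P * exp (- \<kappa> * real k))"
proof (rule summable_comparison_test_ev)
  have "((\<lambda>k. real (k + 1) powr real P * exp (- (\<kappa> / 2) * real k)) \<longlongrightarrow> 0) sequentially"
    using assms by real_asymp
  then have "\<forall>\<^sub>F k in sequentially. real (k + 1) powr real P * exp (- (\<kappa> / 2) * real k) < 1"
    by (intro order_tendstoD(2)) auto
  then show "\<forall>\<^sub>F k in sequentially. norm (real (k + 1) ^ P * exp (- \<kappa> * real k)) \<le> exp (- (\<kappa> / 2)) ^ k"
  proof eventually_elim
    case (elim k)
    have "real (k + 1) ^ P * exp (- \<kappa> * real k) = real (k + 1) powr real P * exp (- (\<kappa> / 2) * real k) * exp (- (\<kappa> / 2)) ^ k"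
      by (simp add: powr_realpow mult.assoc flip: exp_add exp_of_nat_mult)
    also have "\<dots> \<le> 1 * exp (- (\<kappa> / 2)) ^ k"
      using elim by (intro mult_right_mono) auto
    finally show ?case by simp
  qed
  show "summable (\<lambda>k. exp (- (\<kappa> / 2)) ^ k)"
    using assms by (intro summable_geometric) auto
qed

lemma le_of_powr_bound:
  fixes p q A B :: real
  assumes "\<And>X. 1 \<le> X \<Longrightarrow> A * X powr p \<le> B * X powr q" "0 < A"
  shows "p \<le> q"
proof (rule ccontr)
  assume "\<not> p \<le> q"
  then have "0 < p - q" by simp
  then have "filterlim (\<lambda>X. A * X powr (p - q)) at_top at_top"
    using assms(2) by real_asymp
  then have "\<forall>\<^sub>F X in at_top. B < A * X powr (p - q)"
    by (simp add: filterlim_at_top_dense)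
  then have "\<forall>\<^sub>F X in at_top. B < A * X powr (p - q) \<and> 1 \<le> X"
    using eventually_ge_at_top[of 1] by eventually_elim auto
  then obtain X where X: "B < A * X powr (p - q)" "1 \<le> X"
    unfolding eventually_at_top_linorder by (meson order_refl)
  have "B * X powr q < A * X powr (p - q) * X powr q"
    using X by simp
  also have "\<dots> = A * X powr p" by (simp add: mult.assoc flip: powr_add)
  finally show False using assms(1)[OF X(2)] by linarith
qed

text \<open>
  The level at which pieces of size \<open>g * B ^ m\<close> reach the scale \<open>r\<close>; they overshoot by a factor \<open>B\<close> at most.
\<close>

lemma first_power_below:
  fixes B r g :: real
  assumes "0 < B" "B < 1" "0 < r" "r < g"
  obtains q :: nat where "g * B ^ q \<le> r" "\<And>m. m < q \<Longrightarrow> r < g * B ^ m" "B * r \<le> g * B ^ q"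
proof -
  obtain n where "B ^ n < r / g" using real_arch_pow_inv[of "r / g" B] assms by auto
  then have ex: "\<exists>n. g * B ^ n \<le> r" using assms by (intro exI[of _ n]) (simp add: field_simps)
  define q where "q = (LEAST n. g * B ^ n \<le> r)"
  have q: "g * B ^ q \<le> r" unfolding q_def by (rule LeastI_ex[OF ex])
  have less: "r < g * B ^ m" if "m < q" for m
    using not_less_Least[of m] that unfolding q_def by force
  obtain m where m: "q = Suc m" using q assms by (cases q) auto
  have "B * r \<le> B * (g * B ^ m)" using less[of m] m assms by (intro mult_left_mono) auto
  also have "\<dots> = g * B ^ q" by (simp add: m)
  finally show ?thesis using that[OF q less] by blast
qed

text \<open>
  With \<open>ln 0 = 0\<close> the limit is immediate for terms that vanish identically; this avoids the
  discontinuity of \<open>ln\<close> at \<open>0\<close>.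
\<close>

lemma xlnx_tendsto:
  fixes f :: "nat \<Rightarrow> real"
  assumes "f \<longlonglongrightarrow> x" "x = 0 \<Longrightarrow> \<forall>n. f n = 0"
  shows "(\<lambda>n. f n * ln (f n)) \<longlonglongrightarrow> x * ln x"
proof (cases "x = 0")
  case False
  then show ?thesis by (intro tendsto_intros assms)
qed (use assms(2) in simp)

lemma floor_frequency_tendsto:
  assumes "0 \<le> (w :: real)"
  shows "(\<lambda>k. real (nat \<lfloor>real k * w\<rfloor>) / real k) \<longlonglongrightarrow> w"
proof (rule tendsto_sandwich)
  have b: "real k * w - 1 \<le> real (nat \<lfloor>real k * w\<rfloor>)" "real (nat \<lfloor>real k * w\<rfloor>) \<le> real k * w" for k
    using assms by (simp_all add: floor_le_iff le_floor_iff)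
  show "\<forall>\<^sub>F k in sequentially. (real k * w - 1) / real k \<le> real (nat \<lfloor>real k * w\<rfloor>) / real k"
    using b by (intro always_eventually allI divide_right_mono) auto
  show "\<forall>\<^sub>F k in sequentially. real (nat \<lfloor>real k * w\<rfloor>) / real k \<le> real k * w / real k"
    using b by (intro always_eventually allI divide_right_mono) auto
  show "(\<lambda>k. (real k * w - 1) / real k) \<longlonglongrightarrow> w" by real_asymp
  show "(\<lambda>k. real k * w / real k) \<longlonglongrightarrow> w" by real_asymp
qed

section \<open>Coordinates and diagonal affine maps of the plane\<close>

lemma other_neq: "other l \<noteq> l" and other_other: "other (other l) = l"
  using exhaust_2[of l] by (auto simp: other_def)

lemma index_cases: "l = l' \<or> l = other l'"
  using exhaust_2[of l] exhaust_2[of l'] by (auto simp: other_def)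

lemma norm_le_other: 
  fixes x :: "real^2"
  shows "norm x \<le> \<bar>x $ l\<bar> + \<bar>x $ other l\<bar>"
  using norm_le_l1_cart[of x] exhaust_2[of l] by (auto simp: sum_2 other_def)

lemma component_dist_le:
  fixes x y :: "real^2"
  shows "\<bar>x $ l - y $ l\<bar> \<le> dist x y"
  using component_le_norm_cart[of "x - y" l] by (simp add: dist_norm)

lemma dist_le_components:
  fixes x y :: "real^2"
  shows "dist x y \<le> \<bar>x $ l - y $ l\<bar> + \<bar>x $ other l - y $ other l\<bar>"
  using norm_le_other[of "x - y" l] by (simp add: dist_norm)

lemma dist_component_le: "dist (x $ l) (y $ l) \<le> dist x y" for x y :: "real^2"
  using component_dist_le by (simp add: dist_real_def)

lemma dist_scaled: "dist (k *\<^sub>R x) (k *\<^sub>R y) = \<bar>k\<bar> * dist x y" for x y :: "'a::real_normed_vector"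
  by (simp add: dist_norm flip: scaleR_diff_right)

definition diag_aff :: "(2 \<Rightarrow> real) \<Rightarrow> (2 \<Rightarrow> real) \<Rightarrow> real^2 \<Rightarrow> real^2" where
  "diag_aff s c x = (\<chi> l. s l * x $ l + c l)"

lemma diag_aff_nth [simp]: "diag_aff s c x $ l = s l * x $ l + c l"
  by (simp add: diag_aff_def)

text \<open>
  A set of width at most \<open>1\<close> around a line is as easy to cover as its projection to the line, up to
  doubling the radius.
\<close>

lemma coverable_of_thin:
  fixes F :: "(real^2) set"
  assumes thin: "\<And>x. x \<in> F \<Longrightarrow> \<bar>x $ l - p\<bar> \<le> 1"
    and cov: "coverable 1 N ((\<lambda>x. x $ other l) ` F)"
  shows "coverable 2 N F"
proof -
  obtain C where C: "finite C" "real (card C) \<le> N" "(\<lambda>x. x $ other l) ` F \<subseteq> (\<Union>c\<in>C. cball c 1)"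
    using cov unfolding coverable_def by auto
  define v :: "real \<Rightarrow> real^2" where "v q = (\<chi> k. if k = l then p else q)" for q
  have "F \<subseteq> (\<Union>c\<in>v ` C. cball c 2)"
  proof
    fix x assume x: "x \<in> F"
    then obtain q where q: "q \<in> C" "\<bar>x $ other l - q\<bar> \<le> 1"
      using C(3) by (auto simp: dist_real_def abs_minus_commute subset_iff)
    have "dist (v q) x \<le> \<bar>v q $ l - x $ l\<bar> + \<bar>v q $ other l - x $ other l\<bar>"
      by (rule dist_le_components)
    also have "\<dots> \<le> 2"
      using thin[OF x] q by (simp add: v_def other_neq abs_minus_commute)
    finally show "x \<in> (\<Union>c\<in>v ` C. cball c 2)" using q by auto
  qed
  moreover have "real (card (v ` C)) \<le> N" using card_image_le[OF C(1), of v] C(2) by linarith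
  ultimately show ?thesis
    unfolding coverable_def using C(1) by blast
qed

lemma packable_of_projection:
  assumes "packable r N (f ` F)" "\<And>x y. dist (f x) (f y) \<le> dist x y"
  shows "packable r N F"
proof -
  obtain S where S: "finite S" "S \<subseteq> f ` F" "N \<le> real (card S)" "separated_set r S"
    using assms(1) unfolding packable_def by auto
  obtain S' where S': "S' \<subseteq> F" "inj_on f S'" "f ` S' = S" "finite S'"
    using S(1,2) by (metis finite_image_iff subset_image_inj)
  have "separated_set r S'"
    unfolding separated_set_def
  proof (intro ballI impI)
    fix x y assume "x \<in> S'" "y \<in> S'" "x \<noteq> y"
    then have "f x \<noteq> f y" "f x \<in> S" "f y \<in> S" using S' by (auto simp: inj_on_def)
    then have "r \<le> dist (f x) (f y)" using S(4) unfolding separated_set_def by blast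
    then show "r \<le> dist x y" using assms(2) order_trans by blast
  qed
  moreover have "card S' = card S" using S' card_image by metis
  ultimately show ?thesis
    unfolding packable_def using S S' by (intro exI[of _ S']) auto
qed

section \<open>Symbolic description of a separated carpet\<close>

text \<open>
  Strong separation is assumed in both directions, as it is used to recognise both the prefix and the
  window of classes of a nearby point.
\<close>

locale separated_carpet =
  fixes I :: "'i set" and \<beta> d :: "'i \<Rightarrow> 2 \<Rightarrow> real" and K :: "(real^2) set"
  assumes carpet: "baranski_carpet I \<beta> d K"
    and ssc: "\<And>l. strong_separation I \<beta> d K l"

begin

lemma finite_I: "finite I" and card_I: "2 \<le> card I"
  and attractor: "is_attractor I (carpet_map \<beta> d) K"
  and K_unit: "K \<subseteq> cbox 0 1"
  using carpet by (auto simp: baranski_carpet_def)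

lemma I_nonempty: "I \<noteq> {}"
  using card_I by auto

lemma ratio_pos: "i \<in> I \<Longrightarrow> 0 < \<beta> i l" and ratio_less_1: "i \<in> I \<Longrightarrow> \<beta> i l < 1"
  using carpet by (auto simp: baranski_carpet_def)

lemma compact_K: "compact K" and K_nonempty: "K \<noteq> {}" and K_eq: "K = (\<Union>i\<in>I. carpet_map \<beta> d i ` K)"
  using attractor by (auto simp: is_attractor_def)

lemma carpet_map_nth [simp]: "carpet_map \<beta> d i x $ l = coord_map \<beta> d i l (x $ l)"
  by (simp add: carpet_map_def)

lemma carpet_map_in_K: "i \<in> I \<Longrightarrow> x \<in> K \<Longrightarrow> carpet_map \<beta> d i x \<in> K"
  using K_eq by blast

lemma coord_map_eq_imp: 
  assumes "coord_map \<beta> d i l = coord_map \<beta> d i' l"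
  shows "\<beta> i l = \<beta> i' l" "d i l = d i' l"
proof -
  show "d i l = d i' l"
    using fun_cong[OF assms, of 0] by (simp add: coord_map_def)
  then show "\<beta> i l = \<beta> i' l"
    using fun_cong[OF assms, of 1] by (simp add: coord_map_def)
qed

text \<open>
  The elements of \<open>eta_index\<close> are equivalence classes, so the class of a letter is the set itself.
\<close>

definition cls :: "2 \<Rightarrow> 'i \<Rightarrow> 'i set" where
  "cls l i = {i' \<in> I. coord_map \<beta> d i l = coord_map \<beta> d i' l}"

abbreviation classes :: "2 \<Rightarrow> 'i set set" where
  "classes l \<equiv> eta_index I \<beta> d l"

lemma classes_eq: "classes l = cls l ` I"
  by (auto simp: eta_index_def quotient_def cls_def)

lemma finite_classes: "finite (classes l)" and classes_nonempty: "classes l \<noteq> {}"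
  using finite_I I_nonempty by (auto simp: classes_eq)

lemma cls_eq_iff: "i \<in> I \<Longrightarrow> i' \<in> I \<Longrightarrow> cls l i = cls l i' \<longleftrightarrow> coord_map \<beta> d i l = coord_map \<beta> d i' l"
  by (auto simp: cls_def)

lemma cls_in: "i \<in> I \<Longrightarrow> cls l i \<in> classes l" and self_in_cls: "i \<in> I \<Longrightarrow> i \<in> cls l i"
  by (auto simp: classes_eq cls_def)

lemma in_class: "L \<in> classes l \<Longrightarrow> i \<in> L \<Longrightarrow> i \<in> I \<and> cls l i = L"
  by (auto simp: classes_eq cls_def)

lemma class_nonempty: "L \<in> classes l \<Longrightarrow> L \<noteq> {}"
  using self_in_cls by (auto simp: classes_eq)

lemma class_subset: "L \<in> classes l \<Longrightarrow> L \<subseteq> I"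
  using in_class by blast

lemma finite_class: "L \<in> classes l \<Longrightarrow> finite L"
  using class_subset finite_I finite_subset by blast

lemma sum_over_classes: "(\<Sum>i\<in>I. f i) = (\<Sum>L\<in>classes l. \<Sum>i\<in>L. f i)" for f :: "'i \<Rightarrow> real"
proof -
  have "(\<Sum>i\<in>I. f i) = (\<Sum>L\<in>classes l. \<Sum>i\<in>{i\<in>I. cls l i = L}. f i)"
    by (rule sum.group[symmetric]) (use finite_I finite_classes in \<open>auto simp: cls_in\<close>)
  also have "\<dots> = (\<Sum>L\<in>classes l. \<Sum>i\<in>L. f i)"
  proof (rule sum.cong)
    fix L assume L: "L \<in> classes l"
    have "{i\<in>I. cls l i = L} = L"
      using in_class[OF L] self_in_cls by blast
    then show "(\<Sum>i\<in>{i\<in>I. cls l i = L}. f i) = (\<Sum>i\<in>L. f i)" by simp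
  qed simp
  finally show ?thesis .
qed

text \<open>
  The common ratio of the members of a class; the choice is irrelevant by \<open>class_ratio_eq\<close>.
\<close>

definition class_ratio :: "2 \<Rightarrow> 'i set \<Rightarrow> real" where
  "class_ratio l L = \<beta> (SOME i. i \<in> L) l"

definition class_offset :: "2 \<Rightarrow> 'i set \<Rightarrow> real" where
  "class_offset l L = d (SOME i. i \<in> L) l"

lemma class_ratio_eq: "L \<in> classes l \<Longrightarrow> i \<in> L \<Longrightarrow> class_ratio l L = \<beta> i l"
  and class_offset_eq: "L \<in> classes l \<Longrightarrow> i \<in> L \<Longrightarrow> class_offset l L = d i l"
proof -
  assume *: "L \<in> classes l" "i \<in> L"
  have "(SOME i. i \<in> L) \<in> L" using * by (metis someI)
  then have "coord_map \<beta> d (SOME i. i \<in> L) l = coord_map \<beta> d i l"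
    using * in_class by (metis cls_eq_iff)
  from coord_map_eq_imp[OF this] show "class_ratio l L = \<beta> i l" "class_offset l L = d i l"
    by (simp_all add: class_ratio_def class_offset_def)
qed

lemma class_ratio_cls: "i \<in> I \<Longrightarrow> class_ratio l (cls l i) = \<beta> i l"
  by (simp add: class_ratio_eq cls_in self_in_cls)

lemma class_ratio_bounds: "L \<in> classes l \<Longrightarrow> 0 < class_ratio l L \<and> class_ratio l L < 1"
  using class_ratio_eq class_nonempty in_class ratio_pos ratio_less_1 by (metis all_not_in_conv)

text \<open>
  Two letters with the same maps in both directions have the same image of the open unit square, so
  disjointness of these images identifies them.
\<close>

lemma letter_eqI:
  assumes "i \<in> I" "i' \<in> I" "\<And>l. cls l i = cls l i'"
  shows "i = i'"
proof (rule ccontr)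
  assume "i \<noteq> i'"
  have "coord_map \<beta> d i l = coord_map \<beta> d i' l" for l
    using assms cls_eq_iff by blast
  then have "carpet_map \<beta> d i = carpet_map \<beta> d i'"
    by (intro ext) (simp add: carpet_map_def)
  moreover have "carpet_map \<beta> d i ` box 0 1 \<inter> carpet_map \<beta> d i' ` box 0 1 = {}"
    using carpet assms \<open>i \<noteq> i'\<close> by (simp add: baranski_carpet_def)
  moreover have "(\<chi> l. 1/2) \<in> (box 0 1 :: (real^2) set)"
    by (simp add: mem_box_cart)
  ultimately show False by auto
qed

definition bmin :: real where "bmin = Min ((\<lambda>(i, l). \<beta> i l) ` (I \<times> UNIV))"

definition bmax :: real where "bmax = Max ((\<lambda>(i, l). \<beta> i l) ` (I \<times> UNIV))"

lemma bmin_le: "i \<in> I \<Longrightarrow> bmin \<le> \<beta> i l" and le_bmax: "i \<in> I \<Longrightarrow> \<beta> i l \<le> bmax"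
  unfolding bmin_def bmax_def using finite_I by (auto intro!: Min_le Max_ge)

lemma bmin_pos: "0 < bmin"
  unfolding bmin_def using finite_I I_nonempty ratio_pos by (subst Min_gr_iff) auto

lemma bmax_less_1: "bmax < 1"
  unfolding bmax_def using finite_I I_nonempty ratio_less_1 by (subst Max_less_iff) auto

lemma bmin_le_bmax: "bmin \<le> bmax"
  using I_nonempty bmin_le le_bmax by (metis all_not_in_conv order_trans)

lemma bmax_pos: "0 < bmax"
  using bmin_le_bmax bmin_pos by linarith

lemma bmin_less_1: "bmin < 1"
  using bmin_le_bmax bmax_less_1 by linarith

lemma bmin_le_class_ratio: "L \<in> classes l \<Longrightarrow> bmin \<le> class_ratio l L" and class_ratio_le_bmax: "L \<in> classes l \<Longrightarrow> class_ratio l L \<le> bmax"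
  using class_ratio_eq class_nonempty in_class bmin_le le_bmax by (metis all_not_in_conv)+

lemma eta_bounds: "t \<in> eta l K \<Longrightarrow> 0 \<le> t \<and> t \<le> 1"
  using K_unit by (force simp: eta_def mem_box_cart)

lemma K_bounds: "x \<in> K \<Longrightarrow> 0 \<le> x $ l \<and> x $ l \<le> 1"
  using K_unit by (force simp: mem_box_cart)

lemma nth_in_eta: "x \<in> K \<Longrightarrow> x $ l \<in> eta l K"
  by (simp add: eta_def)

lemma compact_eta: "compact (eta l K)"
  unfolding eta_def by (intro compact_continuous_image continuous_intros compact_K)

lemma eta_nonempty: "eta l K \<noteq> {}"
  using K_nonempty by (simp add: eta_def)

lemma coord_map_in_eta: "i \<in> I \<Longrightarrow> t \<in> eta l K \<Longrightarrow> coord_map \<beta> d i l t \<in> eta l K"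
  unfolding eta_def using carpet_map_in_K by (force simp flip: carpet_map_nth)

text \<open>
  The projection is the attractor of the coordinate maps, one for each class.
\<close>

lemma eta_eq: "eta l K = (\<Union>L\<in>classes l. (\<lambda>t. class_ratio l L * t + class_offset l L) ` eta l K)" (is "_ = ?R")
proof
  show "eta l K \<subseteq> ?R"
  proof
    fix t assume "t \<in> eta l K"
    then obtain x where x: "x \<in> K" "t = x $ l" by (auto simp: eta_def)
    then obtain i y where i: "i \<in> I" "y \<in> K" "x = carpet_map \<beta> d i y" using K_eq by blast
    then have "t = class_ratio l (cls l i) * (y $ l) + class_offset l (cls l i)"
      using x by (simp add: coord_map_def class_ratio_cls class_offset_eq[OF cls_in self_in_cls])
    then show "t \<in> ?R" using i cls_in nth_in_eta by blast
  qed
  show "?R \<subseteq> eta l K"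
  proof clarify
    fix L t assume "L \<in> classes l" "t \<in> eta l K"
    moreover then obtain i where "i \<in> L" using class_nonempty by blast
    ultimately show "class_ratio l L * t + class_offset l L \<in> eta l K"
      using coord_map_in_eta[of i t l] in_class by (simp add: class_ratio_eq class_offset_eq coord_map_def)
  qed
qed

text \<open>
  Finitely many pairs of disjoint compact sets have a common positive distance.
\<close>

lemma gap_ex: "\<exists>\<delta>. 0 < \<delta> \<and> \<delta> \<le> 1 \<and> (\<forall>l. \<forall>i\<in>I. \<forall>i'\<in>I. \<forall>s\<in>eta l K. \<forall>t\<in>eta l K.
    cls l i \<noteq> cls l i' \<longrightarrow> \<delta> \<le> \<bar>coord_map \<beta> d i l s - coord_map \<beta> d i' l t\<bar>)"
proof -
  have "\<forall>\<^sub>F \<delta> in at_right 0. \<forall>s\<in>eta l K. \<forall>t\<in>eta l K.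
    cls l i \<noteq> cls l i' \<longrightarrow> \<delta> \<le> \<bar>coord_map \<beta> d i l s - coord_map \<beta> d i' l t\<bar>"
    if "i \<in> I" "i' \<in> I" for i i' l
  proof (cases "cls l i = cls l i'")
    case False
    have comp: "compact (coord_map \<beta> d j l ` eta l K)" for j
      unfolding coord_map_def by (intro compact_continuous_image continuous_intros compact_eta)
    have "coord_map \<beta> d i l ` eta l K \<inter> coord_map \<beta> d i' l ` eta l K = {}"
      by (rule ssc[unfolded strong_separation_def, rule_format, OF cls_in[OF that(1)] cls_in[OF that(2)] False
            self_in_cls[OF that(1)] self_in_cls[OF that(2)]])
    then obtain e where e: "0 < e" "\<forall>x\<in>coord_map \<beta> d i l ` eta l K. \<forall>y\<in>coord_map \<beta> d i' l ` eta l K. e \<le> dist x y"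
      using separate_compact_closed[OF comp compact_imp_closed[OF comp]] by metis
    have "\<forall>\<^sub>F \<delta> in at_right 0. \<delta> < e"
      using e by (auto simp: eventually_at_right)
    then show ?thesis
      by eventually_elim (use e in \<open>force simp: dist_real_def\<close>)
  qed auto
  then have "\<forall>\<^sub>F \<delta> in at_right 0. \<forall>l\<in>UNIV. \<forall>i\<in>I. \<forall>i'\<in>I. \<forall>s\<in>eta l K. \<forall>t\<in>eta l K.
    cls l i \<noteq> cls l i' \<longrightarrow> \<delta> \<le> \<bar>coord_map \<beta> d i l s - coord_map \<beta> d i' l t\<bar>"
    by (intro eventually_ball_finite[OF finite, OF ballI] eventually_ball_finite[OF finite_I, OF ballI])
  moreover have "\<forall>\<^sub>F \<delta> in at_right (0::real). 0 < \<delta> \<and> \<delta> \<le> 1"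
    unfolding eventually_at_right_field by (intro exI[of _ 1]) auto
  ultimately have "\<forall>\<^sub>F \<delta> in at_right 0. (0 < \<delta> \<and> \<delta> \<le> 1) \<and> (\<forall>l\<in>UNIV. \<forall>i\<in>I. \<forall>i'\<in>I. \<forall>s\<in>eta l K. \<forall>t\<in>eta l K.
    cls l i \<noteq> cls l i' \<longrightarrow> \<delta> \<le> \<bar>coord_map \<beta> d i l s - coord_map \<beta> d i' l t\<bar>)"
    by (rule eventually_conj[rotated])
  from eventually_happens[OF this] show ?thesis by (simp add: conj_assoc)
qed

definition gap :: real where
  "gap = (SOME \<delta>. 0 < \<delta> \<and> \<delta> \<le> 1 \<and> (\<forall>l. \<forall>i\<in>I. \<forall>i'\<in>I. \<forall>s\<in>eta l K. \<forall>t\<in>eta l K.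
    cls l i \<noteq> cls l i' \<longrightarrow> \<delta> \<le> \<bar>coord_map \<beta> d i l s - coord_map \<beta> d i' l t\<bar>))"

lemma gap_pos: "0 < gap" and gap_le_1: "gap \<le> 1"
  and gap_le: "\<lbrakk>i \<in> I; i' \<in> I; cls l i \<noteq> cls l i'; s \<in> eta l K; t \<in> eta l K\<rbrakk>
    \<Longrightarrow> gap \<le> \<bar>coord_map \<beta> d i l s - coord_map \<beta> d i' l t\<bar>"
  using someI_ex[OF gap_ex] unfolding gap_def[symmetric] by auto

text \<open>
  The composition of the coordinate maps along a word, first letter outermost.
\<close>

definition coord_word :: "2 \<Rightarrow> 'i list \<Rightarrow> real \<Rightarrow> real" where
  "coord_word l xs t = foldr (\<lambda>i. coord_map \<beta> d i l) xs t"

definition word_map :: "'i list \<Rightarrow> real^2 \<Rightarrow> real^2" where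
  "word_map xs x = foldr (carpet_map \<beta> d) xs x"

text \<open>
  The side length in direction \<open>l\<close> of the cylinder of a word.
\<close>

definition wratio :: "2 \<Rightarrow> 'i list \<Rightarrow> real" where
  "wratio l xs = prod_list (map (\<lambda>i. \<beta> i l) xs)"

lemma word_simps [simp]:
  "coord_word l [] t = t" "coord_word l (i # xs) t = coord_map \<beta> d i l (coord_word l xs t)"
  "word_map [] x = x" "word_map (i # xs) x = carpet_map \<beta> d i (word_map xs x)"
  "wratio l [] = 1" "wratio l (i # xs) = \<beta> i l * wratio l xs"
  "coord_word l (xs @ ys) t = coord_word l xs (coord_word l ys t)"
  "word_map (xs @ ys) x = word_map xs (word_map ys x)"
  "wratio l (xs @ ys) = wratio l xs * wratio l ys"
  by (simp_all add: coord_word_def word_map_def wratio_def)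

lemma word_map_nth: "word_map xs x $ l = coord_word l xs (x $ l)"
  by (induction xs) auto

lemma coord_word_diff: "coord_word l xs s - coord_word l xs t = wratio l xs * (s - t)"
proof (induction xs)
  case (Cons i xs)
  have "coord_word l (i # xs) s - coord_word l (i # xs) t = \<beta> i l * (coord_word l xs s - coord_word l xs t)"
    by (simp add: coord_map_def algebra_simps)
  then show ?case using Cons by simp
qed simp

lemma word_map_in_K: "set xs \<subseteq> I \<Longrightarrow> x \<in> K \<Longrightarrow> word_map xs x \<in> K"
  by (induction xs) (auto intro: carpet_map_in_K)

lemma coord_word_in_eta: "set xs \<subseteq> I \<Longrightarrow> t \<in> eta l K \<Longrightarrow> coord_word l xs t \<in> eta l K"
  by (induction xs) (auto intro: coord_map_in_eta)

lemma wratio_pos: "set xs \<subseteq> I \<Longrightarrow> 0 < wratio l xs"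
  by (induction xs) (auto simp: ratio_pos)

lemma bmin_power_le_wratio: "set xs \<subseteq> I \<Longrightarrow> bmin ^ length xs \<le> wratio l xs"
proof (induction xs)
  case (Cons i xs)
  then show ?case
    using mult_mono[of bmin "\<beta> i l" "bmin ^ length xs" "wratio l xs"] bmin_pos bmin_le[of i l] ratio_pos[of i l] by simp
qed simp

lemma wratio_le_bmax_power: "set xs \<subseteq> I \<Longrightarrow> wratio l xs \<le> bmax ^ length xs"
proof (induction xs)
  case (Cons i xs)
  then show ?case
    using mult_mono[of "\<beta> i l" bmax "wratio l xs" "bmax ^ length xs"] bmax_pos le_bmax[of i l] wratio_pos[of xs l] by simp
qed simp

lemma coord_word_cong:
  assumes "set xs \<subseteq> I" "set ys \<subseteq> I" "map (cls l) xs = map (cls l) ys"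
  shows "coord_word l xs = coord_word l ys" "wratio l xs = wratio l ys"
proof -
  have "coord_word l xs = coord_word l ys \<and> wratio l xs = wratio l ys"
    using assms
  proof (induction xs arbitrary: ys)
    case (Cons i xs)
    then obtain i' ys' where ys: "ys = i' # ys'" by (cases ys) auto
    with Cons.prems have "coord_map \<beta> d i l = coord_map \<beta> d i' l" by (simp add: cls_eq_iff)
    moreover then have "\<beta> i l = \<beta> i' l" by (rule coord_map_eq_imp)
    moreover have "coord_word l xs = coord_word l ys' \<and> wratio l xs = wratio l ys'"
      using Cons ys by auto
    ultimately show ?case using ys by (auto simp: fun_eq_iff)
  qed auto
  then show "coord_word l xs = coord_word l ys" "wratio l xs = wratio l ys" by auto
qed

lemma letters_eqI:
  assumes "set xs \<subseteq> I" "set ys \<subseteq> I" "\<And>l. map (cls l) xs = map (cls l) ys"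
  shows "xs = ys"
proof (rule nth_equalityI)
  show len: "length xs = length ys" using assms(3) map_eq_imp_length_eq by blast
  fix n assume "n < length xs"
  then show "xs ! n = ys ! n"
    using assms len by (intro letter_eqI) (auto simp: list_eq_iff_nth_eq)
qed

text \<open>
  Up to the first letters of different class the two maps agree and contract by the common ratio;
  there the images are at distance at least \<open>gap\<close>.
\<close>

lemma first_difference:
  assumes "set xs \<subseteq> I" "set ys \<subseteq> I" "n < length xs" "n < length ys"
    and eq: "map (cls l) (take n xs) = map (cls l) (take n ys)"
    and neq: "cls l (xs ! n) \<noteq> cls l (ys ! n)"
    and st: "s \<in> eta l K" "t \<in> eta l K"
  shows "gap * wratio l (take n xs) \<le> \<bar>coord_word l xs s - coord_word l ys t\<bar>"
proof -
  have xs: "xs = take n xs @ xs ! n # drop (Suc n) xs" and ys: "ys = take n ys @ ys ! n # drop (Suc n) ys"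
    using assms id_take_nth_drop by metis+
  have sub: "set (take n xs) \<subseteq> I" "set (take n ys) \<subseteq> I" "set (drop (Suc n) xs) \<subseteq> I" "set (drop (Suc n) ys) \<subseteq> I"
    using assms set_take_subset set_drop_subset by fast+
  let ?s = "coord_map \<beta> d (xs ! n) l (coord_word l (drop (Suc n) xs) s)"
  let ?t = "coord_map \<beta> d (ys ! n) l (coord_word l (drop (Suc n) ys) t)"
  have "coord_word l xs s - coord_word l ys t = coord_word l (take n xs) ?s - coord_word l (take n ys) ?t"
    by (subst xs, subst ys) simp
  also have "\<dots> = wratio l (take n xs) * (?s - ?t)"
    unfolding coord_word_cong(1)[OF sub(1,2) eq, symmetric] by (rule coord_word_diff)
  finally have "\<bar>coord_word l xs s - coord_word l ys t\<bar> = wratio l (take n xs) * \<bar>?s - ?t\<bar>"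
    using wratio_pos[OF sub(1), of l] by (simp add: abs_mult)
  moreover have "gap \<le> \<bar>?s - ?t\<bar>"
  proof (rule gap_le[OF _ _ neq])
    show "xs ! n \<in> I" "ys ! n \<in> I" using assms(1-4) by (auto simp: subset_iff)
  qed (rule coord_word_in_eta[OF sub(3) st(1)] coord_word_in_eta[OF sub(4) st(2)])+
  ultimately show ?thesis
    using mult_right_mono[OF _ less_imp_le[OF wratio_pos[OF sub(1), of l]]] by (metis mult.commute)
qed

text \<open>
  A choice of first letter for each point of \<open>K\<close>.  Together with \<open>shift\<close> it makes the symbolic sequence a
  function of the point.
\<close>

definition digit :: "real^2 \<Rightarrow> 'i" where
  "digit x = (SOME i. i \<in> I \<and> x \<in> carpet_map \<beta> d i ` K)"

definition shift :: "real^2 \<Rightarrow> real^2" where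
  "shift x = (SOME y. y \<in> K \<and> x = carpet_map \<beta> d (digit x) y)"

text \<open>
  The first \<open>k\<close> letters of the chosen coding of \<open>x\<close>.
\<close>

definition itin :: "real^2 \<Rightarrow> nat \<Rightarrow> 'i list" where
  "itin x k = map (\<lambda>n. digit ((shift ^^ n) x)) [0..<k]"

lemma digit_shift:
  assumes "x \<in> K"
  shows "digit x \<in> I" "shift x \<in> K" "carpet_map \<beta> d (digit x) (shift x) = x"
proof -
  have "\<exists>i. i \<in> I \<and> x \<in> carpet_map \<beta> d i ` K" using assms K_eq by blast
  from someI_ex[OF this] have 1: "digit x \<in> I" "x \<in> carpet_map \<beta> d (digit x) ` K"
    unfolding digit_def by auto
  then have "\<exists>y. y \<in> K \<and> x = carpet_map \<beta> d (digit x) y" by blast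
  from someI_ex[OF this] 1 show "digit x \<in> I" "shift x \<in> K" "carpet_map \<beta> d (digit x) (shift x) = x"
    unfolding shift_def by auto
qed

lemma shift_iter_in_K: "x \<in> K \<Longrightarrow> (shift ^^ n) x \<in> K"
  by (induction n) (auto simp: digit_shift)

lemma itin_0 [simp]: "itin x 0 = []" and length_itin [simp]: "length (itin x k) = k"
  and itin_Suc: "itin x (Suc k) = itin x k @ [digit ((shift ^^ k) x)]"
  and itin_nth: "n < k \<Longrightarrow> itin x k ! n = digit ((shift ^^ n) x)"
  and take_itin: "n \<le> k \<Longrightarrow> take n (itin x k) = itin x n"
  by (simp_all add: itin_def take_map)

lemma set_itin: "x \<in> K \<Longrightarrow> set (itin x k) \<subseteq> I"
  unfolding itin_def using digit_shift(1) shift_iter_in_K by auto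

lemma itin_add: "itin x (m + k) = itin x m @ itin ((shift ^^ m) x) k"
proof (induction k)
  case (Suc k)
  have "(shift ^^ (m + k)) x = (shift ^^ k) ((shift ^^ m) x)"
    by (metis add.commute comp_apply funpow_add)
  then show ?case using Suc by (simp add: itin_Suc)
qed simp

lemma word_map_itin: "x \<in> K \<Longrightarrow> word_map (itin x k) ((shift ^^ k) x) = x"
  by (induction k) (auto simp: itin_Suc digit_shift shift_iter_in_K)

section \<open>Box dimension of the projections\<close>

text \<open>
  The similarity dimension of the projection, which is also its box dimension by \<open>box_dim_eta\<close>.
\<close>

definition pdim :: "2 \<Rightarrow> real" where
  "pdim l = moran_dim (classes l) (class_ratio l)"

lemma pdim_sum: "(\<Sum>L\<in>classes l. class_ratio l L powr pdim l) = 1"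
  unfolding pdim_def by (rule moran_dim_sum) (auto simp: finite_classes classes_nonempty class_ratio_bounds)

lemma pdim_nonneg: "0 \<le> pdim l"
  unfolding pdim_def by (rule moran_dim_nonneg) (auto simp: finite_classes classes_nonempty class_ratio_bounds)

lemma le_pdim_iff: "t \<le> pdim l \<longleftrightarrow> 1 \<le> (\<Sum>L\<in>classes l. class_ratio l L powr t)"
  unfolding pdim_def by (rule le_moran_dim_iff) (auto simp: finite_classes classes_nonempty class_ratio_bounds)

lemma column_dim_eq: "column_dim \<beta> l L = moran_dim L (\<lambda>i. \<beta> i (other l))"
  by (simp add: column_dim_def moran_dim_def)

abbreviation tdim :: "2 \<Rightarrow> real" where
  "tdim l \<equiv> max_column_dim I \<beta> d l"

lemma column_dim_le_tdim: "L \<in> classes l \<Longrightarrow> column_dim \<beta> l L \<le> tdim l"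
  unfolding max_column_dim_def using finite_classes by (intro Max_ge) auto

lemma tdim_attained: "\<exists>L\<in>classes l. column_dim \<beta> l L = tdim l"
proof -
  have "tdim l \<in> column_dim \<beta> l ` classes l"
    unfolding max_column_dim_def using finite_classes classes_nonempty by (intro Max_in) auto
  then show ?thesis by force
qed

text \<open>
  Moran's equation for a column: the ratios that occur are those of the other direction, in which the
  members of the column are stacked.
\<close>

lemma column_facts:
  assumes "L \<in> classes l"
  shows "(\<Sum>i\<in>L. \<beta> i (other l) powr column_dim \<beta> l L) = 1"
    and "0 \<le> column_dim \<beta> l L"
    and "(\<Sum>i\<in>L. \<beta> i (other l) powr t) \<le> 1 \<longleftrightarrow> column_dim \<beta> l L \<le> t"
proof -
  have *: "finite L" "L \<noteq> {}" "\<And>i. i \<in> L \<Longrightarrow> 0 < \<beta> i (other l) \<and> \<beta> i (other l) < 1"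
    using assms finite_class class_nonempty class_subset ratio_pos ratio_less_1 by (blast+)
  show "(\<Sum>i\<in>L. \<beta> i (other l) powr column_dim \<beta> l L) = 1"
    "0 \<le> column_dim \<beta> l L"
    "(\<Sum>i\<in>L. \<beta> i (other l) powr t) \<le> 1 \<longleftrightarrow> column_dim \<beta> l L \<le> t"
    unfolding column_dim_eq
    using moran_dim_sum[OF *] moran_dim_nonneg[OF *] moran_dim_le_iff[OF *] by simp_all
qed

lemma column_sum_le_1: "L \<in> classes l \<Longrightarrow> (\<Sum>i\<in>L. \<beta> i (other l) powr tdim l) \<le> 1"
  using column_facts(3) column_dim_le_tdim by blast

lemma tdim_nonneg: "0 \<le> tdim l"
  using tdim_attained column_facts(2) by metis

text \<open>
  The members of a column differ in their other class, so the column embeds into the other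
  projection and contributes to its Moran sum.
\<close>

lemma tdim_le_pdim: "tdim l \<le> pdim (other l)"
proof -
  obtain L where L: "L \<in> classes l" "column_dim \<beta> l L = tdim l" using tdim_attained by blast
  have inj: "inj_on (cls (other l)) L"
  proof (rule inj_onI)
    fix i i' assume i: "i \<in> L" "i' \<in> L" "cls (other l) i = cls (other l) i'"
    then have "cls l i = cls l i'" using in_class[OF L(1)] by simp
    then have "cls l' i = cls l' i'" for l' using i(3) index_cases[of l' l] by auto
    then show "i = i'" using i in_class[OF L(1)] letter_eqI by simp
  qed
  have "1 = (\<Sum>i\<in>L. \<beta> i (other l) powr tdim l)"
    using column_facts(1)[OF L(1)] L(2) by simp
  also have "\<dots> = (\<Sum>i\<in>L. class_ratio (other l) (cls (other l) i) powr tdim l)"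
    by (rule sum.cong) (use in_class[OF L(1)] class_ratio_cls in auto)
  also have "\<dots> = (\<Sum>M\<in>cls (other l) ` L. class_ratio (other l) M powr tdim l)"
    by (simp add: sum.reindex[OF inj])
  also have "\<dots> \<le> (\<Sum>M\<in>classes (other l). class_ratio (other l) M powr tdim l)"
    by (rule sum_mono2) (use finite_classes in_class[OF L(1)] cls_in in auto)
  finally show ?thesis by (simp add: le_pdim_iff)
qed

text \<open>
  At scales in \<open>[bmin, 1]\<close>, where subdivision stops, powers are bounded below by constants.
\<close>

lemma bmin_powr_le:
  assumes "bmin \<le> s" "0 \<le> t"
  shows "bmin powr t \<le> s powr t" "1 \<le> bmin powr - t * s powr t"
proof -
  show 1: "bmin powr t \<le> s powr t"
    using assms bmin_pos by (intro powr_mono2) auto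
  have "1 = bmin powr - t * bmin powr t" using bmin_pos by (simp flip: powr_add)
  also have "\<dots> \<le> bmin powr - t * s powr t" using 1 by (intro mult_left_mono) auto
  finally show "1 \<le> bmin powr - t * s powr t" .
qed

lemma eta_scaled_eq:
  "(\<lambda>t. s * t + c) ` eta l K = (\<Union>L\<in>classes l. (\<lambda>t. (s * class_ratio l L) * t + (s * class_offset l L + c)) ` eta l K)"
  by (subst eta_eq) (auto simp: image_UN image_image algebra_simps)

text \<open>
  Induction on the scale: a statement about copies of size \<open>s\<close> is proved for \<open>s \<le> 1\<close> and is inherited from
  the pieces, which are smaller by a factor \<open>bmax\<close> at least.  This replaces stopping-time
  partitions into words.
\<close>

lemma scale_induct [consumes 1, case_names small step]:
  assumes "0 < (s :: real)"
    and small: "\<And>s. 0 < s \<Longrightarrow> s \<le> 1 \<Longrightarrow> P s"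
    and step: "\<And>s. 1 < s \<Longrightarrow> (\<And>s'. 0 < s' \<Longrightarrow> s' \<le> bmax * s \<Longrightarrow> P s') \<Longrightarrow> P s"
  shows "P s"
proof -
  have "\<forall>s. 0 < s \<and> bmax ^ n * s \<le> 1 \<longrightarrow> P s" for n
  proof (induction n)
    case (Suc n)
    show ?case
    proof (intro allI impI)
      fix s assume s: "0 < s \<and> bmax ^ Suc n * s \<le> 1"
      show "P s"
      proof (cases "s \<le> 1")
        case False
        show ?thesis
        proof (rule step)
          fix s' assume s': "0 < s'" "s' \<le> bmax * s"
          have "bmax ^ n * s' \<le> bmax ^ n * (bmax * s)"
            using s' bmax_pos by (intro mult_left_mono) auto
          then show "P s'" using s' s Suc.IH by (simp add: mult.assoc mult.commute mult.left_commute)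
        qed (use False in simp)
      qed (use s small in auto)
    qed
  qed (use small in auto)
  moreover obtain n where "bmax ^ n < 1 / s"
    using real_arch_pow_inv[of "1 / s" bmax] bmax_less_1 assms(1) by auto
  then have "bmax ^ n * s \<le> 1" using assms(1) by (simp add: field_simps)
  ultimately show ?thesis using assms(1) by blast
qed

text \<open>
  Sizes are measured in units of the covering radius.  The bound \<open>s powr pdim l\<close> is preserved under
  subdivision by Moran's equation; subdivision stops at size at most \<open>1\<close>, but at least \<open>bmin\<close>, which costs the constant.
\<close>

lemma eta_coverable:
  assumes "bmin \<le> s"
  shows "coverable 1 (bmin powr - pdim l * s powr pdim l) ((\<lambda>t. s * t + c) ` eta l K)"
proof -
  have "0 < s" using assms bmin_pos by linarith
  then show ?thesis using assms
  proof (induction s arbitrary: c rule: scale_induct)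
    case (small s)
    have "(\<lambda>t. s * t + c) ` eta l K \<subseteq> cball c 1"
    proof clarsimp
      fix t assume "t \<in> eta l K"
      then have "0 \<le> s * t" "s * t \<le> 1"
        using small eta_bounds[of t l] by (auto intro: mult_le_one)
      then show "dist c (s * t + c) \<le> 1" by (simp add: dist_real_def)
    qed
    then show ?case using bmin_powr_le(2)[OF small(3) pdim_nonneg] by (rule coverable_single)
  next
    case (step s)
    have "coverable 1 (\<Sum>L\<in>classes l. bmin powr - pdim l * (s * class_ratio l L) powr pdim l)
       (\<Union>L\<in>classes l. (\<lambda>t. (s * class_ratio l L) * t + (s * class_offset l L + c)) ` eta l K)"
    proof (rule coverable_UN)
      fix L assume L: "L \<in> classes l"
      show "coverable 1 (bmin powr - pdim l * (s * class_ratio l L) powr pdim l) ((\<lambda>t. (s * class_ratio l L) * t + (s * class_offset l L + c)) ` eta l K)"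
      proof (rule step.IH)
        show "0 < s * class_ratio l L" using step(1) class_ratio_bounds[OF L] by simp
        show "s * class_ratio l L \<le> bmax * s" using step(1) class_ratio_le_bmax[OF L] by (simp add: mult.commute)
        show "bmin \<le> s * class_ratio l L"
          using step(1) bmin_le_class_ratio[OF L] mult_right_mono[of 1 s "class_ratio l L"] class_ratio_bounds[OF L] by linarith
      qed
    qed (rule finite_classes)
    moreover have "(\<Sum>L\<in>classes l. bmin powr - pdim l * (s * class_ratio l L) powr pdim l) =
      bmin powr - pdim l * s powr pdim l * (\<Sum>L\<in>classes l. class_ratio l L powr pdim l)"
      using step(1) class_ratio_bounds by (simp add: sum_distrib_left powr_mult mult.assoc less_imp_le)
    ultimately show ?case
      unfolding eta_scaled_eq[of s c l] by (simp add: pdim_sum)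
  qed
qed

text \<open>
  As for coverings: pieces of a copy of size \<open>s > 1\<close> are \<open>gap\<close>-separated, so packings add up.
\<close>

lemma eta_packable:
  assumes "0 < s"
  shows "packable gap (s powr pdim l) ((\<lambda>t. s * t + c) ` eta l K)"
  using assms
proof (induction s arbitrary: c rule: scale_induct)
  case (small s)
  then have "s powr pdim l \<le> 1" using pdim_nonneg by (intro powr_le1) auto
  then show ?case using eta_nonempty by (intro packable_single) auto
next
  case (step s)
  have "packable gap (\<Sum>L\<in>classes l. (s * class_ratio l L) powr pdim l)
     (\<Union>L\<in>classes l. (\<lambda>t. (s * class_ratio l L) * t + (s * class_offset l L + c)) ` eta l K)"
  proof (rule packable_UN)
    fix L assume L: "L \<in> classes l"
    show "packable gap ((s * class_ratio l L) powr pdim l) ((\<lambda>t. (s * class_ratio l L) * t + (s * class_offset l L + c)) ` eta l K)"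
      using step(1) class_ratio_bounds[OF L] class_ratio_le_bmax[OF L] by (intro step.IH) (auto simp: mult.commute)
  next
    fix L L' x y
    assume L: "L \<in> classes l" "L' \<in> classes l" "L \<noteq> L'"
      and "x \<in> (\<lambda>t. (s * class_ratio l L) * t + (s * class_offset l L + c)) ` eta l K"
      and "y \<in> (\<lambda>t. (s * class_ratio l L') * t + (s * class_offset l L' + c)) ` eta l K"
    then obtain u v where uv: "u \<in> eta l K" "v \<in> eta l K"
      "x = (s * class_ratio l L) * u + (s * class_offset l L + c)" "y = (s * class_ratio l L') * v + (s * class_offset l L' + c)" by blast
    obtain i i' where i: "i \<in> L" "i' \<in> L'" using L class_nonempty by blast
    have "x - y = s * (coord_map \<beta> d i l u - coord_map \<beta> d i' l v)"
      unfolding uv coord_map_def using class_ratio_eq class_offset_eq L i by (simp add: algebra_simps)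
    then have "dist x y = s * \<bar>coord_map \<beta> d i l u - coord_map \<beta> d i' l v\<bar>"
      using step(1) by (simp add: dist_real_def abs_mult)
    moreover have "gap \<le> \<bar>coord_map \<beta> d i l u - coord_map \<beta> d i' l v\<bar>"
      using in_class[OF L(1) i(1)] in_class[OF L(2) i(2)] L(3) uv by (intro gap_le) auto
    ultimately show "gap \<le> dist x y"
      using step(1) gap_pos mult_mono[of 1 s gap] by simp
  qed (use finite_classes gap_pos in auto)
  moreover have "(\<Sum>L\<in>classes l. (s * class_ratio l L) powr pdim l) = s powr pdim l * (\<Sum>L\<in>classes l. class_ratio l L powr pdim l)"
    using step(1) class_ratio_bounds by (simp add: sum_distrib_left powr_mult less_imp_le)
  ultimately show ?case
    unfolding eta_scaled_eq[of s c l] by (simp add: pdim_sum)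
qed

lemma covering_number_eta_bounds:
  assumes "0 < r" "r < 1"
  shows "real (covering_number r (eta l K)) \<le> bmin powr - pdim l * r powr - pdim l"
    and "(3 / gap) powr - pdim l * r powr - pdim l \<le> real (covering_number r (eta l K))"
proof -
  have "coverable 1 (bmin powr - pdim l * (1 / r) powr pdim l) ((\<lambda>t. (1 / r) * t + 0) ` eta l K)"
    using assms bmin_less_1 bmin_pos mult_le_one[of r bmin] by (intro eta_coverable) (simp add: field_simps)
  then have "coverable (r * 1) (bmin powr - pdim l * (1 / r) powr pdim l) ((\<lambda>t. r * t) ` (\<lambda>t. (1 / r) * t + 0) ` eta l K)"
    by (rule coverable_image) (use assms in \<open>auto simp: dist_real_def abs_mult simp flip: right_diff_distrib\<close>)
  moreover have "(\<lambda>t. r * t) ` (\<lambda>t. (1 / r) * t + 0) ` eta l K = eta l K"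
    using assms by (simp add: image_image)
  ultimately show "real (covering_number r (eta l K)) \<le> bmin powr - pdim l * r powr - pdim l"
    using assms covering_number_le[of r] by (simp add: powr_divide powr_minus_divide)
  have "packable gap ((gap / (3 * r)) powr pdim l) ((\<lambda>t. (gap / (3 * r)) * t + 0) ` eta l K)"
    using assms gap_pos by (intro eta_packable) auto
  then have "packable (3 * r / gap * gap) ((gap / (3 * r)) powr pdim l) ((\<lambda>t. (3 * r / gap) * t) ` (\<lambda>t. (gap / (3 * r)) * t + 0) ` eta l K)"
    by (rule packable_image) (use assms gap_pos in \<open>auto simp: dist_real_def abs_mult simp flip: right_diff_distrib diff_divide_distrib\<close>)
  moreover have "(\<lambda>t. (3 * r / gap) * t) ` (\<lambda>t. (gap / (3 * r)) * t + 0) ` eta l K = eta l K"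
    using assms gap_pos by (simp add: image_image)
  ultimately have "packable (3 * r) ((gap / (3 * r)) powr pdim l) (eta l K)"
    using gap_pos by simp
  then have "(gap / (3 * r)) powr pdim l \<le> real (covering_number r (eta l K))"
    by (rule covering_number_ge) (use assms compact_eta compact_imp_bounded in auto)
  moreover have "(gap / (3 * r)) powr pdim l = (3 / gap * r) powr - pdim l"
    using gap_pos assms by (simp add: powr_minus powr_divide powr_mult)
  ultimately show "(3 / gap) powr - pdim l * r powr - pdim l \<le> real (covering_number r (eta l K))"
    using gap_pos assms powr_mult[of "3 / gap" r "- pdim l"] by simp
qed

lemma box_dim_eta: "box_dim (eta l K) = ereal (pdim l)"
proof -
  let ?N = "\<lambda>r. real (covering_number r (eta l K))"
  let ?b = "pdim l"
  have *: "ln ((3 / gap) powr - ?b) / - ln r + ?b \<le> ln (?N r) / - ln r \<and>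
     ln (?N r) / - ln r \<le> ln (bmin powr - ?b) / - ln r + ?b"
    if r: "0 < r" "r < 1" for r
  proof -
    note b = covering_number_eta_bounds[OF r, of l]
    have pos: "0 < (3 / gap) powr - ?b * r powr - ?b" "0 < bmin powr - ?b * r powr - ?b"
      using gap_pos r bmin_pos by simp_all
    have "0 < - ln r" using r by simp
    moreover have "ln (c powr - ?b * r powr - ?b) = ln (c powr - ?b) + ?b * - ln r" if "0 < c" for c
      using that r by (simp add: ln_mult ln_powr)
    moreover have "ln ((3 / gap) powr - ?b * r powr - ?b) \<le> ln (?N r)"
      using b pos by simp
    moreover have "ln (?N r) \<le> ln (bmin powr - ?b * r powr - ?b)"
      using b pos by (intro ln_mono) auto
    moreover have "c / - ln r + ?b = (c + ?b * - ln r) / - ln r" for c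
      using r by (simp add: field_simps)
    ultimately show ?thesis
      using gap_pos bmin_pos by (metis divide_right_mono less_imp_le zero_less_divide_iff zero_less_numeral)
  qed
  have ev: "\<forall>\<^sub>F r in at_right (0::real). 0 < r \<and> r < 1"
    unfolding eventually_at_right_field by (intro exI[of _ 1]) auto
  have "((\<lambda>r. c / - ln r + b) \<longlongrightarrow> b) (at_right 0)" for b c :: real
    by real_asymp
  note lim = this
  have "((\<lambda>r. ln (?N r) / - ln r) \<longlongrightarrow> ?b) (at_right 0)"
    by (rule tendsto_sandwich[OF eventually_mono[OF ev] eventually_mono[OF ev] lim lim])
      (use * in blast)+
  then have "((\<lambda>r. ereal (ln (?N r) / - ln r)) \<longlongrightarrow> ereal ?b) (at_right 0)"
    by (rule tendsto_ereal)
  then show ?thesis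
    unfolding box_dim_def by (rule tendsto_Lim[rotated]) simp
qed

section \<open>Coverings of affine copies of columns\<close>

lemma diag_aff_carpet_map:
  "diag_aff s c ` carpet_map \<beta> d i ` E = diag_aff (\<lambda>l. s l * \<beta> i l) (\<lambda>l. s l * d i l + c l) ` E"
  unfolding image_image
  by (rule image_cong) (auto simp: vec_eq_iff coord_map_def algebra_simps)

lemma word_map_eq_diag_aff: "word_map xs = diag_aff (\<lambda>l. wratio l xs) (\<lambda>l. coord_word l xs 0)"
proof
  fix x
  show "word_map xs x = diag_aff (\<lambda>l. wratio l xs) (\<lambda>l. coord_word l xs 0) x"
    unfolding vec_eq_iff
  proof
    fix l
    show "word_map xs x $ l = diag_aff (\<lambda>l. wratio l xs) (\<lambda>l. coord_word l xs 0) x $ l"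
      using coord_word_diff[of l xs "x $ l" 0] by (simp add: word_map_nth)
  qed
qed

text \<open>
  Summing over a column first gives at most \<open>1\<close> by definition of \<open>tdim\<close>, and then Moran's equation of
  the projection applies.  The inequality is strict exactly if the columns do not all have the
  maximal dimension.
\<close>

lemma weighted_sum_le_1: "(\<Sum>i\<in>I. \<beta> i l powr pdim l * \<beta> i (other l) powr tdim l) \<le> 1"
proof -
  have "(\<Sum>i\<in>I. \<beta> i l powr pdim l * \<beta> i (other l) powr tdim l)
    = (\<Sum>L\<in>classes l. \<Sum>i\<in>L. \<beta> i l powr pdim l * \<beta> i (other l) powr tdim l)"
    by (rule sum_over_classes)
  also have "\<dots> = (\<Sum>L\<in>classes l. class_ratio l L powr pdim l * (\<Sum>i\<in>L. \<beta> i (other l) powr tdim l))"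
    unfolding sum_distrib_left by (intro sum.cong refl) (simp add: class_ratio_eq)
  also have "\<dots> \<le> (\<Sum>L\<in>classes l. class_ratio l L powr pdim l * 1)"
    by (intro sum_mono mult_left_mono column_sum_le_1) auto
  finally show ?thesis by (simp add: pdim_sum)
qed

lemma le_bmin_powr_mult:
  assumes "bmin \<le> s" "0 \<le> t" "bmin powr - (p + t) \<le> M" "0 \<le> R"
  shows "bmin powr - p * R \<le> M * (R * s powr t)"
proof -
  have "bmin powr - p * R * 1 \<le> bmin powr - p * R * (bmin powr - t * s powr t)"
    using bmin_powr_le(2)[OF assms(1,2)] assms(4) by (intro mult_left_mono) auto
  also have "\<dots> = bmin powr - (p + t) * (R * s powr t)"
    by (simp add: powr_diff powr_minus field_simps powr_add)
  also have "\<dots> \<le> M * (R * s powr t)"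
    using assms by (intro mult_right_mono) auto
  finally show ?thesis by simp
qed

text \<open>
  A copy that is at most one unit wide in direction \<open>l\<close> looks like its projection to the other
  direction.  The factor \<open>s l powr t\<close> is bounded below, and is inserted to make the bound stable under
  the subdivision that led to this copy.
\<close>

lemma thin_coverable:
  assumes F: "F \<subseteq> K" and eta: "(\<lambda>x. x $ other l) ` F \<subseteq> (\<lambda>t. P * t + e) ` eta (other l) K"
    and s: "bmin \<le> s l" "s l \<le> 1" and R: "bmin \<le> s (other l) * P"
    and t: "0 \<le> t" and M: "bmin powr - (pdim (other l) + t) \<le> M"
  shows "coverable 2 (M * ((s (other l) * P) powr pdim (other l) * s l powr t)) (diag_aff s c ` F)"
proof (rule coverable_of_thin[where l = l and p = "c l"])
  let ?R = "s (other l) * P"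
  show "\<bar>x $ l - c l\<bar> \<le> 1" if "x \<in> diag_aff s c ` F" for x
  proof -
    from that F obtain y where y: "y \<in> K" "x = diag_aff s c y" by blast
    have "0 \<le> s l * y $ l" "s l * y $ l \<le> 1"
      using s bmin_pos K_bounds[OF y(1), of l] by (auto intro: mult_le_one)
    then show ?thesis using y by simp
  qed
  have "coverable 1 (bmin powr - pdim (other l) * ?R powr pdim (other l))
     ((\<lambda>t. ?R * t + (s (other l) * e + c (other l))) ` eta (other l) K)"
    by (rule eta_coverable[OF R])
  moreover have "(\<lambda>x. x $ other l) ` diag_aff s c ` F
      \<subseteq> (\<lambda>t. ?R * t + (s (other l) * e + c (other l))) ` eta (other l) K"
  proof clarsimp
    fix x assume "x \<in> F"
    then obtain t where "t \<in> eta (other l) K" "x $ other l = P * t + e" using eta by blast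
    then show "s (other l) * x $ other l + c (other l)
      \<in> (\<lambda>t. ?R * t + (s (other l) * e + c (other l))) ` eta (other l) K"
      by (intro image_eqI[of _ _ t]) (auto simp: algebra_simps)
  qed
  moreover have "bmin powr - pdim (other l) * ?R powr pdim (other l)
      \<le> M * (?R powr pdim (other l) * s l powr t)"
    using s t M by (intro le_bmin_powr_mult) auto
  ultimately show "coverable 1 (M * (?R powr pdim (other l) * s l powr t)) ((\<lambda>x. x $ other l) ` diag_aff s c ` F)"
    by (meson coverable_mono)
qed

text \<open>
  Copies of \<open>K\<close> with side lengths \<open>s\<close>, in units of the covering radius.  Subdivide until one side is at
  most one unit.  Pieces that are flat in direction \<open>other a\<close> are counted by the first summand,
  pieces that are flat in direction \<open>a\<close> by the second; each summand is preserved by subdivision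
  because the corresponding weights \<open>\<beta> i a powr pdim a * \<beta> i (other a) powr t'\<close> and
  \<open>\<beta> i (other a) powr pdim (other a) * \<beta> i a powr tdim (other a)\<close> have sum at most \<open>1\<close>.
\<close>

lemma K_coverable:
  assumes t': "0 \<le> t'" "(\<Sum>i\<in>I. \<beta> i a powr pdim a * \<beta> i (other a) powr t') \<le> 1"
    and M: "bmin powr - (pdim a + t') \<le> M" "bmin powr - (pdim (other a) + tdim (other a)) \<le> M"
    and s: "\<And>l. bmin \<le> s l"
  shows "coverable 2 (M * (s a powr pdim a * s (other a) powr t' +
    s (other a) powr pdim (other a) * s a powr tdim (other a))) (diag_aff s c ` K)"
proof -
  let ?b = "other a"
  let ?\<Phi> = "\<lambda>s. s a powr pdim a * s ?b powr t' + s ?b powr pdim ?b * s a powr tdim ?b"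
  have M0: "0 \<le> M" using M(1) powr_ge_zero order_trans by blast
  have "\<forall>s c. (\<forall>l. bmin \<le> s l) \<and> min (s a) (s ?b) = m \<longrightarrow> coverable 2 (M * ?\<Phi> s) (diag_aff s c ` K)"
    if "0 < m" for m
    using that
  proof (induction m rule: scale_induct)
    case (small m)
    show ?case
    proof (intro allI impI)
      fix s c assume s: "(\<forall>l. bmin \<le> s l) \<and> min (s a) (s ?b) = m"
      have proj: "(\<lambda>x. x $ l) ` K \<subseteq> (\<lambda>t. 1 * t + 0) ` eta l K" for l
        by (simp add: eta_def)
      consider "s a \<le> 1" | "s ?b \<le> 1" using small s by (auto simp: min_def split: if_splits)
      then show "coverable 2 (M * ?\<Phi> s) (diag_aff s c ` K)"
      proof cases
        case 1
        have "coverable 2 (M * ((s ?b * 1) powr pdim ?b * s a powr tdim ?b)) (diag_aff s c ` K)"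
          using s 1 M tdim_nonneg by (intro thin_coverable[OF order_refl proj]) auto
        then show ?thesis by (rule coverable_mono) (use M0 in \<open>auto intro!: mult_left_mono\<close>)
      next
        case 2
        have "coverable 2 (M * ((s (other ?b) * 1) powr pdim (other ?b) * s ?b powr t')) (diag_aff s c ` K)"
          using s 2 M t' by (intro thin_coverable[OF order_refl proj]) (auto simp: other_other)
        then show ?thesis by (rule coverable_mono) (use M0 in \<open>auto intro!: mult_left_mono simp: other_other\<close>)
      qed
    qed
  next
    case (step m)
    show ?case
    proof (intro allI impI)
      fix s c assume s: "(\<forall>l. bmin \<le> s l) \<and> min (s a) (s ?b) = m"
      then have s1: "1 < s l" for l using step(1) index_cases[of l a] by auto
      have spos: "0 \<le> s l" for l using s1[of l] by linarith
      let ?s = "\<lambda>i l. s l * \<beta> i l"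
      have cov: "coverable 2 (\<Sum>i\<in>I. M * ?\<Phi> (?s i)) (\<Union>i\<in>I. diag_aff (?s i) (\<lambda>l. s l * d i l + c l) ` K)"
      proof (rule coverable_UN)
        fix i assume i: "i \<in> I"
        have b1: "bmin \<le> ?s i l" for l
          using bmin_le[OF i, of l] s1[of l] mult_right_mono[of 1 "s l" "\<beta> i l"] ratio_pos[OF i, of l] by linarith
        have b2: "0 < min (?s i a) (?s i ?b)"
          using mult_pos_pos[OF less_trans[OF zero_less_one s1] ratio_pos[OF i]] by simp
        have b3: "min (?s i a) (?s i ?b) \<le> bmax * m"
        proof (cases "s a \<le> s ?b")
          case True
          then have "min (?s i a) (?s i ?b) \<le> s a * \<beta> i a" "m = s a" using s by auto
          then show ?thesis
            using mult_left_mono[OF le_bmax[OF i, of a], of "s a"] spos by (simp add: mult.commute)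
        next
          case False
          then have "min (?s i a) (?s i ?b) \<le> s ?b * \<beta> i ?b" "m = s ?b" using s by auto
          then show ?thesis
            using mult_left_mono[OF le_bmax[OF i, of ?b], of "s ?b"] spos by (simp add: mult.commute)
        qed
        show "coverable 2 (M * ?\<Phi> (?s i)) (diag_aff (?s i) (\<lambda>l. s l * d i l + c l) ` K)"
          using step.IH[OF b2 b3, THEN spec, of "?s i", THEN spec, THEN mp] b1 by simp
      qed (rule finite_I)
      have eq: "diag_aff s c ` K = (\<Union>i\<in>I. diag_aff (?s i) (\<lambda>l. s l * d i l + c l) ` K)"
        by (subst K_eq) (simp add: image_UN diag_aff_carpet_map)
      have "(\<Sum>i\<in>I. M * ?\<Phi> (?s i)) \<le> M * ?\<Phi> s"
      proof -
        have "?\<Phi> (?s i) = s a powr pdim a * s ?b powr t' * (\<beta> i a powr pdim a * \<beta> i ?b powr t')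
           + s ?b powr pdim ?b * s a powr tdim ?b * (\<beta> i ?b powr pdim ?b * \<beta> i (other ?b) powr tdim ?b)"
          if "i \<in> I" for i
          using spos ratio_pos[OF that] by (simp add: powr_mult less_imp_le other_other algebra_simps)
        then have "(\<Sum>i\<in>I. ?\<Phi> (?s i)) = s a powr pdim a * s ?b powr t' * (\<Sum>i\<in>I. \<beta> i a powr pdim a * \<beta> i ?b powr t')
           + s ?b powr pdim ?b * s a powr tdim ?b * (\<Sum>i\<in>I. \<beta> i ?b powr pdim ?b * \<beta> i (other ?b) powr tdim ?b)"
          by (simp add: sum.distrib sum_distrib_left)
        also have "\<dots> \<le> s a powr pdim a * s ?b powr t' * 1 + s ?b powr pdim ?b * s a powr tdim ?b * 1"
          using t'(2) weighted_sum_le_1[of ?b] by (intro add_mono mult_left_mono) auto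
        finally show ?thesis
          using M0 by (simp add: mult_left_mono flip: sum_distrib_left)
      qed
      then show "coverable 2 (M * ?\<Phi> s) (diag_aff s c ` K)"
        by (rule coverable_mono[OF cov _ eq_refl[OF eq]])
    qed
  qed
  from this[of "min (s a) (s ?b)"] show ?thesis
    using s bmin_pos less_le_trans[OF bmin_pos s] by auto
qed

text \<open>
  Points whose first letters lie in prescribed sets and whose further letters are free.
\<close>

primrec column_set :: "'i set list \<Rightarrow> (real^2) set" where
  "column_set [] = K"
| "column_set (L # Ls) = (\<Union>i\<in>L. carpet_map \<beta> d i ` column_set Ls)"

lemma column_set_subset_K: "set Ls \<subseteq> classes l \<Longrightarrow> column_set Ls \<subseteq> K"
proof (induction Ls)
  case (Cons L Ls)
  then have "column_set Ls \<subseteq> K" "L \<subseteq> I" using class_subset by auto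
  then show ?case using carpet_map_in_K by (auto simp: subset_iff)
qed simp

text \<open>
  All words with prescribed classes in direction \<open>l\<close> have the same coordinate map in this direction.
\<close>

lemma column_set_projection:
  assumes "set Ls \<subseteq> classes l"
  shows "\<exists>e. (\<lambda>x. x $ l) ` column_set Ls = (\<lambda>t. prod_list (map (class_ratio l) Ls) * t + e) ` eta l K"
  using assms
proof (induction Ls)
  case Nil
  show ?case by (rule exI[of _ 0]) (simp add: eta_def)
next
  case (Cons L Ls)
  then obtain e where e: "(\<lambda>x. x $ l) ` column_set Ls = (\<lambda>t. prod_list (map (class_ratio l) Ls) * t + e) ` eta l K" by auto
  have L: "L \<in> classes l" using Cons by simp
  have "(\<lambda>x. x $ l) ` column_set (L # Ls) = (\<Union>i\<in>L. (\<lambda>t. \<beta> i l * t + d i l) ` (\<lambda>x. x $ l) ` column_set Ls)"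
    by (simp add: image_UN image_image coord_map_def)
  also have "\<dots> = (\<Union>i\<in>L. (\<lambda>t. class_ratio l L * t + class_offset l L) ` (\<lambda>x. x $ l) ` column_set Ls)"
    by (intro SUP_cong refl) (simp add: class_ratio_eq[OF L] class_offset_eq[OF L])
  also have "\<dots> = (\<lambda>t. class_ratio l L * t + class_offset l L) ` (\<lambda>x. x $ l) ` column_set Ls"
    using class_nonempty[OF L] by auto
  also have "\<dots> = (\<lambda>t. prod_list (map (class_ratio l) (L # Ls)) * t + (class_ratio l L * e + class_offset l L)) ` eta l K"
    unfolding e image_image by (rule image_cong) (auto simp: algebra_simps)
  finally show ?case by blast
qed

lemma prod_class_ratio_pos: "set Ls \<subseteq> classes l \<Longrightarrow> 0 < prod_list (map (class_ratio l) Ls)"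
  by (induction Ls) (auto simp: class_ratio_bounds)

text \<open>
  The same bound as for \<open>K\<close>, with the height of \<open>K\<close> in direction \<open>other a\<close> replaced by the height that is
  left after the prescribed classes.  During these steps only the width changes, and the bound is
  preserved because column sums of the powers \<open>tdim (other a)\<close> and \<open>pdim a\<close> of the widths are at most \<open>1\<close>;
  the latter uses \<open>tdim_le_pdim\<close>.
\<close>

lemma column_set_coverable:
  assumes t': "0 \<le> t'" "(\<Sum>i\<in>I. \<beta> i a powr pdim a * \<beta> i (other a) powr t') \<le> 1"
    and M: "bmin powr - (pdim a + t') \<le> M" "bmin powr - (pdim (other a) + tdim (other a)) \<le> M"
    and Ls: "set Ls \<subseteq> classes (other a)"
    and s: "bmin \<le> s a" "bmin \<le> s (other a) * prod_list (map (class_ratio (other a)) Ls)"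
  shows "coverable 2 (M * (s a powr pdim a * (s (other a) * prod_list (map (class_ratio (other a)) Ls)) powr t' +
    (s (other a) * prod_list (map (class_ratio (other a)) Ls)) powr pdim (other a) * s a powr tdim (other a))) (diag_aff s c ` column_set Ls)"
  using Ls s
proof (induction Ls arbitrary: s c)
  case Nil
  have "bmin \<le> s l" for l using index_cases[of l a] Nil by auto
  then show ?case using K_coverable[OF t' M] by simp
next
  case (Cons L Ls)
  let ?b = "other a"
  let ?R = "s ?b * prod_list (map (class_ratio ?b) (L # Ls))"
  have M0: "0 \<le> M" using M(1) powr_ge_zero order_trans by blast
  have L: "L \<in> classes ?b" using Cons.prems by simp
  show ?case
  proof (cases "s a \<le> 1")
    case True
    obtain e where e: "(\<lambda>x. x $ ?b) ` column_set (L # Ls) = (\<lambda>t. prod_list (map (class_ratio ?b) (L # Ls)) * t + e) ` eta ?b K"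
      using column_set_projection[OF Cons.prems(1)] by blast
    have "coverable 2 (M * (?R powr pdim ?b * s a powr tdim ?b)) (diag_aff s c ` column_set (L # Ls))"
      by (rule thin_coverable[OF column_set_subset_K[OF Cons.prems(1)] eq_refl[OF e]])
        (use True Cons.prems M tdim_nonneg in auto)
    then show ?thesis by (rule coverable_mono) (use M0 in \<open>auto intro!: mult_left_mono\<close>)
  next
    case False
    let ?s = "\<lambda>i l. s l * \<beta> i l"
    let ?\<Phi> = "\<lambda>x. x powr pdim a * ?R powr t' + ?R powr pdim ?b * x powr tdim ?b"
    have cov: "coverable 2 (\<Sum>i\<in>L. M * ?\<Phi> (s a * \<beta> i a))
       (\<Union>i\<in>L. diag_aff (?s i) (\<lambda>l. s l * d i l + c l) ` column_set Ls)"
    proof (rule coverable_UN)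
      fix i assume i: "i \<in> L"
      then have iI: "i \<in> I" using in_class[OF L] by blast
      have R: "?s i ?b * prod_list (map (class_ratio ?b) Ls) = ?R"
        using class_ratio_eq[OF L i] by (simp add: mult.assoc)
      have "bmin \<le> ?s i a"
        using bmin_le[OF iI, of a] False mult_right_mono[of 1 "s a" "\<beta> i a"] ratio_pos[OF iI, of a] by linarith
      then show "coverable 2 (M * ?\<Phi> (s a * \<beta> i a)) (diag_aff (?s i) (\<lambda>l. s l * d i l + c l) ` column_set Ls)"
        using Cons.IH[of "?s i" "\<lambda>l. s l * d i l + c l"] Cons.prems unfolding R by auto
    qed (rule finite_class[OF L])
    have eq: "diag_aff s c ` column_set (L # Ls) = (\<Union>i\<in>L. diag_aff (?s i) (\<lambda>l. s l * d i l + c l) ` column_set Ls)"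
      by (simp add: image_UN diag_aff_carpet_map)
    have "(\<Sum>i\<in>L. M * ?\<Phi> (s a * \<beta> i a)) \<le> M * ?\<Phi> (s a)"
    proof -
      have col: "(\<Sum>i\<in>L. \<beta> i a powr t) \<le> 1" if "tdim ?b \<le> t" for t
        using column_facts(3)[OF L, of t] column_dim_le_tdim[OF L] that by (simp add: other_other)
      have "?\<Phi> (s a * \<beta> i a) = s a powr pdim a * ?R powr t' * \<beta> i a powr pdim a
          + ?R powr pdim ?b * s a powr tdim ?b * \<beta> i a powr tdim ?b" if "i \<in> L" for i
        using False in_class[OF L that] ratio_pos[of i a] powr_mult[of "s a" "\<beta> i a"] by (simp add: less_imp_le)
      then have "(\<Sum>i\<in>L. ?\<Phi> (s a * \<beta> i a)) = s a powr pdim a * ?R powr t' * (\<Sum>i\<in>L. \<beta> i a powr pdim a)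
          + ?R powr pdim ?b * s a powr tdim ?b * (\<Sum>i\<in>L. \<beta> i a powr tdim ?b)"
        by (simp only: sum.distrib sum_distrib_left cong: sum.cong)
      also have "\<dots> \<le> s a powr pdim a * ?R powr t' * 1 + ?R powr pdim ?b * s a powr tdim ?b * 1"
        using tdim_le_pdim[of ?b] by (intro add_mono mult_left_mono col) (auto simp: other_other)
      finally show ?thesis
        using M0 by (simp add: mult_left_mono flip: sum_distrib_left)
    qed
    then show ?thesis
      by (rule coverable_mono[OF cov _ eq_refl[OF eq]])
  qed
qed

section \<open>Pointwise Assouad dimension\<close>

lemma in_column_set_itin: "z \<in> K \<Longrightarrow> z \<in> column_set (map (cls l) (itin z n))"
proof (induction n arbitrary: z)
  case (Suc n)
  have "itin z (Suc n) = digit z # itin (shift z) n"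
    using itin_add[of z 1 n] by (simp add: itin_Suc)
  moreover have "shift z \<in> column_set (map (cls l) (itin (shift z) n))"
    using Suc digit_shift(2) by blast
  ultimately show ?case
    using digit_shift[OF Suc.prems] self_in_cls by (auto intro!: bexI[of _ "digit z"] image_eqI[of z _ "shift z"])
qed simp

lemma prod_class_ratio_itin: "set xs \<subseteq> I \<Longrightarrow> prod_list (map (class_ratio l) (map (cls l) xs)) = wratio l xs"
  by (induction xs) (auto simp: class_ratio_cls)

lemma wratio_itin_add: "wratio l (itin x (m + k)) = wratio l (itin x m) * wratio l (itin ((shift ^^ m) x) k)"
  by (simp add: itin_add)

text \<open>
  Separation turns closeness of coordinates into agreement of classes.
\<close>

lemma itin_classes_agree:
  assumes x: "x \<in> K" and y: "y \<in> K"
    and close: "\<And>n. n < q \<Longrightarrow> \<bar>x $ l - y $ l\<bar> < gap * wratio l (itin x n)"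
  shows "map (cls l) (itin x q) = map (cls l) (itin y q)"
  using close
proof (induction q)
  case (Suc n)
  then have eq: "map (cls l) (itin x n) = map (cls l) (itin y n)" by simp
  have "cls l (digit ((shift ^^ n) x)) = cls l (digit ((shift ^^ n) y))"
  proof (rule ccontr)
    assume neq: "\<not> ?thesis"
    let ?s = "((shift ^^ Suc n) x) $ l" and ?t = "((shift ^^ Suc n) y) $ l"
    have "gap * wratio l (take n (itin x (Suc n))) \<le> \<bar>coord_word l (itin x (Suc n)) ?s - coord_word l (itin y (Suc n)) ?t\<bar>"
    proof (rule first_difference)
      show "?s \<in> eta l K" "?t \<in> eta l K"
        using x y shift_iter_in_K nth_in_eta by blast+
      show "map (cls l) (take n (itin x (Suc n))) = map (cls l) (take n (itin y (Suc n)))"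
        using eq by (simp add: take_itin)
      show "cls l (itin x (Suc n) ! n) \<noteq> cls l (itin y (Suc n) ! n)"
        using neq by (simp add: itin_nth)
    qed (use set_itin x y in auto)
    also have "\<dots> = \<bar>x $ l - y $ l\<bar>"
      unfolding word_map_nth[symmetric] by (simp only: word_map_itin[OF x] word_map_itin[OF y])
    finally show False using Suc.prems[of n] by (simp add: take_itin)
  qed
  then show ?case using eq by (simp add: itin_Suc)
qed simp

text \<open>
  A small ball only meets an approximate square: up to level \<open>p\<close> both classes of a letter are
  determined, hence the letter, and from \<open>p\<close> to \<open>q\<close> the class in direction \<open>other a\<close>.
\<close>

lemma cball_subset_column_set:
  assumes x: "x \<in> K" and pq: "p \<le> q"
    and a: "\<And>n. n < p \<Longrightarrow> R < gap * wratio a (itin x n)"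
    and b: "\<And>n. n < q \<Longrightarrow> R < gap * wratio (other a) (itin x n)"
  shows "cball x R \<inter> K \<subseteq> word_map (itin x p) ` column_set (map (cls (other a)) (itin ((shift ^^ p) x) (q - p)))"
proof
  fix y assume "y \<in> cball x R \<inter> K"
  then have y: "y \<in> K" and d: "\<bar>x $ l - y $ l\<bar> \<le> R" for l
    using component_dist_le[of x l y] by auto
  have A: "map (cls a) (itin x p) = map (cls a) (itin y p)"
    by (rule itin_classes_agree[OF x y]) (use a d le_less_trans in blast)
  have B: "map (cls (other a)) (itin x q) = map (cls (other a)) (itin y q)"
    by (rule itin_classes_agree[OF x y]) (use b d le_less_trans in blast)
  have q: "q = p + (q - p)" using pq by simp
  have B1: "map (cls (other a)) (itin x p) = map (cls (other a)) (itin y p)"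
    and B2: "map (cls (other a)) (itin ((shift ^^ p) x) (q - p)) = map (cls (other a)) (itin ((shift ^^ p) y) (q - p))"
    using B by (subst (asm) (1 2) q, simp add: itin_add)+
  have "itin x p = itin y p"
  proof (rule letters_eqI)
    show "map (cls l) (itin x p) = map (cls l) (itin y p)" for l
      using A B1 index_cases[of l a] by auto
  qed (use x y set_itin in auto)
  moreover have "(shift ^^ p) y \<in> column_set (map (cls (other a)) (itin ((shift ^^ p) x) (q - p)))"
    unfolding B2 by (intro in_column_set_itin shift_iter_in_K y)
  ultimately show "y \<in> word_map (itin x p) ` column_set (map (cls (other a)) (itin ((shift ^^ p) x) (q - p)))"
    using word_map_itin[OF y, of p] by (metis imageI)
qed

text \<open>
  The level at which the cylinders around \<open>x\<close> reach the scale \<open>R\<close> in direction \<open>l\<close>.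
\<close>

lemma first_small_scale:
  assumes x: "x \<in> K" and R: "0 < R" "R < gap"
  obtains q where "gap * wratio l (itin x q) \<le> R" "\<And>n. n < q \<Longrightarrow> R < gap * wratio l (itin x n)"
    "bmin * R \<le> gap * wratio l (itin x q)"
proof -
  obtain n where "bmax ^ n < R"
    using real_arch_pow_inv[OF R(1) bmax_less_1] by blast
  moreover have "gap * wratio l (itin x n) \<le> 1 * bmax ^ n"
    using gap_le_1 gap_pos wratio_le_bmax_power[OF set_itin[OF x], of l n] wratio_pos[OF set_itin[OF x], of l n]
    by (intro mult_mono) auto
  ultimately have ex: "\<exists>n. gap * wratio l (itin x n) \<le> R" by (intro exI[of _ n]) simp
  define q where "q = (LEAST n. gap * wratio l (itin x n) \<le> R)"
  have q: "gap * wratio l (itin x q) \<le> R" unfolding q_def by (rule LeastI_ex[OF ex])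
  have less: "R < gap * wratio l (itin x n)" if "n < q" for n
    using not_less_Least[of n] that unfolding q_def by force
  obtain m where m: "q = Suc m" using q R(2) by (cases q) auto
  have dI: "digit ((shift ^^ m) x) \<in> I" using x digit_shift shift_iter_in_K by blast
  have "bmin * R \<le> \<beta> (digit ((shift ^^ m) x)) l * (gap * wratio l (itin x m))"
    using less[of m] m R bmin_pos bmin_le[OF dI, of l] by (intro mult_mono) auto
  also have "\<dots> = gap * wratio l (itin x q)" by (simp add: m itin_Suc)
  finally show ?thesis using that q less by blast
qed

text \<open>
  If the cylinders around \<open>x\<close> are eventually narrow in direction \<open>a\<close>, then scale \<open>R\<close> is reached in
  direction \<open>a\<close> no later than in direction \<open>other a\<close>, and the ball is contained in an approximate
  square all of whose sides are comparable to \<open>R\<close>.  Its covering number is estimated by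
  \<open>column_set_coverable\<close>.
\<close>

lemma pointwise_assouad_le:
  assumes x: "x \<in> K"
    and t': "0 \<le> t'" "(\<Sum>i\<in>I. \<beta> i a powr pdim a * \<beta> i (other a) powr t') \<le> 1"
    and \<sigma>: "pdim a + t' \<le> \<sigma>" "pdim (other a) + tdim (other a) \<le> \<sigma>"
    and ev: "\<And>k. k0 \<le> k \<Longrightarrow> wratio a (itin x k) \<le> wratio (other a) (itin x k)"
  shows "pointwise_assouad_dim K x \<le> ereal \<sigma>"
proof -
  let ?b = "other a"
  define M where "M = bmin powr - (pdim a + t') + bmin powr - (pdim ?b + tdim ?b)"
  have M: "bmin powr - (pdim a + t') \<le> M" "bmin powr - (pdim ?b + tdim ?b) \<le> M" "0 < M"
    unfolding M_def using bmin_pos by (auto simp: add_pos_pos)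
  define \<rho> where "\<rho> = gap * bmin ^ k0"
  have \<rho>: "0 < \<rho>" "\<rho> \<le> gap"
    using gap_pos bmin_pos bmin_less_1 unfolding \<rho>_def by (auto simp: power_le_one mult_left_le)
  have main: "real (covering_number r (cball x R \<inter> K)) \<le> (2 * M * (2 / gap) powr \<sigma>) * (R / r) powr \<sigma>"
    if r: "0 < r" "r \<le> R" "R < \<rho>" for r R
  proof -
    have R: "0 < R" "R < gap" using r \<rho> by auto
    obtain p where p: "gap * wratio a (itin x p) \<le> R" "\<And>n. n < p \<Longrightarrow> R < gap * wratio a (itin x n)"
      "bmin * R \<le> gap * wratio a (itin x p)"
      using first_small_scale[OF x R, of a] by metis
    obtain q where q: "gap * wratio ?b (itin x q) \<le> R" "\<And>n. n < q \<Longrightarrow> R < gap * wratio ?b (itin x n)"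
      "bmin * R \<le> gap * wratio ?b (itin x q)"
      using first_small_scale[OF x R, of ?b] by metis
    have "k0 \<le> q"
    proof (rule ccontr)
      assume "\<not> k0 \<le> q"
      then have "bmin ^ k0 \<le> bmin ^ q" using bmin_pos bmin_less_1 by (intro power_decreasing) auto
      also have "\<dots> \<le> wratio ?b (itin x q)" using bmin_power_le_wratio[OF set_itin[OF x], of q ?b] by simp
      finally have "\<rho> \<le> gap * wratio ?b (itin x q)" unfolding \<rho>_def using gap_pos by simp
      then show False using q(1) r by linarith
    qed
    then have "gap * wratio a (itin x q) \<le> gap * wratio ?b (itin x q)"
      using ev gap_pos by simp
    then have pq: "p \<le> q" using p(2)[of q] q(1) by force
    let ?Ls = "map (cls ?b) (itin ((shift ^^ p) x) (q - p))"
    \<comment> \<open>the covering radius \<open>r / 2\<close> is the unit of length\<close>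
    define s where "s l = 2 * wratio l (itin x p) / r" for l
    define c where "c l = 2 * coord_word l (itin x p) 0 / r" for l
    define X where "X = 2 * R / (gap * r)"
    have Ls: "set ?Ls \<subseteq> classes ?b"
      using set_itin[OF shift_iter_in_K[OF x]] cls_in by (auto simp: subset_iff)
    have prod: "s ?b * prod_list (map (class_ratio ?b) ?Ls) = 2 * wratio ?b (itin x q) / r"
      unfolding s_def prod_class_ratio_itin[OF set_itin[OF shift_iter_in_K[OF x]]]
      using wratio_itin_add[of ?b x p "q - p"] pq by simp
    have scale: "bmin \<le> 2 * B / r \<and> 2 * B / r \<le> X" if "gap * B \<le> R" "bmin * R \<le> gap * B" "0 < B" for B
    proof
      have "bmin * r \<le> bmin * R" using r bmin_pos by simp
      also have "\<dots> \<le> gap * B" by fact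
      also have "\<dots> \<le> 2 * B" using gap_le_1 \<open>0 < B\<close> by simp
      finally show "bmin \<le> 2 * B / r" using r by (simp add: field_simps)
      show "2 * B / r \<le> X" unfolding X_def using that r gap_pos by (simp add: field_simps)
    qed
    have sa: "bmin \<le> s a \<and> s a \<le> X"
      unfolding s_def by (rule scale) (use p wratio_pos[OF set_itin[OF x]] in auto)
    have sb: "bmin \<le> s ?b * prod_list (map (class_ratio ?b) ?Ls) \<and> s ?b * prod_list (map (class_ratio ?b) ?Ls) \<le> X"
      unfolding prod by (rule scale) (use q wratio_pos[OF set_itin[OF x]] in auto)
    have "gap * r \<le> 1 * R" using r gap_pos gap_le_1 by (intro mult_mono) auto
    then have X1: "1 \<le> X" unfolding X_def using r gap_pos by (simp add: field_simps)
    let ?u = "s a" and ?v = "s ?b * prod_list (map (class_ratio ?b) ?Ls)"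
    have "coverable 2 (M * (?u powr pdim a * ?v powr t' + ?v powr pdim ?b * ?u powr tdim ?b)) (diag_aff s c ` column_set ?Ls)"
      using column_set_coverable[OF t' M(1,2) Ls] sa sb by blast
    moreover have "M * (?u powr pdim a * ?v powr t' + ?v powr pdim ?b * ?u powr tdim ?b) \<le> M * (X powr \<sigma> + X powr \<sigma>)"
    proof -
      have pw: "u powr \<tau> * v powr \<tau>' \<le> X powr \<sigma>"
        if "bmin \<le> u \<and> u \<le> X" "bmin \<le> v \<and> v \<le> X" "0 \<le> \<tau>" "0 \<le> \<tau>'" "\<tau> + \<tau>' \<le> \<sigma>" for u v \<tau> \<tau>'
      proof -
        have "u powr \<tau> * v powr \<tau>' \<le> X powr \<tau> * X powr \<tau>'"
          using that bmin_pos by (intro mult_mono powr_mono2) auto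
        also have "\<dots> \<le> X powr \<sigma>"
          using that X1 by (simp add: powr_mono flip: powr_add)
        finally show ?thesis .
      qed
      show ?thesis
        using pw[OF sa sb] pw[OF sb sa] t' \<sigma> pdim_nonneg tdim_nonneg M(3) by (intro mult_left_mono add_mono) auto
    qed
    ultimately have "coverable 2 (M * (X powr \<sigma> + X powr \<sigma>)) (diag_aff s c ` column_set ?Ls)"
      by (rule coverable_mono) simp
    then have cov: "coverable (r / 2 * 2) (M * (X powr \<sigma> + X powr \<sigma>)) ((\<lambda>y. (r / 2) *\<^sub>R y) ` diag_aff s c ` column_set ?Ls)"
      by (rule coverable_image) (use r in \<open>auto simp: dist_scaled\<close>)
    have "(r / 2) * (2 * B / r * u + 2 * w / r) = B * u + w" for B u w
      using r by (simp add: field_simps)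
    then have im: "(\<lambda>y. (r / 2) *\<^sub>R y) ` diag_aff s c ` column_set ?Ls = word_map (itin x p) ` column_set ?Ls"
      unfolding image_image word_map_eq_diag_aff by (intro image_cong refl) (simp add: vec_eq_iff s_def c_def)
    have "cball x R \<inter> K \<subseteq> word_map (itin x p) ` column_set ?Ls"
      by (rule cball_subset_column_set[OF x pq p(2) q(2)])
    moreover have "r / 2 * 2 = r" by simp
    ultimately have "coverable r (M * (X powr \<sigma> + X powr \<sigma>)) (cball x R \<inter> K)"
      using cov[unfolded im] by (metis coverable_mono[OF _ order_refl])
    then have "real (covering_number r (cball x R \<inter> K)) \<le> M * (X powr \<sigma> + X powr \<sigma>)"
      by (rule covering_number_le)
    also have "X = (2 / gap) * (R / r)" unfolding X_def by simp
    also have pm: "((2 / gap) * (R / r)) powr \<sigma> = (2 / gap) powr \<sigma> * (R / r) powr \<sigma>"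
      using gap_pos r by (intro powr_mult)
    also have "M * ((2 / gap) powr \<sigma> * (R / r) powr \<sigma> + (2 / gap) powr \<sigma> * (R / r) powr \<sigma>) = (2 * M * (2 / gap) powr \<sigma>) * (R / r) powr \<sigma>"
      by (simp only: mult_2 distrib_left distrib_right mult_ac)
    finally show ?thesis .
  qed
  have "0 < 2 * M * (2 / gap) powr \<sigma>" using M(3) gap_pos by simp
  then have "\<exists>C>0. \<exists>\<rho>>0. \<forall>r R. 0 < r \<and> r \<le> R \<and> R < \<rho> \<longrightarrow>
                real (covering_number r (cball x R \<inter> K)) \<le> C * (R / r) powr \<sigma>"
    using main \<rho>(1) by blast
  then show ?thesis
    unfolding pointwise_assouad_dim_def by (intro INF_lower) blast
qed

section \<open>Assouad dimension from below\<close>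

lemma thin_packable:
  assumes Ls: "set Ls \<subseteq> classes a" and s: "0 < s a" "0 < s (other a)" "s (other a) \<le> 1"
  shows "packable gap (s (other a) powr tdim a * (s a * prod_list (map (class_ratio a) Ls)) powr pdim a) (diag_aff s c ` column_set Ls)"
proof -
  let ?P = "prod_list (map (class_ratio a) Ls)"
  obtain e where e: "(\<lambda>x. x $ a) ` column_set Ls = (\<lambda>t. ?P * t + e) ` eta a K"
    using column_set_projection[OF Ls] by blast
  have "packable gap ((s a * ?P) powr pdim a) ((\<lambda>t. (s a * ?P) * t + (s a * e + c a)) ` eta a K)"
    using s prod_class_ratio_pos[OF Ls] by (intro eta_packable) auto
  also have "(\<lambda>t. (s a * ?P) * t + (s a * e + c a)) ` eta a K = (\<lambda>t. s a * t + c a) ` (\<lambda>x. x $ a) ` column_set Ls"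
    unfolding e image_image by (rule image_cong) (auto simp: algebra_simps)
  also have "\<dots> = (\<lambda>x. x $ a) ` diag_aff s c ` column_set Ls"
    by (simp add: image_image)
  finally have "packable gap ((s a * ?P) powr pdim a) (diag_aff s c ` column_set Ls)"
    by (rule packable_of_projection) (rule dist_component_le)
  moreover have "s (other a) powr tdim a \<le> 1"
    using s tdim_nonneg by (intro powr_le1) auto
  ultimately show ?thesis
    using mult_right_mono[of "s (other a) powr tdim a" 1 "(s a * ?P) powr pdim a"]
    by (elim packable_mono) auto
qed

text \<open>
  A column of maximal dimension, followed for \<open>n\<close> steps, in a copy so flat that its pieces are at
  most one unit high after these steps.  They are stacked in direction \<open>other a\<close> at mutual distance at
  least \<open>gap\<close>, and each contains a packing that comes from the projection to direction \<open>a\<close>.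
\<close>

lemma column_set_packable:
  assumes L: "L \<in> classes a" "column_dim \<beta> a L = tdim a"
    and s: "0 < s a" "0 < s (other a)" "s (other a) * bmax ^ n \<le> 1"
  shows "packable gap (s (other a) powr tdim a * (s a * class_ratio a L ^ n) powr pdim a)
    (diag_aff s c ` column_set (replicate n L))"
  using s
proof (induction n arbitrary: s c)
  case 0
  then show ?case using thin_packable[of "[]" a s c] by simp
next
  case (Suc n)
  let ?b = "other a"
  show ?case
  proof (cases "s ?b \<le> 1")
    case True
    have "set (replicate (Suc n) L) \<subseteq> classes a" using L by auto
    from thin_packable[OF this Suc.prems(1,2) True, of c]
    show ?thesis by (simp del: replicate.simps add: map_replicate)
  next
    case False
    let ?s = "\<lambda>i l. s l * \<beta> i l" and ?c = "\<lambda>i l. s l * d i l + c l"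
    have pack: "packable gap (\<Sum>i\<in>L. ?s i ?b powr tdim a * (?s i a * class_ratio a L ^ n) powr pdim a)
       (\<Union>i\<in>L. diag_aff (?s i) (?c i) ` column_set (replicate n L))"
    proof (rule packable_UN)
      fix i assume i: "i \<in> L"
      then have iI: "i \<in> I" using in_class[OF L(1)] by blast
      have "?s i ?b * bmax ^ n \<le> s ?b * bmax * bmax ^ n"
        using Suc.prems le_bmax[OF iI] bmax_pos by (intro mult_right_mono mult_left_mono) auto
      also have "\<dots> \<le> 1" using Suc.prems by (simp add: mult.assoc)
      finally show "packable gap (?s i ?b powr tdim a * (?s i a * class_ratio a L ^ n) powr pdim a)
          (diag_aff (?s i) (?c i) ` column_set (replicate n L))"
        using Suc.prems ratio_pos[OF iI] by (intro Suc.IH) auto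
    next
      fix i i' x y
      assume i: "i \<in> L" "i' \<in> L" "i \<noteq> i'"
        and "x \<in> diag_aff (?s i) (?c i) ` column_set (replicate n L)" "y \<in> diag_aff (?s i') (?c i') ` column_set (replicate n L)"
      then obtain u v where uv: "u \<in> column_set (replicate n L)" "v \<in> column_set (replicate n L)"
        "x = diag_aff (?s i) (?c i) u" "y = diag_aff (?s i') (?c i') v" by blast
      have "set (replicate n L) \<subseteq> classes a" using L by auto
      with uv have K: "u \<in> K" "v \<in> K" using column_set_subset_K by blast+
      have I: "i \<in> I" "i' \<in> I" "cls a i = cls a i'" using i in_class[OF L(1)] by auto
      have "cls ?b i \<noteq> cls ?b i'"
      proof
        assume "cls ?b i = cls ?b i'"
        then have "cls l i = cls l i'" for l using I(3) index_cases[of l a] by auto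
        then show False using letter_eqI I i(3) by blast
      qed
      then have "gap \<le> \<bar>coord_map \<beta> d i ?b (u $ ?b) - coord_map \<beta> d i' ?b (v $ ?b)\<bar>"
        using I K nth_in_eta by (intro gap_le) auto
      also have "\<dots> \<le> s ?b * \<bar>coord_map \<beta> d i ?b (u $ ?b) - coord_map \<beta> d i' ?b (v $ ?b)\<bar>"
        using False mult_right_mono[of 1 "s ?b"] by simp
      also have "\<dots> = \<bar>s ?b * (coord_map \<beta> d i ?b (u $ ?b) - coord_map \<beta> d i' ?b (v $ ?b))\<bar>"
        using False by (simp add: abs_mult)
      also have "s ?b * (coord_map \<beta> d i ?b (u $ ?b) - coord_map \<beta> d i' ?b (v $ ?b)) = x $ ?b - y $ ?b"
        by (simp add: uv coord_map_def algebra_simps)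
      finally show "gap \<le> dist x y" using component_dist_le[of x ?b y] by linarith
    qed (use L finite_class gap_pos in auto)
    have eq: "(\<Union>i\<in>L. diag_aff (?s i) (?c i) ` column_set (replicate n L)) = diag_aff s c ` column_set (replicate (Suc n) L)"
      by (simp add: image_UN diag_aff_carpet_map)
    have "?s i ?b powr tdim a * (?s i a * class_ratio a L ^ n) powr pdim a
       = s ?b powr tdim a * (s a * class_ratio a L ^ Suc n) powr pdim a * \<beta> i ?b powr tdim a" if "i \<in> L" for i
      using Suc.prems in_class[OF L(1) that] ratio_pos[of i ?b] class_ratio_eq[OF L(1) that]
      by (simp add: powr_mult[of "s ?b"] mult.assoc less_imp_le mult_ac)
    then have "(\<Sum>i\<in>L. ?s i ?b powr tdim a * (?s i a * class_ratio a L ^ n) powr pdim a)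
        = s ?b powr tdim a * (s a * class_ratio a L ^ Suc n) powr pdim a * (\<Sum>i\<in>L. \<beta> i ?b powr tdim a)"
      by (simp only: sum_distrib_left cong: sum.cong)
    also have "\<dots> = s ?b powr tdim a * (s a * class_ratio a L ^ Suc n) powr pdim a"
      using column_facts(1)[OF L(1)] L(2) by simp
    finally show ?thesis using pack unfolding eq by simp
  qed
qed

text \<open>
  Repeating \<open>i0\<close> gives cylinders of arbitrarily large ratio of width \<open>W\<close> to height \<open>H\<close>.  Following an optimal column
  from there until the width has decreased to about \<open>H\<close> takes many steps, so at scales
  between \<open>H / X\<close> and \<open>H\<close>, with \<open>X\<close> fixed in advance, the set looks like the product of the
  column with \<open>\<eta>\<^sub>a(K)\<close>.
\<close>

lemma assouad_dim_ge:
  assumes i0: "i0 \<in> I" "\<beta> i0 (other a) < \<beta> i0 a"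
  shows "ereal (pdim a + tdim a) \<le> assouad_dim K"
  unfolding assouad_dim_def
proof (rule INF_greatest, clarify)
  fix \<sigma> C :: real
  let ?b = "other a"
  assume C: "0 < C" and bound: "\<forall>r R. 0 < r \<and> r \<le> R \<and> R < 1 \<longrightarrow>
       (\<forall>x\<in>K. real (covering_number r (cball x R \<inter> K)) \<le> C * (R / r) powr \<sigma>)"
  obtain L where L: "L \<in> classes a" "column_dim \<beta> a L = tdim a" using tdim_attained by blast
  have class_ratio: "bmin \<le> class_ratio a L" "class_ratio a L \<le> bmax" "0 < class_ratio a L"
    using L bmin_le_class_ratio class_ratio_le_bmax class_ratio_bounds by auto
  have "bmin powr pdim a * X powr (pdim a + tdim a) \<le> C * (6 / gap) powr \<sigma> * X powr \<sigma>" if X: "1 \<le> X" for X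
  proof -
    \<comment> \<open>\<open>n0\<close> steps in the column make the pieces thinner than \<open>H / X\<close>\<close>
    obtain n0 where n0: "bmax ^ n0 < 1 / X"
      using real_arch_pow_inv[of "1 / X" bmax] bmax_less_1 X by auto
    have "(\<beta> i0 ?b / \<beta> i0 a) < 1" "0 < \<beta> i0 ?b / \<beta> i0 a"
      using i0 ratio_pos by simp_all
    then have "(\<lambda>k. (\<beta> i0 ?b / \<beta> i0 a) ^ k) \<longlonglongrightarrow> 0" by (intro LIMSEQ_power_zero) auto
    then have "\<forall>\<^sub>F k in sequentially. (\<beta> i0 ?b / \<beta> i0 a) ^ k < bmin ^ n0"
      using bmin_pos by (intro order_tendstoD(2)) auto
    moreover have "\<forall>\<^sub>F k in sequentially. \<beta> i0 ?b ^ k < 1 / 2"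
      using ratio_pos[OF i0(1)] ratio_less_1[OF i0(1)]
      by (intro order_tendstoD(2)[OF LIMSEQ_power_zero]) (auto simp: abs_of_pos)
    ultimately have "\<forall>\<^sub>F k in sequentially. (\<beta> i0 ?b / \<beta> i0 a) ^ k < bmin ^ n0 \<and> \<beta> i0 ?b ^ k < 1 / 2 \<and> 1 \<le> k"
      using eventually_ge_at_top[of 1] by eventually_elim auto
    then obtain k where k: "(\<beta> i0 ?b / \<beta> i0 a) ^ k < bmin ^ n0" "\<beta> i0 ?b ^ k < 1 / 2" "1 \<le> k"
      unfolding eventually_sequentially by (meson order_refl)
    define H where "H = \<beta> i0 ?b ^ k"
    define W where "W = \<beta> i0 a ^ k"
    have HW: "0 < H" "H < 1 / 2" "0 < W" "H < W * bmin ^ n0"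
      using k i0 ratio_pos by (auto simp: H_def W_def power_divide divide_less_eq mult.commute)
    obtain n' where "class_ratio a L ^ n' < H / W"
      using real_arch_pow_inv[of "H / W" "class_ratio a L"] HW class_ratio bmax_less_1 by auto
    then have ex: "\<exists>n. W * class_ratio a L ^ n \<le> H"
      using HW by (intro exI[of _ n']) (simp add: field_simps)
    define n where "n = (LEAST n. W * class_ratio a L ^ n \<le> H)"
    have n: "W * class_ratio a L ^ n \<le> H" unfolding n_def by (rule LeastI_ex[OF ex])
    have n_ge: "n0 < n"
    proof (rule ccontr)
      assume "\<not> n0 < n"
      then have "bmin ^ n0 \<le> bmin ^ n" using bmin_pos bmin_less_1 by (intro power_decreasing) auto
      also have "\<dots> \<le> class_ratio a L ^ n" using class_ratio bmin_pos by (intro power_mono) auto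
      finally have "W * bmin ^ n0 \<le> W * class_ratio a L ^ n" using HW by simp
      then show False using n HW by linarith
    qed
    then obtain m where m: "n = Suc m" by (cases n) auto
    have "\<not> W * class_ratio a L ^ m \<le> H"
      using not_less_Least[of m "\<lambda>n. W * class_ratio a L ^ n \<le> H"] m unfolding n_def by simp
    then have "H * bmin \<le> W * class_ratio a L ^ m * class_ratio a L"
      using class_ratio HW bmin_pos by (intro mult_mono) auto
    then have n_lower: "bmin * H \<le> W * class_ratio a L ^ n" using m by (simp add: mult_ac)
    \<comment> \<open>the unit of length of the packing\<close>
    define \<tau> where "\<tau> = H / X"
    have \<tau>: "0 < \<tau>" using HW X by (simp add: \<tau>_def)
    let ?w = "replicate k i0"
    let ?F = "word_map ?w ` column_set (replicate n L)"
    define s where "s l = wratio l ?w / \<tau>" for l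
    define c where "c l = coord_word l ?w 0 / \<tau>" for l
    have wratio: "wratio l ?w = \<beta> i0 l ^ k" for l by (simp add: wratio_def)
    have sa: "s a = W / \<tau>" and sb: "s ?b = X"
      using HW X by (simp_all add: s_def wratio \<tau>_def flip: W_def H_def)
    have "bmax ^ n \<le> bmax ^ n0" using n_ge bmax_pos bmax_less_1 by (intro power_decreasing) auto
    then have "X * bmax ^ n \<le> X * (1 / X)" using n0 X by (intro mult_left_mono) auto
    then have "packable gap (s ?b powr tdim a * (s a * class_ratio a L ^ n) powr pdim a) (diag_aff s c ` column_set (replicate n L))"
      using X HW \<tau> by (intro column_set_packable[OF L]) (auto simp: sa sb)
    then have pack0: "packable (\<tau> * gap) (s ?b powr tdim a * (s a * class_ratio a L ^ n) powr pdim a)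
        ((\<lambda>y. \<tau> *\<^sub>R y) ` diag_aff s c ` column_set (replicate n L))"
      by (rule packable_image) (use \<tau> gap_pos in \<open>auto simp: dist_scaled\<close>)
    have "\<tau> * (B / \<tau> * u + w / \<tau>) = B * u + w" for B u w
      using \<tau> by (simp add: field_simps)
    then have im: "(\<lambda>y. \<tau> *\<^sub>R y) ` diag_aff s c ` column_set (replicate n L) = ?F"
      unfolding image_image word_map_eq_diag_aff by (intro image_cong refl) (simp add: vec_eq_iff s_def c_def)
    have "bmin powr pdim a * X powr (pdim a + tdim a) \<le> s ?b powr tdim a * (s a * class_ratio a L ^ n) powr pdim a"
    proof -
      have "bmin * X = bmin * H / \<tau>" using HW X by (simp add: \<tau>_def)
      also have "\<dots> \<le> W * class_ratio a L ^ n / \<tau>" using n_lower \<tau> by (simp add: divide_right_mono)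
      finally have "(bmin * X) powr pdim a \<le> (s a * class_ratio a L ^ n) powr pdim a"
        using X bmin_pos pdim_nonneg by (intro powr_mono2) (auto simp: sa)
      then have "X powr tdim a * (bmin * X) powr pdim a \<le> X powr tdim a * (s a * class_ratio a L ^ n) powr pdim a"
        by (intro mult_left_mono) auto
      then show ?thesis using X bmin_pos by (simp add: sb powr_mult powr_add mult_ac)
    qed
    then have pack: "packable (\<tau> * gap) (bmin powr pdim a * X powr (pdim a + tdim a)) ?F"
      by (rule packable_mono[OF pack0[unfolded im] _ order_refl])
    have Lset: "set (replicate n L) \<subseteq> classes a" using L by auto
    have colK: "column_set (replicate n L) \<subseteq> K" by (rule column_set_subset_K[OF Lset])
    have "set ?w \<subseteq> I" using i0 by auto
    then have FK: "?F \<subseteq> K" using colK word_map_in_K by blast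
    obtain e where e: "(\<lambda>x. x $ a) ` column_set (replicate n L) = (\<lambda>t. prod_list (map (class_ratio a) (replicate n L)) * t + e) ` eta a K"
      using column_set_projection[OF Lset] by blast
    have near: "dist x y \<le> 2 * H" if "x \<in> ?F" "y \<in> ?F" for x y
    proof -
      from that obtain u v
        where uv: "u \<in> column_set (replicate n L)" "v \<in> column_set (replicate n L)" "x = word_map ?w u" "y = word_map ?w v"
        by blast
      have diff: "\<bar>x $ l - y $ l\<bar> = \<beta> i0 l ^ k * \<bar>u $ l - v $ l\<bar>" for l
        using ratio_pos[OF i0(1), of l] by (simp add: uv word_map_nth coord_word_diff wratio abs_mult)
      obtain p q where pq: "p \<in> eta a K" "q \<in> eta a K" "u $ a = class_ratio a L ^ n * p + e" "v $ a = class_ratio a L ^ n * q + e"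
        using e uv(1,2) by (auto simp: map_replicate set_eq_iff image_iff) (metis)
      have "\<bar>x $ a - y $ a\<bar> = W * class_ratio a L ^ n * \<bar>p - q\<bar>"
        unfolding diff W_def[symmetric] pq using class_ratio by (simp add: abs_mult flip: right_diff_distrib)
      also have "\<dots> \<le> H * 1"
        using n HW class_ratio eta_bounds[OF pq(1)] eta_bounds[OF pq(2)] by (intro mult_mono) auto
      finally have "\<bar>x $ a - y $ a\<bar> \<le> H" by simp
      moreover have "\<bar>u $ ?b - v $ ?b\<bar> \<le> 1"
        using K_bounds[of u ?b] K_bounds[of v ?b] uv colK by (auto simp: subset_iff abs_le_iff)
      then have "\<bar>x $ ?b - y $ ?b\<bar> \<le> H"
        unfolding diff H_def[symmetric] using HW mult_left_mono[of _ 1 H] by simp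
      ultimately show ?thesis using dist_le_components[of x y a] by linarith
    qed
    have "column_set (replicate n L) \<noteq> {}" using e eta_nonempty by (metis image_is_empty)
    then obtain x where x: "x \<in> ?F" by blast
    have sub: "?F \<subseteq> cball x (2 * H) \<inter> K" using near[OF x] FK by auto
    define r where "r = \<tau> * gap / 3"
    have r: "0 < r" "r \<le> 2 * H" "2 * H / r = 6 / gap * X"
    proof -
      show "0 < r" using \<tau> gap_pos by (simp add: r_def)
      have "\<tau> * gap \<le> H * 1"
        using HW X gap_pos gap_le_1 \<tau> by (intro mult_mono) (auto simp: \<tau>_def field_simps)
      then show "r \<le> 2 * H" using HW by (simp add: r_def)
      show "2 * H / r = 6 / gap * X" using HW X by (simp add: r_def \<tau>_def)
    qed
    have "bmin powr pdim a * X powr (pdim a + tdim a) \<le> real (covering_number r (cball x (2 * H) \<inter> K))"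
    proof (rule covering_number_ge[OF packable_mono[OF pack order_refl sub]])
      show "bounded (cball x (2 * H) \<inter> K)" using compact_imp_bounded[OF compact_K] by (rule bounded_subset) auto
      show "2 * r < \<tau> * gap" using \<tau> gap_pos by (simp add: r_def)
    qed (rule r)
    also have "\<dots> \<le> C * (2 * H / r) powr \<sigma>"
      by (rule bound[rule_format]) (use r HW subsetD[OF FK x] in simp_all)
    also have "\<dots> = C * (6 / gap) powr \<sigma> * X powr \<sigma>"
      unfolding r(3) using gap_pos X powr_mult[of "6 / gap" X] by simp
    finally show ?thesis .
  qed
  moreover have "0 < bmin powr pdim a" using bmin_pos by simp
  ultimately have "pdim a + tdim a \<le> \<sigma>"
    by (rule le_of_powr_bound)
  then show "ereal (pdim a + tdim a) \<le> ereal \<sigma>" by simp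
qed

section \<open>Entropy, exponents and the numbers \<open>d\<^sub>l\<close>\<close>

lemma prob_vector_nonneg: "w \<in> prob_vectors I \<Longrightarrow> i \<in> I \<Longrightarrow> 0 \<le> w i"
  and prob_vector_sum: "w \<in> prob_vectors I \<Longrightarrow> (\<Sum>i\<in>I. w i) = 1"
  by (auto simp: prob_vectors_def)

lemma eta_vector_nonneg: "w \<in> prob_vectors I \<Longrightarrow> L \<in> classes l \<Longrightarrow> 0 \<le> eta_vector w L"
  unfolding eta_vector_def using class_subset prob_vector_nonneg by (intro sum_nonneg) blast

lemma eta_vector_sum: "w \<in> prob_vectors I \<Longrightarrow> (\<Sum>L\<in>classes l. eta_vector w L) = 1"
  unfolding eta_vector_def by (simp flip: sum_over_classes add: prob_vector_sum)

lemma le_eta_vector: "w \<in> prob_vectors I \<Longrightarrow> L \<in> classes l \<Longrightarrow> i \<in> L \<Longrightarrow> w i \<le> eta_vector w L"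
  unfolding eta_vector_def using class_subset[of L l] prob_vector_nonneg finite_class[of L l]
  by (intro member_le_sum) auto

lemma sum_eta_vector: "(\<Sum>L\<in>classes l. eta_vector w L * f L) = (\<Sum>i\<in>I. w i * f (cls l i))" for f :: "'i set \<Rightarrow> real"
proof -
  have "(\<Sum>i\<in>I. w i * f (cls l i)) = (\<Sum>L\<in>classes l. \<Sum>i\<in>L. w i * f (cls l i))"
    by (rule sum_over_classes)
  also have "\<dots> = (\<Sum>L\<in>classes l. \<Sum>i\<in>L. w i * f L)"
    by (intro sum.cong refl) (use in_class in auto)
  finally show ?thesis by (simp add: eta_vector_def sum_distrib_right)
qed

abbreviation ent_eta :: "2 \<Rightarrow> ('i \<Rightarrow> real) \<Rightarrow> real" where
  "ent_eta l w \<equiv> shannon_entropy (classes l) (eta_vector w)"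

abbreviation lyap :: "2 \<Rightarrow> ('i \<Rightarrow> real) \<Rightarrow> real" where
  "lyap l w \<equiv> chi I \<beta> l w"

text \<open>
  The quantity that is maximised in \<open>d_dir\<close>, without a restriction on \<open>w\<close>.
\<close>

definition dim_formula :: "2 \<Rightarrow> ('i \<Rightarrow> real) \<Rightarrow> real" where
  "dim_formula l w = ent_eta l w / lyap l w + (shannon_entropy I w - ent_eta l w) / lyap (other l) w"

lemma ln_bmax_neg: "ln bmax < 0" and ln_bmin_neg: "ln bmin < 0"
  using bmax_pos bmax_less_1 bmin_pos bmin_less_1 by simp_all

lemma chi_ge: "w \<in> prob_vectors I \<Longrightarrow> - ln bmax \<le> lyap l w"
proof -
  assume w: "w \<in> prob_vectors I"
  have "(\<Sum>i\<in>I. w i * ln (\<beta> i l)) \<le> (\<Sum>i\<in>I. w i * ln bmax)"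
    using w prob_vector_nonneg le_bmax ratio_pos bmax_pos by (intro sum_mono mult_left_mono) auto
  then show ?thesis using prob_vector_sum[OF w] by (simp add: chi_def flip: sum_distrib_right)
qed

lemma chi_pos: "w \<in> prob_vectors I \<Longrightarrow> 0 < lyap l w"
  using chi_ge[of w l] ln_bmax_neg by linarith

lemma ent_eta_alt: "ent_eta l w = - (\<Sum>i\<in>I. w i * ln (eta_vector w (cls l i)))"
  unfolding shannon_entropy_def by (simp add: sum_eta_vector)

lemma ent_eta_nonneg: "w \<in> prob_vectors I \<Longrightarrow> 0 \<le> ent_eta l w"
proof -
  assume w: "w \<in> prob_vectors I"
  have "eta_vector w L * ln (eta_vector w L) \<le> 0" if L: "L \<in> classes l" for L
  proof -
    have "eta_vector w L \<le> (\<Sum>L\<in>classes l. eta_vector w L)"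
      using L eta_vector_nonneg[OF w] finite_classes by (intro member_le_sum) auto
    then have "eta_vector w L \<le> 1" using eta_vector_sum[OF w] by simp
    then show ?thesis using eta_vector_nonneg[OF w L]
      by (cases "eta_vector w L = 0") (auto intro!: mult_nonneg_nonpos)
  qed
  then show ?thesis unfolding shannon_entropy_def by (simp add: sum_nonpos)
qed

lemma ent_eta_le_entropy: "w \<in> prob_vectors I \<Longrightarrow> ent_eta l w \<le> shannon_entropy I w"
proof -
  assume w: "w \<in> prob_vectors I"
  have "w i * ln (w i) \<le> w i * ln (eta_vector w (cls l i))" if i: "i \<in> I" for i
  proof (cases "w i = 0")
    case False
    then have "0 < w i" using prob_vector_nonneg[OF w i] by simp
    then show ?thesis
      using le_eta_vector[OF w cls_in[OF i] self_in_cls[OF i], of l] by (intro mult_left_mono ln_mono) auto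
  qed simp
  then show ?thesis
    unfolding ent_eta_alt unfolding shannon_entropy_def by (simp add: sum_mono)
qed

lemma dim_formula_nonneg: "w \<in> prob_vectors I \<Longrightarrow> 0 \<le> dim_formula l w"
  unfolding dim_formula_def using chi_pos ent_eta_nonneg ent_eta_le_entropy
  by (intro add_nonneg_nonneg divide_nonneg_pos) auto

text \<open>
  Gibbs' inequality against the weights of Moran's equation of the projection.
\<close>

lemma ent_eta_le_pdim: "w \<in> prob_vectors I \<Longrightarrow> ent_eta l w \<le> pdim l * lyap l w"
proof -
  assume w: "w \<in> prob_vectors I"
  have "(\<Sum>L\<in>classes l. eta_vector w L * ln (class_ratio l L powr pdim l)) \<le> (\<Sum>L\<in>classes l. eta_vector w L * ln (eta_vector w L))"
    using finite_classes eta_vector_nonneg[OF w] eta_vector_sum[OF w] pdim_sum class_ratio_bounds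
    by (intro gibbs_inequality) force+
  moreover have "(\<Sum>L\<in>classes l. eta_vector w L * ln (class_ratio l L powr pdim l)) = (\<Sum>i\<in>I. w i * ln (class_ratio l (cls l i) powr pdim l))"
    by (rule sum_eta_vector)
  moreover have "\<dots> = (\<Sum>i\<in>I. pdim l * (w i * ln (\<beta> i l)))"
    by (rule sum.cong) (auto simp: class_ratio_cls ln_powr)
  moreover have "\<dots> = - (pdim l * lyap l w)"
    by (simp add: chi_def sum_distrib_left)
  ultimately show ?thesis unfolding shannon_entropy_def by simp
qed

text \<open>
  Gibbs' inequality against the vector that distributes the mass of each class over its members with
  weights \<open>\<beta> i (other l) powr tdim l\<close>.
\<close>

lemma entropy_diff_le_tdim:
  "w \<in> prob_vectors I \<Longrightarrow> shannon_entropy I w - ent_eta l w \<le> tdim l * lyap (other l) w"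
proof -
  assume w: "w \<in> prob_vectors I"
  let ?q = "\<lambda>i. eta_vector w (cls l i) * \<beta> i (other l) powr tdim l"
  have "(\<Sum>i\<in>I. ?q i) = (\<Sum>L\<in>classes l. \<Sum>i\<in>L. ?q i)" by (rule sum_over_classes)
  also have "\<dots> = (\<Sum>L\<in>classes l. eta_vector w L * (\<Sum>i\<in>L. \<beta> i (other l) powr tdim l))"
    unfolding sum_distrib_left by (intro sum.cong refl) (use in_class in auto)
  also have "\<dots> \<le> (\<Sum>L\<in>classes l. eta_vector w L * 1)"
    using column_sum_le_1 eta_vector_nonneg[OF w] by (intro sum_mono mult_left_mono) auto
  finally have q: "(\<Sum>i\<in>I. ?q i) \<le> (\<Sum>i\<in>I. w i)" using eta_vector_sum[OF w] prob_vector_sum[OF w] by simp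
  have "(\<Sum>i\<in>I. w i * ln (?q i)) \<le> (\<Sum>i\<in>I. w i * ln (w i))"
  proof (rule gibbs_inequality[OF finite_I _ _ _ q])
    fix i assume i: "i \<in> I"
    show "0 \<le> w i" using prob_vector_nonneg[OF w i] .
    show "0 \<le> ?q i" using eta_vector_nonneg[OF w cls_in[OF i]] by simp
    show "?q i = 0 \<Longrightarrow> w i = 0"
      using le_eta_vector[OF w cls_in[OF i] self_in_cls[OF i], of l] \<open>0 \<le> w i\<close> ratio_pos[OF i, of "other l"] by auto
  qed
  moreover have "w i * ln (?q i) = w i * ln (eta_vector w (cls l i)) + tdim l * (w i * ln (\<beta> i (other l)))" if i: "i \<in> I" for i
  proof (cases "w i = 0")
    case False
    then have "0 < eta_vector w (cls l i)"
      using le_eta_vector[OF w cls_in[OF i] self_in_cls[OF i], of l] prob_vector_nonneg[OF w i] False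
      by linarith
    then show ?thesis using ratio_pos[OF i, of "other l"] by (simp add: ln_mult ln_powr algebra_simps)
  qed simp
  ultimately have "(\<Sum>i\<in>I. w i * ln (eta_vector w (cls l i)) + tdim l * (w i * ln (\<beta> i (other l)))) \<le> (\<Sum>i\<in>I. w i * ln (w i))"
    by simp
  then show ?thesis
    unfolding ent_eta_alt unfolding shannon_entropy_def chi_def
    by (simp add: sum.distrib sum_distrib_left algebra_simps)
qed

text \<open>
  A letter is determined by its two classes, so the product of the two projected vectors is a
  subprobability vector on \<open>I\<close>.
\<close>

lemma entropy_subadditive:
  "w \<in> prob_vectors I \<Longrightarrow> shannon_entropy I w \<le> ent_eta l w + ent_eta (other l) w"
proof -
  assume w: "w \<in> prob_vectors I"
  let ?q = "\<lambda>i. eta_vector w (cls l i) * eta_vector w (cls (other l) i)"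
  have inj: "inj_on (\<lambda>i. (cls l i, cls (other l) i)) I"
  proof (rule inj_onI)
    fix i i' assume i: "i \<in> I" "i' \<in> I" "(cls l i, cls (other l) i) = (cls l i', cls (other l) i')"
    then have "cls l' i = cls l' i'" for l' using index_cases[of l' l] by auto
    then show "i = i'" using letter_eqI i by blast
  qed
  have "(\<Sum>i\<in>I. ?q i) = (\<Sum>(L, M)\<in>(\<lambda>i. (cls l i, cls (other l) i)) ` I. eta_vector w L * eta_vector w M)"
    by (simp add: sum.reindex[OF inj])
  also have "\<dots> \<le> (\<Sum>(L, M)\<in>classes l \<times> classes (other l). eta_vector w L * eta_vector w M)"
    using finite_classes cls_in eta_vector_nonneg[OF w] by (intro sum_mono2) auto
  also have "\<dots> = (\<Sum>L\<in>classes l. eta_vector w L) * (\<Sum>M\<in>classes (other l). eta_vector w M)"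
    by (simp add: sum_product sum.cartesian_product)
  finally have q: "(\<Sum>i\<in>I. ?q i) \<le> (\<Sum>i\<in>I. w i)" using eta_vector_sum[OF w] prob_vector_sum[OF w] by simp
  have pos: "0 < eta_vector w (cls l' i)" if "i \<in> I" "w i \<noteq> 0" for i l'
    using le_eta_vector[OF w cls_in[OF that(1)] self_in_cls[OF that(1)], of l'] prob_vector_nonneg[OF w that(1)] that(2)
    by linarith
  have "(\<Sum>i\<in>I. w i * ln (?q i)) \<le> (\<Sum>i\<in>I. w i * ln (w i))"
  proof (rule gibbs_inequality[OF finite_I _ _ _ q])
    fix i assume i: "i \<in> I"
    show "0 \<le> w i" using prob_vector_nonneg[OF w i] .
    show "0 \<le> ?q i" using eta_vector_nonneg[OF w cls_in[OF i]] by simp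
    show "?q i = 0 \<Longrightarrow> w i = 0" using pos[OF i, of l] pos[OF i, of "other l"] by (metis less_irrefl mult_eq_0_iff)
  qed
  moreover have "w i * ln (?q i) = w i * ln (eta_vector w (cls l i)) + w i * ln (eta_vector w (cls (other l) i))" if i: "i \<in> I" for i
    using pos[OF i, of l] pos[OF i, of "other l"] by (cases "w i = 0") (auto simp: ln_mult_pos algebra_simps)
  ultimately have "(\<Sum>i\<in>I. w i * ln (eta_vector w (cls l i)) + w i * ln (eta_vector w (cls (other l) i))) \<le> (\<Sum>i\<in>I. w i * ln (w i))"
    by simp
  then show ?thesis
    unfolding ent_eta_alt unfolding shannon_entropy_def by (simp add: sum.distrib)
qed

lemma dim_formula_le: 
  assumes w: "w \<in> prob_vectors I"
  shows "dim_formula l w \<le> pdim l + tdim l"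
proof -
  have "ent_eta l w / lyap l w \<le> pdim l" "(shannon_entropy I w - ent_eta l w) / lyap (other l) w \<le> tdim l"
    using ent_eta_le_pdim[OF w] entropy_diff_le_tdim[OF w] chi_pos[OF w] by (simp_all add: pos_divide_le_eq)
  then show ?thesis unfolding dim_formula_def by linarith
qed

lemma d_dir_alt: "d_dir I \<beta> d l = (SUP w\<in>prob_vectors_dir I \<beta> l. dim_formula l w)"
  by (simp add: d_dir_def dim_formula_def)

lemma dim_formula_le_d_dir: "w \<in> prob_vectors_dir I \<beta> l \<Longrightarrow> dim_formula l w \<le> d_dir I \<beta> d l"
  unfolding d_dir_alt
  by (rule cSUP_upper) (auto intro!: bdd_aboveI[of _ "pdim l + tdim l"] dim_formula_le simp: prob_vectors_dir_def)

lemma d_dir_le: "prob_vectors_dir I \<beta> l \<noteq> {} \<Longrightarrow> d_dir I \<beta> d l \<le> pdim l + tdim l"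
  unfolding d_dir_alt by (rule cSUP_least) (auto intro!: dim_formula_le simp: prob_vectors_dir_def)

lemma letter_freq_prob: 
  assumes "range \<gamma> \<subseteq> I" "1 \<le> k"
  shows "letter_freq \<gamma> k \<in> prob_vectors I"
proof -
  have "(\<Sum>i\<in>I. card {n. n < k \<and> \<gamma> n = i}) = card (\<Union>i\<in>I. {n. n < k \<and> \<gamma> n = i})"
    by (rule card_UN_disjoint[symmetric]) (auto simp: finite_I)
  also have "(\<Union>i\<in>I. {n. n < k \<and> \<gamma> n = i}) = {..<k}" using assms by auto
  finally have "(\<Sum>i\<in>I. card {n. n < k \<and> \<gamma> n = i}) = k" by simp
  then have "(\<Sum>i\<in>I. real (card {n. n < k \<and> \<gamma> n = i})) = real k" by (simp flip: of_nat_sum)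
  then show ?thesis
    using assms unfolding prob_vectors_def letter_freq_def by (simp flip: sum_divide_distrib)
qed

text \<open>
  The empirical vectors of a sequence in \<open>\<Omega>\<^sub>l\<close> eventually have the smaller exponent in direction \<open>l\<close>.
\<close>

lemma Omega_dir_imp:
  assumes "Omega_dir I \<beta> l \<noteq> {}"
  shows "\<exists>w\<in>prob_vectors I. lyap l w < lyap (other l) w"
proof -
  obtain \<gamma> where \<gamma>: "\<gamma> \<in> Omega_dir I \<beta> l" using assms by blast
  then have I: "range \<gamma> \<subseteq> I" by (auto simp: Omega_dir_def split: if_splits)
  have pos: "0 < lyap l' (letter_freq \<gamma> k)" if "1 \<le> k" for k l'
    using chi_pos letter_freq_prob[OF I that] by blast
  have "\<exists>k\<ge>1. lyap l (letter_freq \<gamma> k) < lyap (other l) (letter_freq \<gamma> k)"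
  proof (cases "l = 1")
    case True
    then have "limsup (\<lambda>k. ereal (exponent_ratio I \<beta> \<gamma> k)) < 1"
      using \<gamma> by (simp add: Omega_dir_def)
    then have "\<forall>\<^sub>F k in sequentially. ereal (exponent_ratio I \<beta> \<gamma> k) < 1"
      by (rule Limsup_lessD)
    then obtain k where "ereal (exponent_ratio I \<beta> \<gamma> k) < 1" "1 \<le> k"
      unfolding eventually_sequentially by (meson nle_le order_refl)
    then show ?thesis
      using True pos[of k] by (intro exI[of _ k]) (auto simp: exponent_ratio_def other_def)
  next
    case False
    then have l: "l = 2" using exhaust_2 by blast
    then have "1 < liminf (\<lambda>k. ereal (exponent_ratio I \<beta> \<gamma> k))"
      using \<gamma> False by (simp add: Omega_dir_def)
    then have "\<forall>\<^sub>F k in sequentially. 1 < ereal (exponent_ratio I \<beta> \<gamma> k)"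
      by (rule less_LiminfD)
    then obtain k where "1 < ereal (exponent_ratio I \<beta> \<gamma> k)" "1 \<le> k"
      unfolding eventually_sequentially by (meson nle_le order_refl)
    then show ?thesis
      using False l pos[of k] by (intro exI[of _ k]) (auto simp: exponent_ratio_def other_def)
  qed
  then show ?thesis using letter_freq_prob[OF I] by blast
qed

lemma wide_letter:
  assumes "w \<in> prob_vectors I" "lyap l w < lyap (other l) w"
  shows "\<exists>i\<in>I. \<beta> i (other l) < \<beta> i l"
proof (rule ccontr)
  assume "\<not> ?thesis"
  then have "(\<Sum>i\<in>I. w i * ln (\<beta> i l)) \<le> (\<Sum>i\<in>I. w i * ln (\<beta> i (other l)))"
    using prob_vector_nonneg[OF assms(1)] ratio_pos by (intro sum_mono mult_left_mono) (auto simp: not_less)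
  then show False using assms(2) by (simp add: chi_def)
qed

text \<open>
  Suppose the sum equals \<open>1\<close>.  Then its summands form a probability vector \<open>w\<close> at which the formula in
  direction \<open>a\<close> has the value \<open>s\<^sub>a = pdim a + tdim a\<close>.  If \<open>w\<close> is admissible for \<open>d\<^sub>a\<close>, then \<open>d\<^sub>a \<ge> s\<^sub>a > s\<^sub>b \<ge> d\<^sub>b\<close>,
  a contradiction.  Otherwise the exponent in direction \<open>b\<close> is the smaller one; then subadditivity
  of entropy makes the formula in direction \<open>b\<close> at least as large as that in direction \<open>a\<close>, so that
  \<open>s\<^sub>b \<ge> s\<^sub>a\<close>.
\<close>

lemma nonuniform_columns:
  assumes d_less: "d_dir I \<beta> d a < d_dir I \<beta> d (other a)"
    and s_less: "pdim (other a) + tdim (other a) < pdim a + tdim a"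
    and ne: "prob_vectors_dir I \<beta> (other a) \<noteq> {}"
  shows "(\<Sum>i\<in>I. \<beta> i a powr pdim a * \<beta> i (other a) powr tdim a) < 1"
proof (rule ccontr)
  let ?b = "other a"
  let ?w = "\<lambda>i. \<beta> i a powr pdim a * \<beta> i ?b powr tdim a"
  assume "\<not> ?thesis"
  then have sum: "(\<Sum>i\<in>I. ?w i) = 1" using weighted_sum_le_1[of a] by simp
  then have w: "?w \<in> prob_vectors I" by (simp add: prob_vectors_def)
  have ev: "eta_vector ?w L = class_ratio a L powr pdim a * (\<Sum>i\<in>L. \<beta> i ?b powr tdim a)" if "L \<in> classes a" for L
    unfolding eta_vector_def sum_distrib_left by (intro sum.cong refl) (use class_ratio_eq[OF that] in simp)
  have ev_le: "eta_vector ?w L \<le> class_ratio a L powr pdim a" if "L \<in> classes a" for L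
    unfolding ev[OF that] using column_sum_le_1[OF that] by (simp add: mult_left_le)
  have ev_eq: "eta_vector ?w L = class_ratio a L powr pdim a" if L: "L \<in> classes a" for L
  proof (rule ccontr)
    assume "eta_vector ?w L \<noteq> class_ratio a L powr pdim a"
    then have "eta_vector ?w L < class_ratio a L powr pdim a" using ev_le[OF L] by simp
    then have "(\<Sum>L\<in>classes a. eta_vector ?w L) < (\<Sum>L\<in>classes a. class_ratio a L powr pdim a)"
      using L ev_le finite_classes by (intro sum_strict_mono_ex1) auto
    then show False using eta_vector_sum[OF w, of a] pdim_sum[of a] by simp
  qed
  have E: "ent_eta a ?w = pdim a * lyap a ?w"
  proof -
    have "ent_eta a ?w = - (\<Sum>i\<in>I. pdim a * (?w i * ln (\<beta> i a)))"
      unfolding ent_eta_alt by (intro arg_cong[of _ _ uminus] sum.cong refl) (use ratio_pos in \<open>simp add: ev_eq cls_in class_ratio_cls ln_powr\<close>)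
    then show ?thesis by (simp add: chi_def sum_distrib_left)
  qed
  have H: "shannon_entropy I ?w - ent_eta a ?w = tdim a * lyap ?b ?w"
  proof -
    have "?w i * ln (?w i) = pdim a * (?w i * ln (\<beta> i a)) + tdim a * (?w i * ln (\<beta> i ?b))" if "i \<in> I" for i
      using ratio_pos[OF that, of a] ratio_pos[OF that, of ?b] by (simp add: ln_mult ln_powr algebra_simps)
    then have "shannon_entropy I ?w = - (\<Sum>i\<in>I. pdim a * (?w i * ln (\<beta> i a)) + tdim a * (?w i * ln (\<beta> i ?b)))"
      unfolding shannon_entropy_def by (simp cong: sum.cong)
    also have "\<dots> = pdim a * lyap a ?w + tdim a * lyap ?b ?w"
      by (simp add: chi_def sum.distrib sum_distrib_left)
    finally show ?thesis using E by simp
  qed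
  note pos = chi_pos[OF w, of a] chi_pos[OF w, of ?b]
  have fa: "dim_formula a ?w = pdim a + tdim a"
    unfolding dim_formula_def using E H pos by simp
  show False
  proof (cases "lyap a ?w \<le> lyap ?b ?w")
    case True
    then have "pdim a + tdim a \<le> d_dir I \<beta> d a"
      using dim_formula_le_d_dir[of ?w a] w fa by (simp add: prob_vectors_dir_def)
    moreover have "d_dir I \<beta> d ?b \<le> pdim ?b + tdim ?b" by (rule d_dir_le[OF ne])
    ultimately show False using d_less s_less by linarith
  next
    case False
    define h ea eb xa xb where "h = shannon_entropy I ?w" "ea = ent_eta a ?w" "eb = ent_eta ?b ?w"
      "xa = lyap a ?w" "xb = lyap ?b ?w"
    have "dim_formula ?b ?w - dim_formula a ?w = eb / xb + (h - eb) / xa - (ea / xa + (h - ea) / xb)"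
      by (simp add: dim_formula_def other_other h_ea_eb_xa_xb_def)
    also have "\<dots> = (1 / xb - 1 / xa) * (ea + eb - h)"
      by (simp add: field_simps diff_divide_distrib add_divide_distrib)
    also have "\<dots> \<ge> 0"
    proof (rule mult_nonneg_nonneg)
      show "0 \<le> 1 / xb - 1 / xa" using False pos by (simp add: h_ea_eb_xa_xb_def frac_le)
      show "0 \<le> ea + eb - h" using entropy_subadditive[OF w, of a] by (simp add: h_ea_eb_xa_xb_def)
    qed
    finally show False using fa dim_formula_le[OF w, of ?b] s_less by linarith
  qed
qed

text \<open>
  At exponent \<open>0\<close> the sum is at least \<open>1\<close>, so by continuity it takes the value \<open>1\<close> before \<open>tdim a\<close>.
\<close>

lemma smaller_exponent:
  assumes "(\<Sum>i\<in>I. \<beta> i a powr pdim a * \<beta> i (other a) powr tdim a) < 1"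
  obtains t' where "0 \<le> t'" "t' < tdim a" "(\<Sum>i\<in>I. \<beta> i a powr pdim a * \<beta> i (other a) powr t') \<le> 1"
proof -
  let ?f = "\<lambda>t. \<Sum>i\<in>I. \<beta> i a powr pdim a * \<beta> i (other a) powr t"
  have "1 \<le> ?f 0"
  proof -
    have "1 = (\<Sum>L\<in>classes a. class_ratio a L powr pdim a)" by (simp add: pdim_sum)
    also have "\<dots> \<le> (\<Sum>L\<in>classes a. \<Sum>i\<in>L. \<beta> i a powr pdim a)"
    proof (rule sum_mono)
      fix L assume L: "L \<in> classes a"
      then obtain i where i: "i \<in> L" using class_nonempty by blast
      have "\<beta> i a powr pdim a \<le> (\<Sum>i\<in>L. \<beta> i a powr pdim a)"
        using i finite_class[OF L] by (intro member_le_sum) auto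
      then show "class_ratio a L powr pdim a \<le> (\<Sum>i\<in>L. \<beta> i a powr pdim a)" using class_ratio_eq[OF L i] by simp
    qed
    also have "\<dots> = (\<Sum>i\<in>I. \<beta> i a powr pdim a)" by (rule sum_over_classes[symmetric])
    also have "\<dots> = ?f 0"
      by (rule sum.cong) (use ratio_pos in \<open>auto simp: order_less_le\<close>)
    finally show ?thesis .
  qed
  moreover have "continuous_on {0..tdim a} ?f"
    using ratio_pos by (intro continuous_intros) (auto simp: order_less_le)
  ultimately have "\<exists>t. 0 \<le> t \<and> t \<le> tdim a \<and> ?f t = 1"
    using assms tdim_nonneg by (intro IVT2') auto
  then obtain t where t: "0 \<le> t" "t \<le> tdim a" "?f t = 1" by blast
  then have "t \<noteq> tdim a" using assms by auto
  then show ?thesis using that t by force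
qed

section \<open>Dimension of the points that return to a region of flat cylinders\<close>

definition logB :: "2 \<Rightarrow> real^2 \<Rightarrow> nat \<Rightarrow> real" where
  "logB l x k = - ln (wratio l (itin x k))"

lemma exp_logB: "x \<in> K \<Longrightarrow> exp (- logB l x k) = wratio l (itin x k)"
  unfolding logB_def using wratio_pos[OF set_itin] by simp

lemma logB_Suc: 
  assumes "x \<in> K" 
  shows "logB l x k - ln bmax \<le> logB l x (Suc k)" "logB l x (Suc k) \<le> logB l x k - ln bmin"
proof -
  let ?i = "digit ((shift ^^ k) x)"
  have i: "?i \<in> I" using assms digit_shift shift_iter_in_K by blast
  have "logB l x (Suc k) = logB l x k - ln (\<beta> ?i l)"
    unfolding logB_def itin_Suc using wratio_pos[OF set_itin[OF assms], of l k] ratio_pos[OF i, of l] by (simp add: ln_mult)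
  moreover have "ln (\<beta> ?i l) \<le> ln bmax" "ln bmin \<le> ln (\<beta> ?i l)"
    using ratio_pos[OF i, of l] bmin_pos le_bmax[OF i, of l] bmin_le[OF i, of l] bmax_pos by simp_all
  ultimately show "logB l x k - ln bmax \<le> logB l x (Suc k)" "logB l x (Suc k) \<le> logB l x k - ln bmin"
    by linarith+
qed

lemma logB_0 [simp]: "logB l x 0 = 0"
  by (simp add: logB_def)

lemma logB_add_ge: "x \<in> K \<Longrightarrow> logB l x k + real n * - ln bmax \<le> logB l x (k + n)"
proof (induction n)
  case (Suc n)
  then show ?case using logB_Suc(1)[of x l "k + n"] by (simp add: algebra_simps)
qed simp

lemma logB_ge: "x \<in> K \<Longrightarrow> real k * - ln bmax \<le> logB l x k"
  using logB_add_ge[of x l 0 k] by simp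

lemma logB_le: "x \<in> K \<Longrightarrow> logB l x k \<le> real k * - ln bmin"
proof (induction k)
  case (Suc k)
  then show ?case using logB_Suc(2)[of x l k] by (simp add: algebra_simps)
qed simp

lemma logB_mono: "x \<in> K \<Longrightarrow> k \<le> k' \<Longrightarrow> logB l x k \<le> logB l x k'"
  using logB_add_ge[of x l k "k' - k"] ln_bmax_neg mult_nonneg_nonneg[of "real (k' - k)" "- ln bmax"] by simp

text \<open>
  Dictionary between words and probability vectors: the entropies and exponents of the empirical
  vector are those of the word, divided by its length.
\<close>

lemma word_frequency:
  assumes xs: "set xs \<subseteq> I" "xs \<noteq> []"
  defines "w \<equiv> \<lambda>i. real (count_list xs i) / real (length xs)"
  shows "w \<in> prob_vectors I"
    and "word_ent xs = real (length xs) * shannon_entropy I w"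
    and "word_ent (map (cls l) xs) = real (length xs) * ent_eta l w"
    and "- ln (wratio l xs) = real (length xs) * lyap l w"
proof -
  have n: "0 < real (length xs)" using xs by simp
  show w: "w \<in> prob_vectors I"
    unfolding prob_vectors_def w_def using sum_count_list[OF finite_I xs(1)] n by (simp flip: sum_divide_distrib)
  have eq: "(\<Sum>i\<leftarrow>xs. f i) = real (length xs) * (\<Sum>i\<in>I. w i * f i)" for f :: "'i \<Rightarrow> real"
    unfolding sum_list_eq_sum_count[OF finite_I xs(1)] sum_distrib_left
    by (intro sum.cong refl) (use n in \<open>simp add: w_def\<close>)
  show "word_ent xs = real (length xs) * shannon_entropy I w"
    unfolding word_ent_def eq shannon_entropy_def by (simp add: w_def sum_negf)
  have cl: "real (count_list (map (cls l) xs) (cls l i)) / real (length xs) = eta_vector w (cls l i)" if i: "i \<in> I" for i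
  proof -
    have "real (count_list (map (cls l) ys) (cls l i)) = (\<Sum>j\<leftarrow>ys. if cls l j = cls l i then 1 else 0)" for ys
      by (induction ys) auto
    moreover have mem: "cls l j = cls l i \<longleftrightarrow> j \<in> cls l i" if "j \<in> I" for j
      using in_class[OF cls_in[OF i], of j] self_in_cls[OF that, of l] by auto
    ultimately have "real (count_list (map (cls l) xs) (cls l i)) = real (length xs) * (\<Sum>j\<in>I. w j * (if cls l j = cls l i then 1 else 0))"
      using eq by simp
    also have "(\<Sum>j\<in>I. w j * (if cls l j = cls l i then 1 else 0)) = (\<Sum>j\<in>I. if j \<in> cls l i then w j else 0)"
      by (intro sum.cong refl) (simp add: mem)
    also have "\<dots> = eta_vector w (cls l i)"
      unfolding eta_vector_def using finite_I class_subset[OF cls_in[OF i]] by (simp add: sum.If_cases Int_absorb1)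
    finally show ?thesis using n by simp
  qed
  have "word_ent (map (cls l) xs) = (\<Sum>i\<leftarrow>xs. - ln (real (count_list (map (cls l) xs) (cls l i)) / real (length xs)))"
    unfolding word_ent_def by (simp add: comp_def)
  also have "\<dots> = (\<Sum>i\<leftarrow>xs. - ln (eta_vector w (cls l i)))"
    using cl xs(1) by (intro arg_cong[of _ _ sum_list] map_cong) auto
  also have "\<dots> = real (length xs) * ent_eta l w"
    unfolding eq ent_eta_alt by (simp add: sum_negf)
  finally show "word_ent (map (cls l) xs) = real (length xs) * ent_eta l w" .
  have "- ln (wratio l ys) = (\<Sum>i\<leftarrow>ys. - ln (\<beta> i l))" if "set ys \<subseteq> I" for ys
    using that by (induction ys) (auto simp: ln_mult_pos ratio_pos wratio_pos)
  then have "- ln (wratio l xs) = (\<Sum>i\<leftarrow>xs. - ln (\<beta> i l))" using xs by blast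
  then show "- ln (wratio l xs) = real (length xs) * lyap l w"
    unfolding eq chi_def by (simp add: sum_negf)
qed

text \<open>
  The inequality \<open>dim_formula a w \<le> d\<^sub>a\<close> for the empirical vector \<open>w\<close> of the first \<open>k\<close> letters, multiplied
  by \<open>logB (other a) x k\<close>.
\<close>

lemma prefix_entropy_le:
  assumes x: "x \<in> K" and k: "1 \<le> k" and le: "logB a x k \<le> logB (other a) x k"
  shows "word_ent (itin x k) + word_ent (map (cls a) (itin x k)) / logB a x k * (logB (other a) x k - logB a x k)
    \<le> d_dir I \<beta> d a * logB (other a) x k"
proof -
  define w where "w = (\<lambda>i. real (count_list (itin x k) i) / real (length (itin x k)))"
  have ne: "itin x k \<noteq> []" using k by (metis length_itin list.size(3) not_one_le_zero)
  note wf = word_frequency[OF set_itin[OF x] ne, folded w_def]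
  have n: "0 < real k" using k by simp
  have La: "logB l x k = real k * lyap l w" for l using wf(4)[of l] by (simp add: logB_def)
  note pos = chi_pos[OF wf(1), of a] chi_pos[OF wf(1), of "other a"]
  have "w \<in> prob_vectors_dir I \<beta> a"
    using le n wf(1) by (simp add: La prob_vectors_dir_def)
  then have "dim_formula a w \<le> d_dir I \<beta> d a" by (rule dim_formula_le_d_dir)
  then have "dim_formula a w * logB (other a) x k \<le> d_dir I \<beta> d a * logB (other a) x k"
    using n pos by (intro mult_right_mono) (auto simp: La)
  moreover have "dim_formula a w * logB (other a) x k
     = word_ent (itin x k) + word_ent (map (cls a) (itin x k)) / logB a x k * (logB (other a) x k - logB a x k)"
    unfolding dim_formula_def La wf(2,3) using pos n by (simp add: field_simps)
  ultimately show ?thesis by simp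
qed

text \<open>
  The level at which the cylinder has become as narrow in direction \<open>a\<close> as it is high at level \<open>k\<close>.
  The letters between \<open>k\<close> and this level form the window of an approximate square.
\<close>

definition hit_time :: "2 \<Rightarrow> real^2 \<Rightarrow> nat \<Rightarrow> nat" where
  "hit_time a x k = (LEAST m. logB (other a) x k \<le> logB a x m)"

lemma hit_time_props:
  assumes x: "x \<in> K" and le: "logB a x k \<le> logB (other a) x k"
  shows "logB (other a) x k \<le> logB a x (hit_time a x k)"
    and "logB a x (hit_time a x k) \<le> logB (other a) x k - ln bmin"
    and "k \<le> hit_time a x k"
proof -
  obtain n where "logB (other a) x k / - ln bmax \<le> real n" using real_arch_simple by blast
  then have "logB (other a) x k \<le> real n * - ln bmax" using ln_bmax_neg by (simp add: field_simps)
  then have "logB (other a) x k \<le> logB a x n" using logB_ge[OF x, of n a] by linarith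
  then show h: "logB (other a) x k \<le> logB a x (hit_time a x k)"
    unfolding hit_time_def by (rule LeastI)
  show "logB a x (hit_time a x k) \<le> logB (other a) x k - ln bmin"
  proof (cases "hit_time a x k")
    case 0
    then show ?thesis using logB_ge[OF x, of k "other a"] ln_bmax_neg ln_bmin_neg
      mult_nonneg_nonneg[of "real k" "- ln bmax"] by simp
  next
    case (Suc m)
    then have "\<not> logB (other a) x k \<le> logB a x m"
      using not_less_Least[of m "\<lambda>m. logB (other a) x k \<le> logB a x m"] unfolding hit_time_def by simp
    then show ?thesis using logB_Suc(2)[OF x, of a m] Suc by simp
  qed
  show "k \<le> hit_time a x k"
  proof (rule ccontr)
    assume "\<not> k \<le> hit_time a x k"
    then have "logB a x (Suc (hit_time a x k)) \<le> logB a x k" by (intro logB_mono[OF x]) simp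
    then show False using h le logB_Suc(1)[OF x, of a "hit_time a x k"] ln_bmax_neg by linarith
  qed
qed

text \<open>
  Let \<open>f k\<close> be the entropy of the class prefix per unit of \<open>logB a\<close>.  At a bad scale the window has larger entropy
  than \<open>f k\<close> predicts, by \<open>\<epsilon> * logB (other a) x k\<close>.  The window must then be long, so the cylinder
  is far from being a square and the next level still belongs to the region.  If all large scales
  of the region were bad, the orbit would therefore remain in the region, and concavity of
  entropy would give \<open>f k + \<epsilon> / 2 \<le> f (hit_time a x k)\<close>.  Iteration contradicts the boundedness of \<open>f\<close>.
\<close>

lemma good_scale:
  assumes x: "x \<in> K" and \<epsilon>: "0 < \<epsilon>"
    and freq: "\<And>N. \<exists>k\<ge>N. logB a x k \<le> logB (other a) x k"
  shows "\<exists>k\<ge>N. logB a x k \<le> logB (other a) x k \<and>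
    word_ent (map (cls a) (itin ((shift ^^ k) x) (hit_time a x k - k)))
    \<le> word_ent (map (cls a) (itin x k)) / logB a x k * (logB (other a) x k - logB a x k) + \<epsilon> * logB (other a) x k"
proof (rule ccontr)
  assume contra: "\<not> ?thesis"
  let ?f = "\<lambda>k. word_ent (map (cls a) (itin x k)) / logB a x k"
  let ?Sa = "\<lambda>k. logB a x k" and ?Sb = "\<lambda>k. logB (other a) x k"
  let ?z = "\<lambda>k. word_ent (map (cls a) (itin ((shift ^^ k) x) (hit_time a x k - k)))"
  have bad: "?f k * (?Sb k - ?Sa k) + \<epsilon> * ?Sb k < ?z k" if "N \<le> k" "?Sa k \<le> ?Sb k" for k
    using contra that by (metis not_le)
  define c0 where "c0 = - ln bmax"
  define c1 where "c1 = - ln bmin"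
  define C where "C = ln (real (card (classes a)))"
  have c: "0 < c0" "0 < c1" using ln_bmax_neg ln_bmin_neg by (auto simp: c0_def c1_def)
  have C0: "0 \<le> C" unfolding C_def using finite_classes classes_nonempty
    by (simp add: Suc_leI card_gt_0_iff)
  have win: "word_ent (map (cls a) (itin y n)) \<le> real n * C" if "y \<in> K" for y n
  proof -
    have "set (map (cls a) (itin y n)) \<subseteq> classes a" using set_itin[OF that] cls_in by (auto simp: subset_iff)
    from word_ent_le_log_card[OF finite_classes this] show ?thesis by (simp add: C_def)
  qed
  have Sge: "real k * c0 \<le> logB l x k" for k l using logB_ge[OF x] by (simp add: c0_def)
  have Snn: "0 \<le> logB l x k" for k l
    using c by (intro order_trans[OF _ Sge[of k l]]) simp
  have f_bound: "?f k \<le> C / c0" and f_nn: "0 \<le> ?f k" for k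
  proof -
    show "0 \<le> ?f k" by (intro divide_nonneg_nonneg word_ent_nonneg Snn)
    show "?f k \<le> C / c0"
    proof (cases "k = 0")
      case True
      then show ?thesis using C0 c by (simp add: word_ent_def)
    next
      case False
      have "0 < real k * c0" using False c by simp
      then have "?f k \<le> (real k * C) / (real k * c0)"
        using win[OF x, of k] Sge[of k a] C0 by (intro frac_le) auto
      then show ?thesis using False by simp
    qed
  qed
  \<comment> \<open>a bad scale lies far inside the region\<close>
  have far: "\<epsilon> * c0 * ?Sb k \<le> C * (?Sb k - ?Sa k + c1)" if k: "N \<le> k" "?Sa k \<le> ?Sb k" for k
  proof -
    let ?n = "hit_time a x k - k"
    have "k + ?n = hit_time a x k" using hit_time_props(3)[OF x k(2)] by simp
    then have "real ?n * c0 \<le> ?Sa (hit_time a x k) - ?Sa k" using logB_add_ge[OF x, of a k ?n] by (simp add: c0_def)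
    also have "\<dots> \<le> ?Sb k - ?Sa k + c1" using hit_time_props(2)[OF x k(2)] by (simp add: c1_def)
    finally have n: "real ?n * c0 \<le> ?Sb k - ?Sa k + c1" .
    have "\<epsilon> * ?Sb k \<le> ?f k * (?Sb k - ?Sa k) + \<epsilon> * ?Sb k"
      using mult_nonneg_nonneg[OF f_nn[of k], of "?Sb k - ?Sa k"] k by linarith
    also have "\<dots> \<le> ?z k" using bad[OF k] by simp
    also have "\<dots> \<le> real ?n * C" by (rule win[OF shift_iter_in_K[OF x]])
    finally have "\<epsilon> * ?Sb k * c0 \<le> real ?n * C * c0" using c by (intro mult_right_mono) auto
    then have "\<epsilon> * ?Sb k * c0 \<le> C * (real ?n * c0)" by (simp only: mult_ac)
    also have "\<dots> \<le> C * (?Sb k - ?Sa k + c1)" using n C0 by (intro mult_left_mono) auto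
    finally show ?thesis by (simp add: mult_ac)
  qed
  obtain k1 :: nat where k1: "2 * C * c1 / (\<epsilon> * c0 * c0) < real k1" using reals_Archimedean2 by blast
  obtain k2 :: nat where k2: "2 * (C / c0 + \<epsilon>) * c1 / (\<epsilon> * c0) < real k2" using reals_Archimedean2 by blast
  \<comment> \<open>a boundary scale would have \<open>?Sb k - ?Sa k < c1\<close>, which is not far enough inside\<close>
  have stay: "?Sa (Suc k) \<le> ?Sb (Suc k)" if k: "N \<le> k" "k1 \<le> k" "?Sa k \<le> ?Sb k" for k
  proof (rule ccontr)
    assume "\<not> ?thesis"
    then have "?Sb k - ?Sa k < c1"
      using logB_Suc(2)[OF x, of a k] logB_Suc(1)[OF x, of "other a" k] ln_bmax_neg by (simp add: c1_def)
    then have "C * (?Sb k - ?Sa k + c1) \<le> C * (2 * c1)" using C0 by (intro mult_left_mono) auto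
    then have "\<epsilon> * c0 * ?Sb k \<le> 2 * C * c1" using far[OF k(1,3)] by simp
    moreover have "\<epsilon> * c0 * (real k * c0) \<le> \<epsilon> * c0 * ?Sb k" using Sge c \<epsilon> by (intro mult_left_mono) auto
    moreover have "2 * C * c1 < real k1 * (\<epsilon> * c0 * c0)"
      using k1 c \<epsilon> by (simp add: pos_divide_less_eq)
    moreover have "real k1 * (\<epsilon> * c0 * c0) \<le> real k * (\<epsilon> * c0 * c0)"
      using k(2) c \<epsilon> by (intro mult_right_mono) auto
    moreover have "\<epsilon> * c0 * (real k * c0) = real k * (\<epsilon> * c0 * c0)" by simp
    ultimately show False by linarith
  qed
  obtain k0 where k0: "max N (max k1 (max k2 1)) \<le> k0" "?Sa k0 \<le> ?Sb k0" using freq by blast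
  have region: "?Sa (k0 + n) \<le> ?Sb (k0 + n)" for n
    by (induction n) (use k0 stay in auto)
  have step: "?f k + \<epsilon> / 2 \<le> ?f (hit_time a x k)" if k: "k0 \<le> k" for k
  proof -
    have kN: "N \<le> k" "k2 \<le> k" "1 \<le> k" using k k0 by auto
    have kr: "?Sa k \<le> ?Sb k" using region[of "k - k0"] k by simp
    let ?m = "hit_time a x k"
    have m: "?m = k + (?m - k)" using hit_time_props(3)[OF x kr] by simp
    have "0 < real k * c0" using kN c by simp
    then have Sapos: "0 < ?Sa k" using Sge[of k a] by linarith
    have "?f k * ?Sb k + \<epsilon> * ?Sb k = word_ent (map (cls a) (itin x k)) + (?f k * (?Sb k - ?Sa k) + \<epsilon> * ?Sb k)"
      using Sapos by (simp add: field_simps)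
    also have "\<dots> \<le> word_ent (map (cls a) (itin x k)) + ?z k" using bad[OF kN(1) kr] by simp
    also have "\<dots> \<le> word_ent (map (cls a) (itin x k) @ map (cls a) (itin ((shift ^^ k) x) (?m - k)))"
      by (rule word_ent_append)
    also have "\<dots> = word_ent (map (cls a) (itin x ?m))"
      by (subst (2) m) (simp add: itin_add)
    finally have num: "(?f k + \<epsilon>) * ?Sb k \<le> word_ent (map (cls a) (itin x ?m))" by (simp add: algebra_simps)
    have Sm: "?Sb k \<le> ?Sa ?m" "?Sa ?m \<le> ?Sb k + c1" using hit_time_props[OF x kr] by (auto simp: c1_def)
    have Sbpos: "0 < ?Sb k" using Sapos kr by linarith
    have "(C / c0 + \<epsilon>) * c1 \<le> \<epsilon> / 2 * (real k * c0)"
    proof -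
      have "2 * (C / c0 + \<epsilon>) * c1 < real k2 * (\<epsilon> * c0)" using k2 c \<epsilon> by (simp add: pos_divide_less_eq)
      also have "\<dots> \<le> real k * (\<epsilon> * c0)" using kN c \<epsilon> by (intro mult_right_mono) auto
      finally have lt: "2 * (C / c0 + \<epsilon>) * c1 < real k * (\<epsilon> * c0)" .
      have "2 * (C / c0 + \<epsilon>) * c1 = 2 * ((C / c0 + \<epsilon>) * c1)" by (rule mult.assoc)
      moreover have "\<epsilon> / 2 * (real k * c0) = real k * (\<epsilon> * c0) / 2" by simp
      ultimately show ?thesis using lt by linarith
    qed
    also have "\<dots> \<le> \<epsilon> / 2 * ?Sb k" using Sge[of k "other a"] \<epsilon> by (intro mult_left_mono) auto
    finally have small: "(C / c0 + \<epsilon>) * c1 \<le> \<epsilon> / 2 * ?Sb k" .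
    have "(?f k + \<epsilon> / 2) * ?Sa ?m \<le> (?f k + \<epsilon> / 2) * (?Sb k + c1)"
      using Sm f_nn[of k] \<epsilon> by (intro mult_left_mono) auto
    also have "\<dots> = (?f k + \<epsilon>) * ?Sb k - \<epsilon> / 2 * ?Sb k + (?f k + \<epsilon> / 2) * c1"
      by (simp add: algebra_simps add_divide_distrib)
    also have "(?f k + \<epsilon> / 2) * c1 \<le> (C / c0 + \<epsilon>) * c1"
      using f_bound[of k] c \<epsilon> by (intro mult_right_mono) auto
    finally have "(?f k + \<epsilon> / 2) * ?Sa ?m \<le> word_ent (map (cls a) (itin x ?m))" using small num by linarith
    then show ?thesis using Sm Sbpos by (simp add: pos_le_divide_eq)
  qed
  define kk where "kk n = ((hit_time a x) ^^ n) k0" for n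
  have kk: "k0 \<le> kk n \<and> real n * (\<epsilon> / 2) \<le> ?f (kk n)" for n
  proof (induction n)
    case 0
    then show ?case using f_nn by (simp add: kk_def)
  next
    case (Suc n)
    have "?Sa (kk n) \<le> ?Sb (kk n)" using region[of "kk n - k0"] Suc by simp
    then have "kk n \<le> kk (Suc n)" using hit_time_props(3)[OF x] by (simp add: kk_def)
    moreover have "?f (kk n) + \<epsilon> / 2 \<le> ?f (kk (Suc n))" using step[of "kk n"] Suc by (simp add: kk_def)
    ultimately show ?case using Suc by (auto simp: algebra_simps)
  qed
  obtain n :: nat where "C / c0 < real n * (\<epsilon> / 2)"
    using reals_Archimedean3[OF half_gt_zero[OF \<epsilon>]] by blast
  then show False using kk[of n] f_bound[of "kk n"] by linarith
qed

lemma dist_le_of_agree: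
  assumes "x \<in> K" "y \<in> K" "map (cls l) (itin x n) = map (cls l) (itin y n)"
  shows "\<bar>x $ l - y $ l\<bar> \<le> wratio l (itin x n)"
proof -
  let ?x = "(shift ^^ n) x" and ?y = "(shift ^^ n) y"
  have "x $ l - y $ l = coord_word l (itin x n) (?x $ l) - coord_word l (itin y n) (?y $ l)"
    unfolding word_map_nth[symmetric] by (simp only: word_map_itin assms)
  also have "\<dots> = wratio l (itin x n) * (?x $ l - ?y $ l)"
    unfolding coord_word_cong(1)[OF set_itin[OF assms(1)] set_itin[OF assms(2)] assms(3), symmetric] by (rule coord_word_diff)
  finally have "\<bar>x $ l - y $ l\<bar> = wratio l (itin x n) * \<bar>?x $ l - ?y $ l\<bar>"
    using wratio_pos[OF set_itin[OF assms(1)], of l n] by (simp add: abs_mult)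
  also have "\<dots> \<le> wratio l (itin x n) * 1"
    using K_bounds[OF shift_iter_in_K[OF assms(1)], of n l] K_bounds[OF shift_iter_in_K[OF assms(2)], of n l]
      wratio_pos[OF set_itin[OF assms(1)], of l n] by (intro mult_left_mono) auto
  finally show ?thesis by simp
qed

text \<open>
  At a good scale the prefix and the window have total entropy at most \<open>(d\<^sub>a + \<epsilon>) * logB (other a) x k\<close>, so
  the approximate square contributes at most the exponential of minus this entropy times a factor
  that decays exponentially in \<open>k\<close>.  By \<open>sum_exp_word_ent\<close> the sum over all words is polynomial in \<open>k\<close>.
\<close>

lemma hausdorff_measure_zero_region:
  assumes s: "d_dir I \<beta> d a < s" "0 < s"
    and A: "A \<subseteq> K" "\<And>x N. x \<in> A \<Longrightarrow> \<exists>k\<ge>N. logB a x k \<le> logB (other a) x k"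
  shows "hausdorff_measure s A = 0"
proof -
  let ?b = "other a"
  define \<epsilon> where "\<epsilon> = (s - d_dir I \<beta> d a) / 2"
  define D where "D = d_dir I \<beta> d a + \<epsilon>"
  have \<epsilon>: "0 < \<epsilon>" "s = D + \<epsilon>" using s by (auto simp: \<epsilon>_def D_def field_simps)
  define c0 where "c0 = - ln bmax"
  define c1 where "c1 = - ln bmin"
  have c: "0 < c0" "0 < c1" using ln_bmax_neg ln_bmin_neg by (auto simp: c0_def c1_def)
  obtain C :: nat where C: "c1 / c0 \<le> real C" using real_arch_simple by blast
  \<comment> \<open>\<open>C * (k + 1)\<close> bounds the hitting time, hence the length of a window\<close>
  define J where "J k = {xs. set xs \<subseteq> I \<and> length xs = k} \<times> {zs. set zs \<subseteq> classes a \<and> length zs \<le> C * (k + 1)}" for k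
  define U where "U k j = (case j of (xs, zs) \<Rightarrow> {x \<in> K. itin x k = xs \<and>
      map (cls a) (itin ((shift ^^ k) x) (length zs)) = zs \<and>
      wratio a (itin x (k + length zs)) \<le> wratio ?b xs \<and>
      word_ent xs + word_ent zs \<le> D * - ln (wratio ?b xs)})" for k j
  have diam: "bounded (U k (xs, zs)) \<and> diameter (U k (xs, zs)) \<le> 2 * wratio ?b xs" if xs: "set xs \<subseteq> I" for k xs zs
  proof
    show "bounded (U k (xs, zs))"
      using compact_imp_bounded[OF compact_K] by (rule bounded_subset) (auto simp: U_def)
    show "diameter (U k (xs, zs)) \<le> 2 * wratio ?b xs"
    proof (rule diameter_le)
      show "U k (xs, zs) \<noteq> {} \<or> 0 \<le> 2 * wratio ?b xs" using wratio_pos[OF xs, of ?b] by auto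
      fix x y assume xy: "x \<in> U k (xs, zs)" "y \<in> U k (xs, zs)"
      then have K: "x \<in> K" "y \<in> K" and eq: "itin x k = xs" "itin y k = xs"
        "map (cls a) (itin x (k + length zs)) = map (cls a) (itin y (k + length zs))"
        and le: "wratio a (itin x (k + length zs)) \<le> wratio ?b xs"
        by (auto simp: U_def itin_add)
      have "\<bar>x $ a - y $ a\<bar> \<le> wratio ?b xs" using dist_le_of_agree[OF K eq(3)] le by linarith
      moreover have "\<bar>x $ ?b - y $ ?b\<bar> \<le> wratio ?b xs" using dist_le_of_agree[OF K, of ?b k] eq by simp
      ultimately show "norm (x - y) \<le> 2 * wratio ?b xs"
        using dist_le_components[of x y a] by (simp add: dist_norm)
    qed
  qed
  define e where "e k = 2 powr s * real (C + 1) ^ (card (classes a) + 1) *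
      (real (k + 1) ^ (card I + (card (classes a) + 1)) * exp (- (\<epsilon> * c0) * real k))" for k
  show ?thesis
  proof (rule hausdorff_measure_zeroI[where J = J and U = U and r = "\<lambda>k. 2 * bmax ^ k" and e = e])
    show "finite (J k)" for k
      unfolding J_def using finite_I finite_classes by (intro finite_cartesian_product finite_lists_length_eq finite_lists_length_le)
    show "bounded (U k j) \<and> diameter (U k j) \<le> 2 * bmax ^ k" if j: "j \<in> J k" for k j
    proof -
      obtain xs zs where j': "j = (xs, zs)" "set xs \<subseteq> I" "length xs = k" using j by (auto simp: J_def)
      then show ?thesis using diam[OF j'(2), of k zs] wratio_le_bmax_power[OF j'(2), of ?b] by simp
    qed
    show "(\<lambda>k. 2 * bmax ^ k) \<longlonglongrightarrow> 0"
      using bmax_pos bmax_less_1 by (intro tendsto_mult_right_zero LIMSEQ_power_zero) auto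
    show "summable e"
      unfolding e_def using \<epsilon> c by (intro summable_mult summable_poly_exp) simp
    show "(\<Sum>j\<in>J k. diameter_power s (U k j)) \<le> e k" for k
    proof -
      have dp: "diameter_power s (U k j) \<le> 2 powr s * exp (- (\<epsilon> * c0) * real k) * (exp (- word_ent (fst j)) * exp (- word_ent (snd j)))"
        if j: "j \<in> J k" for j
      proof (cases "U k j = {}")
        case True
        then show ?thesis by (simp add: diameter_power_def)
      next
        case False
        obtain xs zs where j': "j = (xs, zs)" "set xs \<subseteq> I" "length xs = k" using j by (auto simp: J_def)
        have B: "0 < wratio ?b xs" using wratio_pos[OF j'(2)] .
        have L: "real k * c0 \<le> - ln (wratio ?b xs)"
        proof -
          have "ln (wratio ?b xs) \<le> ln (bmax ^ k)" using wratio_le_bmax_power[OF j'(2), of ?b] B j'(3) by (intro ln_mono) auto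
          then show ?thesis using bmax_pos by (simp add: ln_realpow c0_def)
        qed
        have le: "word_ent xs + word_ent zs \<le> D * - ln (wratio ?b xs)" using False by (auto simp: U_def j')
        have "diameter_power s (U k j) = diameter (U k j) powr s"
          using False s by (simp add: diameter_power_def)
        also have "\<dots> \<le> (2 * wratio ?b xs) powr s"
          using diam[OF j'(2), of k zs] s by (intro powr_mono2) (auto simp: j' diameter_ge_0)
        also have "\<dots> = 2 powr s * exp (- (s * - ln (wratio ?b xs)))"
          using B by (simp add: powr_mult) (simp add: powr_def)
        also have "\<dots> \<le> 2 powr s * exp (- (word_ent xs + word_ent zs + \<epsilon> * (real k * c0)))"
        proof -
          have "\<epsilon> * (real k * c0) \<le> \<epsilon> * - ln (wratio ?b xs)" using L \<epsilon>(1) by (intro mult_left_mono) auto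
          then have "word_ent xs + word_ent zs + \<epsilon> * (real k * c0) \<le> s * - ln (wratio ?b xs)"
            using le unfolding \<epsilon>(2) distrib_right by linarith
          then show ?thesis by simp
        qed
        also have "\<dots> = 2 powr s * exp (- (\<epsilon> * c0) * real k) * (exp (- word_ent xs) * exp (- word_ent zs))"
          by (simp add: mult.assoc flip: exp_add)
        finally show ?thesis by (simp add: j')
      qed
      let ?X = "{xs. set xs \<subseteq> I \<and> length xs = k}" and ?Z = "{zs. set zs \<subseteq> classes a \<and> length zs \<le> C * (k + 1)}"
      have "(\<Sum>j\<in>J k. diameter_power s (U k j)) \<le> (\<Sum>j\<in>J k. 2 powr s * exp (- (\<epsilon> * c0) * real k) * (exp (- word_ent (fst j)) * exp (- word_ent (snd j))))"
        by (rule sum_mono) (rule dp)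
      also have "\<dots> = 2 powr s * exp (- (\<epsilon> * c0) * real k) * (\<Sum>(xs, zs)\<in>?X \<times> ?Z. exp (- word_ent xs) * exp (- word_ent zs))"
        by (simp add: J_def sum_distrib_left case_prod_unfold)
      also have "(\<Sum>(xs, zs)\<in>?X \<times> ?Z. exp (- word_ent xs) * exp (- word_ent zs)) = (\<Sum>xs\<in>?X. exp (- word_ent xs)) * (\<Sum>zs\<in>?Z. exp (- word_ent zs))"
        by (simp add: sum_product sum.cartesian_product)
      also have "\<dots> \<le> real (k + 1) ^ card I * real (C * (k + 1) + 1) ^ (card (classes a) + 1)"
        by (intro mult_mono sum_exp_word_ent sum_exp_word_ent_le finite_I finite_classes) (auto intro: sum_nonneg)
      also have "\<dots> \<le> real (k + 1) ^ card I * (real (C + 1) * real (k + 1)) ^ (card (classes a) + 1)"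
      proof (intro mult_left_mono power_mono)
        have "C * (k + 1) + 1 \<le> (C + 1) * (k + 1)" by simp
        then show "real (C * (k + 1) + 1) \<le> real (C + 1) * real (k + 1)"
          unfolding of_nat_mult[symmetric] by (simp only: of_nat_le_iff)
      qed auto
      also have "2 powr s * exp (- (\<epsilon> * c0) * real k) * \<dots> = e k"
        unfolding e_def power_mult_distrib power_add by (simp only: mult_ac)
      finally show ?thesis by (simp add: mult_left_mono)
    qed
    fix x N assume x: "x \<in> A"
    then have xK: "x \<in> K" using A by blast
    obtain k where k: "max N 1 \<le> k" "logB a x k \<le> logB ?b x k"
      "word_ent (map (cls a) (itin ((shift ^^ k) x) (hit_time a x k - k)))
       \<le> word_ent (map (cls a) (itin x k)) / logB a x k * (logB ?b x k - logB a x k) + \<epsilon> * logB ?b x k"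
      using good_scale[OF xK \<epsilon>(1) A(2)[OF x]] by blast
    define xs where "xs = itin x k"
    define zs where "zs = map (cls a) (itin ((shift ^^ k) x) (hit_time a x k - k))"
    note hp = hit_time_props[OF xK k(2)]
    have len: "k + length zs = hit_time a x k" using hp(3) by (simp add: zs_def)
    have "real (hit_time a x k) * c0 \<le> logB a x (hit_time a x k)" using logB_ge[OF xK] by (simp add: c0_def)
    also have "\<dots> \<le> real k * c1 + c1" using hp(2) logB_le[OF xK, of ?b k] by (simp add: c1_def)
    finally have "real (hit_time a x k) \<le> c1 / c0 * real (k + 1)" using c by (simp add: field_simps)
    also have "\<dots> \<le> real C * real (k + 1)" using C by (intro mult_right_mono) auto
    finally have "real (hit_time a x k) \<le> real (C * (k + 1))" by (simp only: of_nat_mult)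
    then have "length zs \<le> C * (k + 1)" using len by linarith
    moreover have "set xs \<subseteq> I" "length xs = k" using set_itin[OF xK] by (auto simp: xs_def)
    moreover have "set zs \<subseteq> classes a"
      using set_itin[OF shift_iter_in_K[OF xK]] cls_in by (auto simp: zs_def subset_iff)
    ultimately have "(xs, zs) \<in> J k" by (simp add: J_def)
    moreover have "x \<in> U k (xs, zs)"
    proof -
      have "wratio a (itin x (k + length zs)) \<le> wratio ?b xs"
        unfolding len xs_def exp_logB[OF xK, symmetric] using hp(1) by simp
      moreover have "word_ent xs + word_ent zs \<le> D * - ln (wratio ?b xs)"
        using prefix_entropy_le[OF xK _ k(2)] k(1,3)
        by (simp add: xs_def zs_def D_def distrib_right logB_def[symmetric] algebra_simps)
      ultimately show ?thesis using xK by (simp add: U_def xs_def zs_def)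
    qed
    ultimately show "\<exists>k\<ge>N. \<exists>j\<in>J k. x \<in> U k j" using k(1) by (intro exI[of _ k]) auto
  qed
qed

section \<open>Homogeneous subsets of the carpet\<close>

lemma word_gap:
  assumes xs: "set xs \<subseteq> I" "set ys \<subseteq> I" "length xs = N" "length ys = N"
    and neq: "map (cls l) xs \<noteq> map (cls l) ys" and st: "s \<in> eta l K" "t \<in> eta l K"
  shows "gap * bmin ^ N \<le> \<bar>coord_word l xs s - coord_word l ys t\<bar>"
proof -
  have ex: "\<exists>k<N. cls l (xs ! k) \<noteq> cls l (ys ! k)"
    using neq xs by (auto simp: list_eq_iff_nth_eq)
  define k where "k = (LEAST k. k < N \<and> cls l (xs ! k) \<noteq> cls l (ys ! k))"
  have k: "k < N" "cls l (xs ! k) \<noteq> cls l (ys ! k)" using LeastI_ex[OF ex] unfolding k_def by auto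
  have eq: "cls l (xs ! m) = cls l (ys ! m)" if "m < k" for m
    using not_less_Least[of m "\<lambda>k. k < N \<and> cls l (xs ! k) \<noteq> cls l (ys ! k)"] that k(1) unfolding k_def by auto
  have "map (cls l) (take k xs) = map (cls l) (take k ys)"
    using eq k xs by (auto simp: list_eq_iff_nth_eq)
  from first_difference[OF xs(1,2) _ _ this k(2) st]
  have 1: "gap * wratio l (take k xs) \<le> \<bar>coord_word l xs s - coord_word l ys t\<bar>" using k xs by simp
  have sub: "set (take k xs) \<subseteq> I" using xs(1) set_take_subset[of k xs] by blast
  have "bmin ^ N \<le> bmin ^ k" using k bmin_pos bmin_less_1 by (intro power_decreasing) auto
  also have "\<dots> \<le> wratio l (take k xs)" using bmin_power_le_wratio[OF sub, of l] k xs by simp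
  finally have "gap * bmin ^ N \<le> gap * wratio l (take k xs)" using gap_pos by simp
  then show ?thesis using 1 by linarith
qed

text \<open>
  Nested compact sets; this yields a point for every sequence of words.
\<close>

lemma coding_point:
  assumes "\<And>n. set (\<omega> n) \<subseteq> I"
  shows "\<exists>x\<in>K. \<forall>n. x \<in> word_map (concat (map \<omega> [0..<n])) ` K"
proof -
  let ?F = "\<lambda>n. word_map (concat (map \<omega> [0..<n])) ` K"
  have "\<Inter>(range ?F) \<noteq> {}"
  proof (rule compact_nest)
    fix n
    have "continuous_on K (word_map xs)" for xs
      unfolding word_map_eq_diag_aff diag_aff_def by (intro continuous_intros)
    then show "compact (?F n)" using compact_K by (rule compact_continuous_image)
    show "?F n \<noteq> {}" using K_nonempty by simp
  next
    fix m n :: nat assume "m \<le> n"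
    have step: "?F (Suc n) \<subseteq> ?F n" for n
      using word_map_in_K[OF assms] by auto
    show "?F n \<subseteq> ?F m" by (rule lift_Suc_antimono_le[where f = ?F, OF step \<open>m \<le> n\<close>])
  qed
  then obtain x where "\<And>n. x \<in> ?F n" by blast
  moreover then have "x \<in> K" using \<open>\<And>n. x \<in> ?F n\<close>[of 0] by simp
  ultimately show ?thesis by blast
qed

lemma wratio_blocks:
  assumes "\<And>n. wratio l (\<omega> n) = B"
  shows "wratio l (concat (map \<omega> [0..<m])) = B ^ m"
  by (induction m) (simp_all add: assms mult.commute)

text \<open>
  As \<open>itin_classes_agree\<close>, for sequences of words of one length and one side length \<open>B\<close>.
\<close>

lemma block_agree:
  assumes W: "\<And>n. set (\<omega> n) \<subseteq> I \<and> length (\<omega> n) = N" "\<And>n. set (\<omega>' n) \<subseteq> I \<and> length (\<omega>' n) = N"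
    and B: "\<And>n. wratio l (\<omega> n) = B" "0 < B"
    and x: "\<And>n. x \<in> word_map (concat (map \<omega> [0..<n])) ` K" "\<And>n. y \<in> word_map (concat (map \<omega>' [0..<n])) ` K"
    and close: "\<And>m. m < q \<Longrightarrow> \<bar>x $ l - y $ l\<bar> < gap * bmin ^ N * B ^ m"
    and m: "m < q"
  shows "map (cls l) (\<omega> m) = map (cls l) (\<omega>' m)"
  using m
proof (induction m rule: less_induct)
  case (less m)
  let ?u = "concat (map \<omega> [0..<m])" and ?u' = "concat (map \<omega>' [0..<m])"
  have "map (cls l) (\<omega> k) = map (cls l) (\<omega>' k)" if "k < m" for k
    using less.IH[OF that] less.prems that by simp
  then have "map (map (cls l)) (map \<omega> [0..<m]) = map (map (cls l)) (map \<omega>' [0..<m])" by simp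
  then have eq: "map (cls l) ?u = map (cls l) ?u'" by (simp only: map_concat)
  have sub: "set ?u \<subseteq> I" "set ?u' \<subseteq> I" using W by auto
  obtain z where z: "z \<in> K" "x = word_map (concat (map \<omega> [0..<Suc m])) z" using x(1) by blast
  obtain z' where z': "z' \<in> K" "y = word_map (concat (map \<omega>' [0..<Suc m])) z'" using x(2) by blast
  show ?case
  proof (rule ccontr)
    assume neq: "map (cls l) (\<omega> m) \<noteq> map (cls l) (\<omega>' m)"
    have "x $ l - y $ l = coord_word l ?u (coord_word l (\<omega> m) (z $ l)) - coord_word l ?u' (coord_word l (\<omega>' m) (z' $ l))"
      unfolding z(2) z'(2) word_map_nth by simp
    also have "\<dots> = B ^ m * (coord_word l (\<omega> m) (z $ l) - coord_word l (\<omega>' m) (z' $ l))"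
      unfolding coord_word_cong(1)[OF sub eq, symmetric] coord_word_diff wratio_blocks[OF B(1)] ..
    finally have "\<bar>x $ l - y $ l\<bar> = B ^ m * \<bar>coord_word l (\<omega> m) (z $ l) - coord_word l (\<omega>' m) (z' $ l)\<bar>"
      using B(2) by (simp add: abs_mult)
    moreover have "gap * bmin ^ N \<le> \<bar>coord_word l (\<omega> m) (z $ l) - coord_word l (\<omega>' m) (z' $ l)\<bar>"
      using W neq nth_in_eta[OF z(1)] nth_in_eta[OF z'(1)] by (intro word_gap) auto
    ultimately have "gap * bmin ^ N * B ^ m \<le> \<bar>x $ l - y $ l\<bar>"
      using B(2) by (simp add: mult.commute mult_left_mono)
    then show False using close[OF less.prems] by linarith
  qed
qed

text \<open>
  Free concatenations of words from \<open>W\<close> with the uniform product measure.  The points at distance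
  less than \<open>r\<close> from a given one share its first \<open>p\<close> words and the classes of its first \<open>q\<close> words, where
  \<open>A ^ p\<close> and \<open>B ^ q\<close> are comparable to \<open>r\<close>.  The mass of this approximate square is at most
  \<open>(1 / card W) ^ p * (F / card W) ^ (q - p) = (1 / F) ^ p * (F / card W) ^ q\<close>.
\<close>

lemma hausdorff_dim_ge_homogeneous:
  assumes W: "finite W" "W \<noteq> {}" "\<And>xs. xs \<in> W \<Longrightarrow> set xs \<subseteq> I \<and> length xs = N \<and> wratio a xs = A \<and> wratio (other a) xs = B"
    and AB: "0 < A" "A \<le> B" "B < 1"
    and F: "\<And>xs. xs \<in> W \<Longrightarrow> real (card {ys \<in> W. map (cls (other a)) ys = map (cls (other a)) xs}) \<le> F" "1 \<le> F"
    and \<sigma>: "\<sigma> = ln F / - ln A + (ln (real (card W)) - ln F) / - ln B" "0 < \<sigma>"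
  shows "ereal \<sigma> \<le> hausdorff_dim K"
proof -
  let ?b = "other a"
  let ?M = "PiM UNIV (\<lambda>_ :: nat. uniform_count_measure W)"
  define s1 where "s1 = ln F / - ln A"
  define s2 where "s2 = (ln (real (card W)) - ln F) / - ln B"
  define g where "g = gap * bmin ^ N"
  have g: "0 < g" using gap_pos bmin_pos by (simp add: g_def)
  have lnAB: "ln A < 0" "ln B < 0" using AB by simp_all
  have s1: "0 \<le> s1" unfolding s1_def using F(2) lnAB by (intro divide_nonneg_pos) auto
  have cW: "0 < real (card W)" using W by (simp add: card_gt_0_iff)
  define C where "C = (1 / g) powr \<sigma> * (1 + B powr s2)"
  have C: "0 < C" using g by (simp add: C_def add_pos_nonneg)
  have pr: "prob_space (uniform_count_measure W)" using W by (intro prob_space_uniform_count_measure)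
  interpret prod: product_prob_space "\<lambda>_ :: nat. uniform_count_measure W" UNIV
    by (intro product_prob_space.intro product_sigma_finite.intro product_prob_space_axioms.intro
        prob_space_imp_sigma_finite pr)
  have space: "space ?M = {\<omega>. \<forall>n. \<omega> n \<in> W}"
    by (auto simp: space_PiM space_uniform_count_measure PiE_def)
  define P where "P \<omega> = (SOME x. x \<in> K \<and> (\<forall>n. x \<in> word_map (concat (map \<omega> [0..<n])) ` K))" for \<omega>
  have P: "P \<omega> \<in> K \<and> (\<forall>n. P \<omega> \<in> word_map (concat (map \<omega> [0..<n])) ` K)" if "\<omega> \<in> space ?M" for \<omega>
  proof -
    have "\<exists>x. x \<in> K \<and> (\<forall>n. x \<in> word_map (concat (map \<omega> [0..<n])) ` K)"
      using coding_point[of \<omega>] that W(3) unfolding space by blast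
    then show ?thesis unfolding P_def by (rule someI_ex)
  qed
  have mass: "\<exists>Q\<in>sets ?M. {\<omega> \<in> space ?M. P \<omega> \<in> U} \<subseteq> Q \<and> emeasure ?M Q \<le> ennreal (C * r powr \<sigma>)"
    if r: "0 < r" "r < g" and U: "\<And>x y. x \<in> U \<Longrightarrow> y \<in> U \<Longrightarrow> dist x y < r" for U r
  proof (cases "{\<omega> \<in> space ?M. P \<omega> \<in> U} = {}")
    case True
    then show ?thesis by (intro bexI[of _ "{}"]) auto
  next
    case False
    then obtain \<gamma> where \<gamma>: "\<gamma> \<in> space ?M" "P \<gamma> \<in> U" by blast
    have \<gamma>W: "\<gamma> n \<in> W" for n using \<gamma>(1) space by blast
    obtain p where p: "g * A ^ p \<le> r" "\<And>m. m < p \<Longrightarrow> r < g * A ^ m"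
      using first_power_below[of A r g] AB r by (metis le_less_trans)
    obtain q where q: "g * B ^ q \<le> r" "\<And>m. m < q \<Longrightarrow> r < g * B ^ m" "B * r \<le> g * B ^ q"
      using first_power_below[of B r g] AB r by (metis less_le_trans)
    have "g * A ^ q \<le> g * B ^ q" using AB g by (intro mult_left_mono power_mono) auto
    then have pq: "p \<le> q" using p(2)[of q] q(1) by force
    define X where "X m = (if m < p then {\<gamma> m} else {ys \<in> W. map (cls ?b) ys = map (cls ?b) (\<gamma> m)})" for m
    have XW: "X m \<subseteq> W" for m using \<gamma>W by (auto simp: X_def)
    define Q where "Q = {\<omega> \<in> space ?M. \<forall>m\<in>{..<q}. \<omega> m \<in> X m}"
    have Xs: "X m \<in> sets (uniform_count_measure W)" for m using XW by (simp add: sets_uniform_count_measure)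
    have "(\<lambda>\<omega>. \<omega> m) -` X m \<inter> space ?M \<in> sets ?M" for m
      by (rule measurable_sets[OF _ Xs]) (rule measurable_component_singleton, simp)
    moreover have "(\<lambda>\<omega>. \<omega> m) -` X m \<inter> space ?M = {\<omega> \<in> space ?M. \<omega> m \<in> X m}" for m by blast
    ultimately have "{\<omega> \<in> space ?M. \<omega> m \<in> X m} \<in> sets ?M" for m by (simp only:)
    then have Qs: "Q \<in> sets ?M" unfolding Q_def by (intro sets.sets_Collect_finite_All) auto
    have sub: "{\<omega> \<in> space ?M. P \<omega> \<in> U} \<subseteq> Q"
    proof
      fix \<omega> assume \<omega>: "\<omega> \<in> {\<omega> \<in> space ?M. P \<omega> \<in> U}"
      then have \<omega>W: "\<omega> n \<in> W" for n using space by blast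
      have d: "\<bar>P \<gamma> $ l - P \<omega> $ l\<bar> < r" for l
        using component_dist_le[of "P \<gamma>" l "P \<omega>"] U[OF \<gamma>(2)] \<omega> by (auto intro: le_less_trans)
      have words: "set (\<gamma> n) \<subseteq> I \<and> length (\<gamma> n) = N" "set (\<omega> n) \<subseteq> I \<and> length (\<omega> n) = N"
        "wratio a (\<gamma> n) = A" "wratio ?b (\<gamma> n) = B" for n
        using W(3)[OF \<gamma>W[of n]] W(3)[OF \<omega>W[of n]] by auto
      have pts: "P \<gamma> \<in> word_map (concat (map \<gamma> [0..<n])) ` K" "P \<omega> \<in> word_map (concat (map \<omega> [0..<n])) ` K" for n
        using P[OF \<gamma>(1)] P[of \<omega>] \<omega> by auto
      have agree_a: "map (cls a) (\<gamma> m) = map (cls a) (\<omega> m)" if "m < p" for m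
        by (rule block_agree[OF words(1,2,3) AB(1) pts _ that]) (use p(2) d less_trans in \<open>fastforce simp: g_def\<close>)
      have agree_b: "map (cls ?b) (\<gamma> m) = map (cls ?b) (\<omega> m)" if "m < q" for m
        by (rule block_agree[OF words(1,2,4) _ pts _ that]) (use q(2) d less_trans AB in \<open>fastforce simp: g_def\<close>)+
      have "\<omega> m \<in> X m" if m: "m < q" for m
      proof (cases "m < p")
        case True
        have "\<gamma> m = \<omega> m"
        proof (rule letters_eqI)
          show "map (cls l) (\<gamma> m) = map (cls l) (\<omega> m)" for l
            using agree_a[OF True] agree_b[OF m] index_cases[of l a] by auto
        qed (use words in auto)
        then show ?thesis using True by (simp add: X_def)
      next
        case False
        then show ?thesis using agree_b[OF m] \<omega>W by (simp add: X_def)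
      qed
      then show "\<omega> \<in> Q" using \<omega> by (simp add: Q_def)
    qed
    have "emeasure ?M Q = (\<Prod>m\<in>{..<q}. emeasure (uniform_count_measure W) (X m))"
      unfolding Q_def using Xs by (intro prod.emeasure_PiM_Collect) auto
    also have "\<dots> = (\<Prod>m\<in>{..<q}. ennreal (real (card (X m)) / real (card W)))"
      using XW by (simp add: emeasure_uniform_count_measure[OF W(1)])
    also have "\<dots> = ennreal (\<Prod>m<q. real (card (X m)) / real (card W))"
      by (rule prod_ennreal) simp
    also have "\<dots> \<le> ennreal (C * r powr \<sigma>)"
    proof (rule ennreal_leI)
      have "(\<Prod>m<q. real (card (X m)) / real (card W)) \<le> (\<Prod>m<q. (if m < p then 1 / F else 1) * (F / real (card W)))"
      proof (rule prod_mono)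
        fix m assume "m \<in> {..<q}"
        have "real (card (X m)) \<le> (if m < p then 1 / F else 1) * F"
          using F(1)[OF \<gamma>W[of m]] F(2) by (auto simp: X_def)
        then show "0 \<le> real (card (X m)) / real (card W) \<and> real (card (X m)) / real (card W) \<le> (if m < p then 1 / F else 1) * (F / real (card W))"
          using cW by (auto simp: divide_right_mono)
      qed
      also have "\<dots> = (\<Prod>m<q. if m < p then 1 / F else 1) * (F / real (card W)) ^ q"
        by (simp only: prod.distrib prod_constant card_lessThan)
      also have "(\<Prod>m<q. if m < p then 1 / F else 1) = (\<Prod>m<p. 1 / F)"
        using pq by (intro prod.mono_neutral_cong_right) auto
      also have "\<dots> = (1 / F) ^ p" by simp
      also have "1 / F = A powr s1"
        using AB lnAB F(2) by (simp add: powr_def s1_def exp_minus inverse_eq_divide)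
      also have "F / real (card W) = B powr s2"
      proof -
        have "B powr s2 = exp (ln F - ln (real (card W)))"
          using AB lnAB by (simp add: powr_def s2_def)
        then show ?thesis using F(2) cW by (simp add: exp_diff)
      qed
      also have "(A powr s1) ^ p * (B powr s2) ^ q = (A ^ p) powr s1 * (B ^ q) powr s2"
        using AB by (simp add: powr_power powr_powr powr_realpow[symmetric] mult.commute)
      also have "\<dots> \<le> (r / g) powr s1 * ((1 + B powr s2) * (r / g) powr s2)"
      proof (rule mult_mono)
        show "(A ^ p) powr s1 \<le> (r / g) powr s1"
          using AB s1 p(1) g by (intro powr_mono2) (auto simp: field_simps)
        \<comment> \<open>for a negative exponent the lower bound \<open>B * r \<le> g * B ^ q\<close> is the relevant one\<close>
        show "(B ^ q) powr s2 \<le> (1 + B powr s2) * (r / g) powr s2"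
        proof (cases "0 \<le> s2")
          case True
          then have "(B ^ q) powr s2 \<le> (r / g) powr s2"
            using AB q(1) g by (intro powr_mono2) (auto simp: field_simps)
          then show ?thesis by (simp add: distrib_right add_increasing2)
        next
          case False
          then have "(B ^ q) powr s2 \<le> (B * (r / g)) powr s2"
            using AB q(3) g r by (intro powr_mono2') (auto simp: field_simps)
          also have "\<dots> = B powr s2 * (r / g) powr s2" using AB r g by (intro powr_mult)
          finally show ?thesis by (simp add: distrib_right add_increasing)
        qed
      qed auto
      also have "\<dots> = (1 + B powr s2) * (r / g) powr \<sigma>"
        unfolding \<sigma>(1) s1_def[symmetric] s2_def[symmetric] by (simp add: powr_add)
      also have "\<dots> = C * r powr \<sigma>"
        using r g by (simp add: C_def powr_divide)
      finally show "(\<Prod>m<q. real (card (X m)) / real (card W)) \<le> C * r powr \<sigma>" .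
    qed
    finally show ?thesis using Qs sub by blast
  qed
  show ?thesis
    by (rule mass_distribution_principle[OF prod.P.prob_space_axioms _ C g \<sigma>(2) mass]) (use P in auto)
qed

text \<open>
  Here \<open>W\<close> consists of all words with letter counts \<open>c\<close>.  Its size is a multinomial coefficient.  The words of \<open>W\<close>
  over a given word of classes all have the same probability \<open>exp (- n * (H(u) - H(\<eta> u)))\<close> under the
  conditional product measure, so their number is at most the reciprocal of this.
\<close>

lemma hausdorff_dim_ge_type_class:
  fixes c :: "'i \<Rightarrow> nat"
  defines "n \<equiv> \<Sum>i\<in>I. c i"
  defines "u \<equiv> \<lambda>i. real (c i) / real n"
  assumes c: "\<And>i. i \<notin> I \<Longrightarrow> c i = 0" and n: "1 \<le> n"
    and lyap: "lyap (other a) u < lyap a u"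
    and pos: "0 < dim_formula (other a) u - real (card I) * (ln (real (n + 1)) + 1) / (real n * lyap (other a) u)"
  shows "ereal (dim_formula (other a) u - real (card I) * (ln (real (n + 1)) + 1) / (real n * lyap (other a) u))
    \<le> hausdorff_dim K"
proof -
  let ?b = "other a"
  define M where "M = (\<Sum>i\<in>I. replicate_mset (c i) i)"
  define W where "W = permutations_of_multiset M"
  have nr: "0 < real n" using n by simp
  have cM: "count M i = c i" for i
    unfolding M_def count_sum using c finite_I by (simp add: sum.delta)
  have W: "finite W" "W \<noteq> {}"
    unfolding W_def by simp_all
  have count: "count_list xs i = c i" and len: "length xs = n" and setI: "set xs \<subseteq> I" if "xs \<in> W" for xs i
  proof -
    have m: "mset xs = M" using that by (simp add: W_def permutations_of_multiset_def)
    show cl: "count_list xs i = c i" for i using m cM[of i] by (simp add: count_mset flip: m)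
    show sI: "set xs \<subseteq> I"
    proof
      fix i assume "i \<in> set xs"
      then have "0 < c i" using count_list_pos[of i xs] cl by simp
      then show "i \<in> I" using c[of i] by fastforce
    qed
    show "length xs = n"
      using sum_count_list[OF finite_I sI] cl by (simp add: n_def flip: of_nat_sum)
  qed
  have ne: "xs \<noteq> []" if "xs \<in> W" for xs using len[OF that] n by auto
  have freq: "u \<in> prob_vectors I" "- ln (wratio l xs) = real n * lyap l u" if "xs \<in> W" for xs l
    using word_frequency(1,4)[OF setI[OF that] ne[OF that]] by (simp_all add: count[OF that] len[OF that] u_def)
  obtain xs0 where xs0: "xs0 \<in> W" using W by blast
  have u: "u \<in> prob_vectors I" by (rule freq(1)[OF xs0])
  note lpos = chi_pos[OF u, of a] chi_pos[OF u, of ?b]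
  let ?D = "shannon_entropy I u - ent_eta ?b u"
  define A where "A = exp (- (real n * lyap a u))"
  define B where "B = exp (- (real n * lyap ?b u))"
  define F where "F = exp (real n * ?D)"
  have lnAB: "- ln A = real n * lyap a u" "- ln B = real n * lyap ?b u" "ln F = real n * ?D"
    by (simp_all add: A_def B_def F_def)
  have wratio: "wratio a xs = A" "wratio ?b xs = B" if "xs \<in> W" for xs
    unfolding A_def B_def freq(2)[OF that, symmetric]
    using wratio_pos[OF setI[OF that], of a] wratio_pos[OF setI[OF that], of ?b] by simp_all
  \<comment> \<open>size of the fibres\<close>
  \<comment> \<open>the conditional probability of a letter given its class\<close>
  define q where "q y = u y / eta_vector u (cls ?b y)" for y
  have q_prod: "prod_list (map q ys) = exp (- (real n * ?D))" if ys: "ys \<in> W" for ys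
  proof -
    have upos: "0 < u y" if "y \<in> set ys" for y
      using count_list_pos[OF that] count[OF ys] nr by (simp add: u_def)
    have evpos: "0 < eta_vector u (cls ?b y)" if "y \<in> I" "0 < u y" for y
      using le_eta_vector[OF u cls_in[OF that(1)] self_in_cls[OF that(1)], of ?b] that by simp
    have qpos: "0 < q y" if "y \<in> set ys" for y
      using upos[OF that] evpos[of y] setI[OF ys] that by (auto simp: q_def)
    have "prod_list (map q zs) = exp (\<Sum>y\<leftarrow>zs. ln (q y))" if "\<And>y. y \<in> set zs \<Longrightarrow> 0 < q y" for zs
      using that by (induction zs) (auto simp: exp_add)
    then have "prod_list (map q ys) = exp (\<Sum>y\<leftarrow>ys. ln (q y))" using qpos by blast
    also have "(\<Sum>y\<leftarrow>ys. ln (q y)) = (\<Sum>y\<in>I. real (c y) * ln (q y))"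
      using sum_list_eq_sum_count[OF finite_I setI[OF ys]] count[OF ys] by simp
    also have "\<dots> = (\<Sum>y\<in>I. real n * (u y * ln (u y) - u y * ln (eta_vector u (cls ?b y))))"
    proof (rule sum.cong)
      fix y assume y: "y \<in> I"
      show "real (c y) * ln (q y) = real n * (u y * ln (u y) - u y * ln (eta_vector u (cls ?b y)))"
      proof (cases "c y = 0")
        case False
        then have "0 < u y" using nr by (simp add: u_def)
        moreover have "real (c y) = real n * u y" using nr by (simp add: u_def)
        ultimately show ?thesis using evpos[OF y] by (simp add: q_def ln_div algebra_simps)
      qed (simp add: u_def)
    qed simp
    also have "\<dots> = - (real n * ?D)"
      unfolding ent_eta_alt unfolding shannon_entropy_def
      by (simp add: sum_subtractf flip: sum_distrib_left) (simp add: algebra_simps)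
    finally show ?thesis .
  qed
  have q_nn: "0 \<le> q y" if "y \<in> I" for y
    unfolding q_def using eta_vector_nonneg[OF u cls_in[OF that]] by (simp add: u_def)
  have fibre: "real (card {ys \<in> W. map (cls ?b) ys = map (cls ?b) xs}) \<le> F" if xs: "xs \<in> W" for xs
  proof -
    let ?zs = "map (cls ?b) xs"
    let ?S = "{ys \<in> W. map (cls ?b) ys = ?zs}" and ?T = "{ys. set ys \<subseteq> I \<and> map (cls ?b) ys = ?zs}"
    have "?T \<subseteq> {ys. set ys \<subseteq> I \<and> length ys = length ?zs}" by (auto dest: map_eq_imp_length_eq)
    then have finT: "finite ?T" using finite_lists_length_eq[OF finite_I] finite_subset by blast
    have "real (card ?S) * exp (- (real n * ?D)) = (\<Sum>ys\<in>?S. prod_list (map q ys))"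
      using q_prod by simp
    also have "\<dots> \<le> (\<Sum>ys\<in>?T. prod_list (map q ys))"
      using finT setI q_nn by (intro sum_mono2) (auto intro!: prod_list_nonneg simp: subset_iff)
    also have "\<dots> = prod_list (map (\<lambda>z. \<Sum>y\<in>{y\<in>I. cls ?b y = z}. q y) ?zs)"
      by (rule sum_fibre_prod[OF finite_I])
    also have "\<dots> \<le> 1"
    proof -
      have one: "0 \<le> (\<Sum>y\<in>{y\<in>I. cls ?b y = z}. q y) \<and> (\<Sum>y\<in>{y\<in>I. cls ?b y = z}. q y) \<le> 1"
        if z: "z \<in> classes ?b" for z
      proof
        show "0 \<le> (\<Sum>y\<in>{y\<in>I. cls ?b y = z}. q y)" using q_nn by (intro sum_nonneg) auto
        have "{y\<in>I. cls ?b y = z} = z" using in_class[OF z] self_in_cls by blast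
        then have "(\<Sum>y\<in>{y\<in>I. cls ?b y = z}. q y) = (\<Sum>y\<in>z. u y / eta_vector u z)"
          using in_class[OF z] by (intro sum.cong) (auto simp: q_def)
        also have "\<dots> = eta_vector u z / eta_vector u z"
          unfolding eta_vector_def by (rule sum_divide_distrib[symmetric])
        also have "\<dots> \<le> 1" by simp
        finally show "(\<Sum>y\<in>{y\<in>I. cls ?b y = z}. q y) \<le> 1" .
      qed
      have "prod_list (map f zs) \<le> 1" if "\<And>z. z \<in> set zs \<Longrightarrow> 0 \<le> f z \<and> f z \<le> 1" for zs and f :: "'i set \<Rightarrow> real"
        using that by (induction zs) (auto intro!: mult_le_one prod_list_nonneg)
      moreover have "set ?zs \<subseteq> classes ?b" using setI[OF xs] cls_in by auto
      ultimately show ?thesis using one by (meson subsetD)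
    qed
    finally have "real (card ?S) * exp (- (real n * ?D)) * exp (real n * ?D) \<le> 1 * exp (real n * ?D)"
      by (rule mult_right_mono) simp
    then show ?thesis by (simp add: F_def mult.assoc flip: exp_add)
  qed
  \<comment> \<open>size of the type class\<close>
  have card: "real n * shannon_entropy I u - real (card I) * (ln (real (n + 1)) + 1) \<le> ln (real (card W))"
  proof -
    have "real n * shannon_entropy I u = - (\<Sum>i\<in>I. real n * (u i * ln (u i)))"
      by (simp add: shannon_entropy_def sum_distrib_left)
    also have "(\<Sum>i\<in>I. real n * (u i * ln (u i))) = (\<Sum>i\<in>I. real (c i) * ln (real (c i)) - real (c i) * ln (real n))"
    proof (rule sum.cong)
      fix i
      show "real n * (u i * ln (u i)) = real (c i) * ln (real (c i)) - real (c i) * ln (real n)"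
        using nr by (cases "c i = 0") (simp_all add: u_def ln_div algebra_simps)
    qed simp
    also have "\<dots> = (\<Sum>i\<in>I. real (c i) * ln (real (c i))) - real n * ln (real n)"
      by (simp add: sum_subtractf n_def flip: sum_distrib_right)
    finally have "real n * shannon_entropy I u = real n * ln (real n) - (\<Sum>i\<in>I. real (c i) * ln (real (c i)))" by simp
    then show ?thesis
      using ln_card_permutations_ge[OF finite_I, of M c n] c cM unfolding W_def n_def by (metis (no_types, lifting))
  qed
  let ?\<sigma> = "ln F / - ln A + (ln (real (card W)) - ln F) / - ln B"
  let ?err = "real (card I) * (ln (real (n + 1)) + 1)"
  have ge: "dim_formula ?b u - ?err / (real n * lyap ?b u) \<le> ?\<sigma>"
  proof -
    have "dim_formula ?b u - ?err / (real n * lyap ?b u)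
      = ?D / lyap a u + (real n * ent_eta ?b u - ?err) / (real n * lyap ?b u)"
      using nr lpos by (simp add: dim_formula_def other_other diff_divide_distrib)
    also have "\<dots> \<le> ?D / lyap a u + (ln (real (card W)) - real n * ?D) / (real n * lyap ?b u)"
      using card nr lpos by (intro add_left_mono divide_right_mono) (auto simp: algebra_simps)
    also have "\<dots> = ?\<sigma>" unfolding lnAB using nr by simp
    finally show ?thesis .
  qed
  have "ereal ?\<sigma> \<le> hausdorff_dim K"
  proof (rule hausdorff_dim_ge_homogeneous[OF W(1,2), where N = n and A = A and B = B and F = F and a = a])
    show "set xs \<subseteq> I \<and> length xs = n \<and> wratio a xs = A \<and> wratio ?b xs = B" if "xs \<in> W" for xs
      using setI[OF that] len[OF that] wratio[OF that] by simp
    show "0 < A" by (simp add: A_def)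
    show "A \<le> B" using lyap nr by (simp add: A_def B_def)
    show "B < 1" using lpos nr by (simp add: B_def)
    show "1 \<le> F" using ent_eta_le_entropy[OF u, of ?b] nr by (simp add: F_def)
    show "0 < ?\<sigma>" using ge pos by linarith
  qed (use fibre in auto)
  moreover have "ereal (dim_formula ?b u - ?err / (real n * lyap ?b u)) \<le> ereal ?\<sigma>" using ge by simp
  ultimately show ?thesis by (rule order_trans[rotated])
qed

text \<open>
  Approximate \<open>w\<close> by letter frequencies with denominators tending to infinity.  Rounding down keeps
  vanishing entries equal to zero, so that all entropies converge.
\<close>

lemma hausdorff_dim_ge_dim_formula:
  assumes w: "w \<in> prob_vectors I" and lyap: "lyap (other a) w < lyap a w"
    and T: "0 \<le> T" "T < dim_formula (other a) w"
  shows "ereal T \<le> hausdorff_dim K"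
proof -
  let ?b = "other a"
  define c where "c k i = (if i \<in> I then nat \<lfloor>real k * w i\<rfloor> else 0)" for k i
  define n where "n k = (\<Sum>i\<in>I. c k i)" for k
  define u where "u k = (\<lambda>i. real (c k i) / real (n k))" for k
  have c_lim: "(\<lambda>k. real (c k i) / real k) \<longlonglongrightarrow> w i" if "i \<in> I" for i
    using floor_frequency_tendsto[OF prob_vector_nonneg[OF w that]] that by (simp add: c_def)
  have "(\<lambda>k. \<Sum>i\<in>I. real (c k i) / real k) \<longlonglongrightarrow> (\<Sum>i\<in>I. w i)"
    by (intro tendsto_sum c_lim)
  then have n_lim: "(\<lambda>k. real (n k) / real k) \<longlonglongrightarrow> 1"
    by (simp add: n_def prob_vector_sum[OF w] flip: sum_divide_distrib)
  have u_lim: "(\<lambda>k. u k i) \<longlonglongrightarrow> w i" if "i \<in> I" for i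
  proof -
    have "(\<lambda>k. (real (c k i) / real k) / (real (n k) / real k)) \<longlonglongrightarrow> w i / 1"
      by (intro tendsto_divide c_lim[OF that] n_lim) simp
    moreover have "(real (c k i) / real k) / (real (n k) / real k) = u k i" for k
      by (cases "k = 0") (simp_all add: u_def n_def c_def)
    ultimately show ?thesis by simp
  qed
  have u_zero: "u k i = 0" if "i \<in> I" "w i = 0" for k i
    using that by (simp add: u_def c_def)
  have H_lim: "(\<lambda>k. shannon_entropy I (u k)) \<longlonglongrightarrow> shannon_entropy I w"
    unfolding shannon_entropy_def by (intro tendsto_minus tendsto_sum xlnx_tendsto u_lim) (use u_zero in auto)
  have E_lim: "(\<lambda>k. ent_eta l (u k)) \<longlonglongrightarrow> ent_eta l w" for l
    unfolding shannon_entropy_def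
  proof (intro tendsto_minus tendsto_sum xlnx_tendsto)
    fix L assume L: "L \<in> classes l"
    show "(\<lambda>k. eta_vector (u k) L) \<longlonglongrightarrow> eta_vector w L"
      unfolding eta_vector_def by (intro tendsto_sum u_lim) (use class_subset[OF L] in blast)
    assume zero: "eta_vector w L = 0"
    have "w i = 0" if i: "i \<in> L" for i
      using le_eta_vector[OF w L i] zero prob_vector_nonneg[OF w, of i] in_class[OF L i] by linarith
    then show "\<forall>k. eta_vector (u k) L = 0"
      unfolding eta_vector_def using u_zero in_class[OF L] by (intro allI sum.neutral) blast
  qed
  have lyap_lim: "(\<lambda>k. lyap l (u k)) \<longlonglongrightarrow> lyap l w" for l
    unfolding chi_def by (intro tendsto_intros u_lim)
  have pos: "lyap l w \<noteq> 0" for l using chi_pos[OF w, of l] by simp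
  have f_lim: "(\<lambda>k. dim_formula ?b (u k)) \<longlonglongrightarrow> dim_formula ?b w"
    unfolding dim_formula_def by (intro tendsto_intros E_lim H_lim lyap_lim pos)
  have "filterlim (\<lambda>k. real (n k) / real k * real k) at_top sequentially"
    by (rule filterlim_tendsto_pos_mult_at_top[OF n_lim]) (simp_all add: filterlim_real_sequentially)
  moreover have "real (n k) / real k * real k = real (n k)" for k
    by (cases "k = 0") (simp_all add: n_def c_def)
  ultimately have n_inf: "filterlim (\<lambda>k. real (n k)) at_top sequentially" by simp
  have "((\<lambda>x. real (card I) * (ln (x + 1) + 1) / x) \<longlongrightarrow> 0) at_top" by real_asymp
  from filterlim_compose[OF this n_inf]
  have "(\<lambda>k. real (card I) * (ln (real (n k) + 1) + 1) / real (n k)) \<longlonglongrightarrow> 0" .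
  then have "(\<lambda>k. dim_formula ?b (u k) - real (card I) * (ln (real (n k) + 1) + 1) / real (n k) / lyap ?b (u k))
      \<longlonglongrightarrow> dim_formula ?b w - 0 / lyap ?b w"
    by (intro tendsto_diff f_lim tendsto_divide lyap_lim pos)
  then have "\<forall>\<^sub>F k in sequentially. T < dim_formula ?b (u k) - real (card I) * (ln (real (n k) + 1) + 1) / real (n k) / lyap ?b (u k)"
    by (rule order_tendstoD(1)) (use T in simp)
  moreover have "\<forall>\<^sub>F k in sequentially. 0 < lyap a (u k) - lyap ?b (u k)"
    by (rule order_tendstoD(1)[OF tendsto_diff[OF lyap_lim lyap_lim]]) (use lyap in simp)
  moreover have "\<forall>\<^sub>F k in sequentially. 1 \<le> real (n k)"
    using n_inf unfolding filterlim_at_top by blast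
  ultimately have "\<forall>\<^sub>F k in sequentially. T < dim_formula ?b (u k) - real (card I) * (ln (real (n k) + 1) + 1) / real (n k) / lyap ?b (u k)
      \<and> 0 < lyap a (u k) - lyap ?b (u k) \<and> 1 \<le> real (n k)"
    by eventually_elim simp
  then obtain k where k: "T < dim_formula ?b (u k) - real (card I) * (ln (real (n k) + 1) + 1) / real (n k) / lyap ?b (u k)"
    "0 < lyap a (u k) - lyap ?b (u k)" "1 \<le> real (n k)"
    unfolding eventually_sequentially by (meson order_refl)
  let ?t = "dim_formula ?b (u k) - real (card I) * (ln (real (n k + 1)) + 1) / (real (n k) * lyap ?b (u k))"
  have t: "T < ?t" using k(1) by (simp add: add.commute)
  have "ereal ?t \<le> hausdorff_dim K"
  proof (rule hausdorff_dim_ge_type_class[of "c k" a, folded n_def, folded u_def])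
    show "c k i = 0" if "i \<notin> I" for i using that by (simp add: c_def)
    show "1 \<le> n k" using k(3) by simp
    show "lyap ?b (u k) < lyap a (u k)" using k(2) by simp
    show "0 < ?t" using t T by linarith
  qed
  moreover have "ereal T \<le> ereal ?t" using t by simp
  ultimately show ?thesis by (rule order_trans[rotated])
qed

end

section \<open>Points of maximal pointwise Assouad dimension\<close>

theorem theorem4p5:
  fixes I :: "'i set"
    and \<beta> d :: "'i \<Rightarrow> 2 \<Rightarrow> real"
    and K :: "(real^2) set"
    and j :: 2
  assumes carpet: "baranski_carpet I \<beta> d K"
    and ssc: "\<And>l. strong_separation I \<beta> d K l"
    and Omega_nonempty: "\<And>l. Omega_dir I \<beta> l \<noteq> {}"
    and d_less: "d_dir I \<beta> d j < d_dir I \<beta> d (other j)"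
    and assouad_greater:
      "box_dim (eta j K) + ereal (max_column_dim I \<beta> d j)
         > box_dim (eta (other j) K) + ereal (max_column_dim I \<beta> d (other j))"
  shows "hausdorff_dim {x \<in> K. pointwise_assouad_dim K x = assouad_dim K} < hausdorff_dim K"
proof -
  interpret separated_carpet I \<beta> d K
    by unfold_locales (rule carpet, rule ssc)
  let ?b = "other j"
  let ?A = "{x \<in> K. pointwise_assouad_dim K x = assouad_dim K}"
  have s_less: "pdim ?b + tdim ?b < pdim j + tdim j"
    using assouad_greater by (simp add: box_dim_eta)
  obtain v where v: "v \<in> prob_vectors I" "lyap j v < lyap ?b v"
    using Omega_dir_imp[OF Omega_nonempty[of j]] by blast
  obtain v' where v': "v' \<in> prob_vectors I" "lyap ?b v' < lyap (other ?b) v'"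
    using Omega_dir_imp[OF Omega_nonempty[of ?b]] by blast
  have ne: "prob_vectors_dir I \<beta> ?b \<noteq> {}" using v' by (auto simp: prob_vectors_dir_def)
  have d_nonneg: "0 \<le> d_dir I \<beta> d j"
    using dim_formula_le_d_dir[of v j] dim_formula_nonneg[of v j] v by (simp add: prob_vectors_dir_def)
  obtain t' where t': "0 \<le> t'" "t' < tdim j" "(\<Sum>i\<in>I. \<beta> i j powr pdim j * \<beta> i ?b powr t') \<le> 1"
    using smaller_exponent[OF nonuniform_columns[OF d_less s_less ne]] by blast
  define \<sigma> where "\<sigma> = max (pdim j + t') (pdim ?b + tdim ?b)"
  have \<sigma>: "\<sigma> < pdim j + tdim j" using t' s_less by (simp add: \<sigma>_def)
  obtain i0 where i0: "i0 \<in> I" "\<beta> i0 ?b < \<beta> i0 j" using wide_letter[OF v] by blast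
  have A: "\<exists>k\<ge>N. logB j x k \<le> logB ?b x k" if x: "x \<in> ?A" for x N
  proof (rule ccontr)
    assume none: "\<not> ?thesis"
    have xK: "x \<in> K" using x by simp
    have "wratio j (itin x k) \<le> wratio ?b (itin x k)" if "N \<le> k" for k
    proof -
      have "logB ?b x k \<le> logB j x k" using none that by (meson nle_le)
      then show ?thesis by (simp flip: exp_logB[OF xK])
    qed
    then have "pointwise_assouad_dim K x \<le> ereal \<sigma>"
      by (intro pointwise_assouad_le[OF xK t'(1,3)]) (auto simp: \<sigma>_def)
    also have "\<dots> < ereal (pdim j + tdim j)" using \<sigma> by simp
    also have "\<dots> \<le> assouad_dim K" by (rule assouad_dim_ge[OF i0])
    finally show False using x by simp
  qed
  have "\<exists>y\<in>dim_formula ?b ` prob_vectors_dir I \<beta> ?b. d_dir I \<beta> d j < y"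
    using d_less ne unfolding d_dir_alt[of ?b] by (intro less_cSupD) auto
  then obtain w where w: "w \<in> prob_vectors_dir I \<beta> ?b" "d_dir I \<beta> d j < dim_formula ?b w" by blast
  have wp: "w \<in> prob_vectors I" "lyap ?b w \<le> lyap j w" using w(1) by (auto simp: prob_vectors_dir_def other_other)
  have strict: "lyap ?b w < lyap j w"
  proof (rule ccontr)
    assume "\<not> ?thesis"
    then have eq: "lyap ?b w = lyap j w" using wp by simp
    then have "w \<in> prob_vectors_dir I \<beta> j" using wp by (simp add: prob_vectors_dir_def)
    then have "dim_formula j w \<le> d_dir I \<beta> d j" by (rule dim_formula_le_d_dir)
    moreover have "dim_formula j w = dim_formula ?b w"
      by (simp add: dim_formula_def other_other eq flip: add_divide_distrib)
    ultimately show False using w(2) by simp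
  qed
  obtain s where s: "d_dir I \<beta> d j < s" "s < dim_formula ?b w" using dense[OF w(2)] by blast
  obtain T where T: "s < T" "T < dim_formula ?b w" using dense[OF s(2)] by blast
  have "hausdorff_measure s ?A = 0"
    by (rule hausdorff_measure_zero_region[OF s(1)]) (use A s d_nonneg in auto)
  then have "hausdorff_dim ?A \<le> ereal s"
    using s d_nonneg by (intro hausdorff_dim_le) auto
  also have "\<dots> < ereal T" using T by simp
  also have "\<dots> \<le> hausdorff_dim K"
    using s T d_nonneg by (intro hausdorff_dim_ge_dim_formula[OF wp(1) strict]) auto
  finally show ?thesis .
qed

end
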